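(* Let $T:\mathbb S^1\to\mathbb S^1$ be a non-singular map and $(D_\delta)_{\delta\in[0,\bar\delta]}$ a family of $C^3$ diffeomorphisms of the circle with $D_0=Id$, for which there are $S_1,S_2\in C^3(\mathbb S^1,\mathbb R)$ with $$\frac1{|\delta|}\|D_\delta-Id-\delta S_1\|_{C^0}\xrightarrow[\delta\to0]{}0,\qquad \frac1{\delta^2}\left\|D_\delta-Id-\delta S_1-\frac{\delta^2}2S_2\right\|_{C^0}\xrightarrow[\delta\to0]{}0.$$ Consider the random dynamical system generated by $T_\delta(\omega,x)=D_\delta\circ T(x)+X_\xi(\omega)\bmod 1$, where $X_\xi$ is a centered Gaussian random variable with variance $\xi^2>0$, and the associated annealed transfer operators $L_\delta:=\rho_\xi\ast L_{D_\delta\circ T}$, $\delta\in[0,\bar\delta]$. Then linear and quadratic response hold for the stationary measure when $\delta\to0$, for the sequence of spaces $C^{k+1}(\mathbb S^1)\subset C^k(\mathbb S^1)\subset C^{k-1}(\mathbb S^1)\subset C^{k-2}(\mathbb S^1)$, for every integer $k\ge2$. That is: each $L_\delta$ has a (unique) stationary probability density $h_\delta=L_\delta h_\delta\in C^{k+1}(\mathbb S^1)$; the resolvent $(Id-L_0)^{-1}=\sum_{i\ge0}L_0^i$ is well defined and bounded on the zero-average subspaces of $C^{k-1}(\mathbb S^1)$ and of $C^{k-2}(\mathbb S^1)$; and, with $\dot L:=\rho_\xi\ast R\circ L_T$ and $\ddot L:=\rho_\xi\ast Q\circ L_T$, where $Rf:=-(fS_1)'$ and $Qf:=(fS_1^2)''-(fS_2)'$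 in the sense of distributions, $$\lim_{\delta\to0}\left\|\frac{h_\delta-h_0}\delta-(Id-L_0)^{-1}\dot Lh_0\right\|_{C^{k-1}}=0,$$ $$\lim_{\delta\to0}\left\|\frac{h_\delta-h_0-\delta(Id-L_0)^{-1}\dot Lh_0}{\delta^2}-(Id-L_0)^{-1}\left[\tfrac12\ddot Lh_0+\dot L(Id-L_0)^{-1}\dot Lh_0\right]\right\|_{C^{k-2}}=0.$$
   Context: $\mathbb S^1=\mathbb R/\mathbb Z$ with Lebesgue measure $m$. $T$ non-singular means that preimages of Lebesgue-null sets are null. For $D_\delta$ close to the identity, $D_\delta-Id$ is viewed as a real-valued function on $\mathbb S^1$ via the lift close to the identity. $L_T$ is the transfer operator (pushforward) on $L^1(\mathbb S^1)$: $\int (L_Tf)\,g\,dm=\int f\,(g\circ T)\,dm$; $L_{D_\delta\circ T}=L_{D_\delta}\circ L_T$. $\rho_\xi(x)=\frac{1}{\sqrt{2\pi}\,\xi}e^{-x^2/2\xi^2}$. For a Schwartz function $\rho$ with periodization $\tilde\rho(x)=\sum_{k\in\mathbb Z}\rho(x+k)$ and $f\in L^1(\mathbb S^1)$, $\rho\ast f(x):=\int_{\mathbb S^1}\tilde\rho(x-y)f(y)\,dy$; for a distribution $f$ on $\mathbb S^1$, $\langle\rho\ast f,\phi\rangle:=\langle f,\bar\rho\ast\phi\rangle$ for $\phi\in C^\infty(\mathbb S^1)$, with $\bar\rho(x)=\rho(-x)$ (a smooth function when $f$ is a distributional derivative of an $L^1$ function). *)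

theory Defs
  imports "HOL-Probability.Probability"
begin

text \<open>
  The circle is \<open>\<real>/\<int>\<close>. Functions on it are 1-periodic functions on the reals, integrated over the
  fundamental domain \<open>{0..<1}\<close>. Self-maps of the circle, continuous or not, are represented by
  lifts \<open>T :: real \<Rightarrow> real\<close> with \<open>T (x + 1) - T x \<in> \<int>\<close>.
\<close>

definition periodic :: "(real \<Rightarrow> real) \<Rightarrow> bool" where
  "periodic f \<longleftrightarrow> (\<forall>x. f (x + 1) = f x)"

definition circle_integral :: "(real \<Rightarrow> real) \<Rightarrow> real" where
  "circle_integral f = (LINT x:{0..<1}|lebesgue. f x)"

definition L1_circle :: "(real \<Rightarrow> real) \<Rightarrow> bool" where
  "L1_circle f \<longleftrightarrow> periodic f \<and> set_integrable lebesgue {0..<1} f"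

subsection \<open>Spaces of differentiable functions\<close>

definition C_diff :: "nat \<Rightarrow> (real \<Rightarrow> real) \<Rightarrow> bool" where
  "C_diff n f \<longleftrightarrow>
     (\<forall>i<n. \<forall>x. (deriv ^^ i) f field_differentiable (at x)) \<and>
     (\<forall>i\<le>n. continuous_on UNIV ((deriv ^^ i) f))"

definition C_circle :: "nat \<Rightarrow> (real \<Rightarrow> real) set" where
  "C_circle n = {f. periodic f \<and> C_diff n f}"

definition smooth_circle :: "(real \<Rightarrow> real) set" where
  "smooth_circle = (\<Inter>n. C_circle n)"

text \<open>
  The suprema are over a period, so they are finite for every \<open>C_diff n\<close> function, periodic or not.
\<close>

definition C_norm :: "nat \<Rightarrow> (real \<Rightarrow> real) \<Rightarrow> real" where
  "C_norm n f = (\<Sum>i\<le>n. SUP x\<in>{0..1}. \<bar>(deriv ^^ i) f x\<bar>)"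

definition zero_avg :: "nat \<Rightarrow> (real \<Rightarrow> real) set" where
  "zero_avg n = {f \<in> C_circle n. circle_integral f = 0}"

subsection \<open>Maps of the circle\<close>

text \<open>
  Null sets of the real line may be used in place of null sets of the circle: a set of reals is null
  iff the union of its integer translates is, so a circle map has null preimages of null sets iff its lift
  does. Measurability is part of the notion.
\<close>

definition nonsingular_circle_map :: "(real \<Rightarrow> real) \<Rightarrow> bool" where
  "nonsingular_circle_map T \<longleftrightarrow>
     (\<forall>x. T (x + 1) - T x \<in> \<int>) \<and> T \<in> borel_measurable lebesgue \<and>
     (\<forall>N\<in>null_sets lebesgue. T -` N \<in> null_sets lebesgue)"

text \<open>Lifts of diffeomorphisms of either orientation.\<close>

definition circle_diffeo :: "nat \<Rightarrow> (real \<Rightarrow> real) \<Rightarrow> bool" where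
  "circle_diffeo n F \<longleftrightarrow>
     ((\<forall>x. F (x + 1) = F x + 1) \<or> (\<forall>x. F (x + 1) = F x - 1)) \<and>
     bij F \<and> C_diff n F \<and> C_diff n (inv F)"

text \<open>
  The transfer operator on \<open>L\<^sup>1\<close> is determined by duality up to a null set; an arbitrary
  representative is chosen.
\<close>

definition transfer_op :: "(real \<Rightarrow> real) \<Rightarrow> (real \<Rightarrow> real) \<Rightarrow> (real \<Rightarrow> real)" where
  "transfer_op T f = (SOME h. L1_circle h \<and>
     (\<forall>g. periodic g \<and> g \<in> borel_measurable borel \<and> bounded (range g) \<longrightarrow>
        circle_integral (\<lambda>x. h x * g x) = circle_integral (\<lambda>x. f x * g (T x))))"

subsection \<open>Convolution and distributions\<close>

definition periodization :: "(real \<Rightarrow> real) \<Rightarrow> real \<Rightarrow> real" where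
  "periodization \<rho> x = (\<Sum>\<^sub>\<infinity>k\<in>(UNIV::int set). \<rho> (x + of_int k))"

definition circle_conv :: "(real \<Rightarrow> real) \<Rightarrow> (real \<Rightarrow> real) \<Rightarrow> real \<Rightarrow> real" where
  "circle_conv \<rho> f x = circle_integral (\<lambda>y. periodization \<rho> (x - y) * f y)"

text \<open>Distributions are functionals whose values matter only on \<^const>\<open>smooth_circle\<close>.\<close>

type_synonym distribution = "(real \<Rightarrow> real) \<Rightarrow> real"

definition dist_of :: "(real \<Rightarrow> real) \<Rightarrow> distribution" where
  "dist_of f \<phi> = circle_integral (\<lambda>x. f x * \<phi> x)"

definition dist_deriv :: "distribution \<Rightarrow> distribution" where
  "dist_deriv F \<phi> = - F (deriv \<phi>)"

definition dist_conv :: "(real \<Rightarrow> real) \<Rightarrow> distribution \<Rightarrow> distribution" where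
  "dist_conv \<rho> F \<phi> = F (circle_conv (\<lambda>x. \<rho> (- x)) \<phi>)"

text \<open>The smooth function that a distribution is given by, if there is one.\<close>

definition dist_fun :: "distribution \<Rightarrow> real \<Rightarrow> real" where
  "dist_fun F = (THE u. u \<in> smooth_circle \<and> (\<forall>\<phi>\<in>smooth_circle. dist_of u \<phi> = F \<phi>))"

definition R_op :: "(real \<Rightarrow> real) \<Rightarrow> (real \<Rightarrow> real) \<Rightarrow> distribution" where
  "R_op S1 f = (\<lambda>\<phi>. - dist_deriv (dist_of (\<lambda>x. f x * S1 x)) \<phi>)"

definition Q_op :: "(real \<Rightarrow> real) \<Rightarrow> (real \<Rightarrow> real) \<Rightarrow> (real \<Rightarrow> real) \<Rightarrow> distribution" where
  "Q_op S1 S2 f = (\<lambda>\<phi>. dist_deriv (dist_deriv (dist_of (\<lambda>x. f x * (S1 x)\<^sup>2))) \<phi>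
                        - dist_deriv (dist_of (\<lambda>x. f x * S2 x)) \<phi>)"

subsection \<open>Densities and resolvent\<close>

definition prob_density :: "(real \<Rightarrow> real) \<Rightarrow> bool" where
  "prob_density f \<longleftrightarrow> L1_circle f \<and> (AE x in lebesgue. 0 \<le> f x) \<and> circle_integral f = 1"

definition id_minus :: "((real \<Rightarrow> real) \<Rightarrow> (real \<Rightarrow> real)) \<Rightarrow> (real \<Rightarrow> real) \<Rightarrow> (real \<Rightarrow> real)" where
  "id_minus L f = (\<lambda>x. f x - L f x)"

definition resolvent :: "((real \<Rightarrow> real) \<Rightarrow> (real \<Rightarrow> real)) \<Rightarrow> nat \<Rightarrow> (real \<Rightarrow> real) \<Rightarrow> (real \<Rightarrow> real)" where
  "resolvent L n = inv_into (zero_avg n) (id_minus L)"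

text \<open>
  \<open>Id - L\<close> is invertible on the zero-average subspace of \<open>C\<^sup>n\<close>, its inverse is bounded, and the
  Neumann series converges to it in operator norm.
\<close>

definition resolvent_well_defined :: "((real \<Rightarrow> real) \<Rightarrow> (real \<Rightarrow> real)) \<Rightarrow> nat \<Rightarrow> bool" where
  "resolvent_well_defined L n \<longleftrightarrow>
     bij_betw (id_minus L) (zero_avg n) (zero_avg n) \<and>
     (\<exists>C. \<forall>f\<in>zero_avg n. C_norm n (resolvent L n f) \<le> C * C_norm n f) \<and>
     (\<forall>\<epsilon>>0. \<forall>\<^sub>F N in sequentially. \<forall>f\<in>zero_avg n.
        C_norm n (\<lambda>x. resolvent L n f x - (\<Sum>i<N. (L ^^ i) f x)) \<le> \<epsilon> * C_norm n f)"

end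

theory Submission
  imports Defs
begin

text \<open>
  Let \<open>P\<close> be the periodized Gaussian. By duality the annealed operator is an integral operator,
  \<open>L\<^sub>\<delta> f(x) = \<integral> P(x - D\<^sub>\<delta>(T y)) f(y) dy\<close> (\<open>circle_conv_transfer_op\<close>). The irregular map \<open>T\<close> enters
  only through the integration variable \<open>y\<close>, whereas derivatives in \<open>x\<close> fall on the smooth function \<open>P\<close>.
  Hence every \<open>L\<^sub>\<delta>\<close> is bounded from \<open>L\<^sup>1\<close> to \<open>C\<^sup>n\<close> for each \<open>n\<close>, and differences of such operators are
  as small as the differences of their kernels.

  \<^emph>\<open>Invertibility.\<close> Since \<open>P \<ge> c\<close> for some \<open>c > 0\<close>, each \<open>L\<^sub>\<delta>\<close> shrinks the \<open>L\<^sup>1\<close> norm of zero-mean functions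
  by the factor \<open>1 - c\<close>, uniformly in \<open>\<delta>\<close> (\<open>L1_contraction\<close>). The Neumann series therefore solves
  \<open>u - L u = w\<close> (\<open>neumann_solution\<close>), and writing \<open>u = w + L u\<close> upgrades the \<open>L\<^sup>1\<close> bound to
  \<open>\<parallel>u\<parallel> \<le> const \<parallel>u - L u\<parallel>\<close> in every \<open>C\<^sup>n\<close> (\<open>C_norm_a_priori\<close>). This yields the stationary density, its
  uniqueness and the resolvent.

  \<^emph>\<open>Expansion of the operators.\<close> Taylor's formula for \<open>P\<close> in the displacement \<open>D\<^sub>\<delta> t - t\<close> at \<open>t = T y\<close> shows that
  \<open>L\<^sub>\<delta> - L\<^sub>0\<close>, \<open>L\<^sub>\<delta> - L\<^sub>0 - \<delta> L'\<close> and \<open>L\<^sub>\<delta> - L\<^sub>0 - \<delta> L' - \<delta>\<^sup>2/2 L''\<close> are \<open>O(\<delta>)\<close>, \<open>O(\<delta>\<^sup>2)\<close> and \<open>o(\<delta>\<^sup>2)\<close> as operators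
  from \<open>L\<^sup>1\<close> to \<open>C\<^sup>n\<close> (\<open>kernel_expansion\<close>, \<open>operator_expansion\<close>). Here \<open>L'\<close> and \<open>L''\<close> are integral operators whose
  kernels are \<open>-P'(x - T y) S\<^sub>1(T y)\<close> and \<open>P''(x - T y) S\<^sub>1(T y)\<^sup>2 - P'(x - T y) S\<^sub>2(T y)\<close>. Moving the
  derivatives of the test function onto \<open>P\<close> identifies them with the operators that the theorem defines by
  distributions (\<open>transfer_op_test\<close>).

  \<^emph>\<open>Response.\<close> The deviation \<open>d = h\<^sub>\<delta> - h\<^sub>0\<close> satisfies \<open>d - L\<^sub>\<delta> d = (L\<^sub>\<delta> - L\<^sub>0) h\<^sub>0\<close>, so it is \<open>O(\<delta>)\<close> in \<open>L\<^sup>1\<close>. It also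
  satisfies \<open>(1 - L\<^sub>0) d = (L\<^sub>\<delta> - L\<^sub>0) h\<^sub>0 + (L\<^sub>\<delta> - L\<^sub>0) d\<close>. With \<open>(1 - L\<^sub>0) h\<^sub>1 = L' h\<^sub>0\<close> and
  \<open>(1 - L\<^sub>0) h\<^sub>2 = 1/2 L'' h\<^sub>0 + L' h\<^sub>1\<close> this gives

    \<open>(1 - L\<^sub>0)(d - \<delta> h\<^sub>1) = (L\<^sub>\<delta> - L\<^sub>0 - \<delta> L') h\<^sub>0 + (L\<^sub>\<delta> - L\<^sub>0) d = O(\<delta>\<^sup>2)\<close>,

    \<open>(1 - L\<^sub>0)(d - \<delta> h\<^sub>1 - \<delta>\<^sup>2 h\<^sub>2) = (L\<^sub>\<delta> - L\<^sub>0 - \<delta> L' - \<delta>\<^sup>2/2 L'') h\<^sub>0 + (L\<^sub>\<delta> - L\<^sub>0 - \<delta> L') d + \<delta> L'(d - \<delta> h\<^sub>1) = o(\<delta>\<^sup>2)\<close>,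

  and the a priori estimate turns these into the two limits, in any \<open>C\<^sup>n\<close>.
\<close>

section \<open>Calculus in the spaces of differentiable functions\<close>

lemma deriv_iter_eqI:
  assumes "\<And>i x. i < n \<Longrightarrow> (F i has_real_derivative F (Suc i) x) (at x)" "i \<le> n"
  shows "(deriv ^^ i) (F 0) = F i"
  using assms(2)
proof (induction i)
  case (Suc i)
  then have "(deriv ^^ Suc i) (F 0) = deriv (F i)" by simp
  also have "\<dots> = F (Suc i)"
    using assms(1)[of i] Suc.prems by (auto intro!: ext DERIV_imp_deriv)
  finally show ?case .
qed simp

lemma C_diffI:
  assumes "\<And>i x. (F i has_real_derivative F (Suc i) x) (at x)"
  shows "C_diff n (F 0)"
proof -
  have eq: "(deriv ^^ i) (F 0) = F i" for i
    using deriv_iter_eqI[of i F i] assms by auto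
  show ?thesis
    unfolding C_diff_def eq
    using assms by (auto simp: field_differentiable_def intro: DERIV_continuous_on)
qed

lemma C_diff_has_derivative:
  assumes "C_diff n f" "i < n"
  shows "((deriv ^^ i) f has_real_derivative (deriv ^^ Suc i) f x) (at x)"
  using assms by (auto simp: C_diff_def field_differentiable_derivI)

lemma deriv_iter_lincomb:
  assumes "C_diff n f" "C_diff n g" "i \<le> n"
  shows "(deriv ^^ i) (\<lambda>x. a * f x + b * g x) = (\<lambda>x. a * (deriv ^^ i) f x + b * (deriv ^^ i) g x)"
proof -
  define F where "F i x = a * (deriv ^^ i) f x + b * (deriv ^^ i) g x" for i x
  have "(F i has_real_derivative F (Suc i) x) (at x)" if "i < n" for i x
    unfolding F_def
    by (intro DERIV_add DERIV_cmult C_diff_has_derivative[OF assms(1) that]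
        C_diff_has_derivative[OF assms(2) that])
  from deriv_iter_eqI[of n F i, OF this assms(3)] have "(deriv ^^ i) (F 0) = F i" by simp
  then show ?thesis by (simp add: F_def[abs_def])
qed

lemma C_diff_lincomb:
  assumes "C_diff n f" "C_diff n g"
  shows "C_diff n (\<lambda>x. a * f x + b * g x)"
  unfolding C_diff_def
proof (intro conjI allI impI)
  fix i x assume i: "i < n"
  have "((deriv ^^ i) (\<lambda>x. a * f x + b * g x) has_real_derivative
      a * (deriv ^^ Suc i) f x + b * (deriv ^^ Suc i) g x) (at x)"
    using i by (subst deriv_iter_lincomb[OF assms])
      (auto simp del: funpow.simps intro!: DERIV_add DERIV_cmult C_diff_has_derivative[OF assms(1)]
        C_diff_has_derivative[OF assms(2)])
  then show "(deriv ^^ i) (\<lambda>x. a * f x + b * g x) field_differentiable at x"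
    by (auto simp: field_differentiable_def)
next
  fix i assume "i \<le> n"
  then show "continuous_on UNIV ((deriv ^^ i) (\<lambda>x. a * f x + b * g x))"
    using assms by (auto simp: deriv_iter_lincomb C_diff_def intro!: continuous_intros)
qed

lemma C_diff_mono: "C_diff n f \<Longrightarrow> m \<le> n \<Longrightarrow> C_diff m f"
  by (auto simp: C_diff_def)

lemma C_diff_continuous: "C_diff n f \<Longrightarrow> continuous_on A f"
  unfolding C_diff_def by (metis continuous_on_subset funpow_0 le0 subset_UNIV)

lemma bdd_above_abs_continuous:
  fixes f :: "real \<Rightarrow> real"
  assumes "continuous_on UNIV f"
  shows "bdd_above ((\<lambda>x. \<bar>f x\<bar>) ` {0..1})"
  using assms
  by (intro bounded_imp_bdd_above compact_imp_bounded compact_continuous_image continuous_intros)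
    (auto intro: continuous_on_subset)

lemma C_norm_ge:
  assumes "C_diff n f" "i \<le> n" "x \<in> {0..1}"
  shows "\<bar>(deriv ^^ i) f x\<bar> \<le> C_norm n f"
proof -
  have bdd: "bdd_above ((\<lambda>x. \<bar>(deriv ^^ j) f x\<bar>) ` {0..1})" if "j \<le> n" for j
    using assms(1) that by (intro bdd_above_abs_continuous) (auto simp: C_diff_def)
  have nn: "0 \<le> (SUP x\<in>{0..1}. \<bar>(deriv ^^ j) f x\<bar>)" if "j \<le> n" for j
    using cSUP_upper2[OF bdd[OF that], of 0 0] by auto
  have "\<bar>(deriv ^^ i) f x\<bar> \<le> (SUP x\<in>{0..1}. \<bar>(deriv ^^ i) f x\<bar>)"
    by (rule cSUP_upper[OF assms(3) bdd[OF assms(2)]])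
  also have "\<dots> \<le> C_norm n f"
    unfolding C_norm_def using assms(2) nn by (intro member_le_sum) auto
  finally show ?thesis .
qed

lemma C_norm_nonneg: "C_diff n f \<Longrightarrow> 0 \<le> C_norm n f"
  using C_norm_ge[of n f 0 0] by force

lemma C_norm_le:
  assumes "\<And>i x. i \<le> n \<Longrightarrow> x \<in> {0..1} \<Longrightarrow> \<bar>(deriv ^^ i) f x\<bar> \<le> B i"
  shows "C_norm n f \<le> (\<Sum>i\<le>n. B i)"
  unfolding C_norm_def using assms by (intro sum_mono cSUP_least) auto

lemma C_norm_lincomb:
  assumes f: "C_diff n f" and g: "C_diff n g"
  shows "C_norm n (\<lambda>x. a * f x + b * g x) \<le> \<bar>a\<bar> * C_norm n f + \<bar>b\<bar> * C_norm n g"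
proof -
  have bdd: "bdd_above ((\<lambda>x. \<bar>(deriv ^^ j) f x\<bar>) ` {0..1})" "bdd_above ((\<lambda>x. \<bar>(deriv ^^ j) g x\<bar>) ` {0..1})"
    if "j \<le> n" for j
    using f g that by (auto intro!: bdd_above_abs_continuous simp: C_diff_def)
  have "\<bar>(deriv ^^ i) (\<lambda>x. a * f x + b * g x) x\<bar>
      \<le> \<bar>a\<bar> * (SUP x\<in>{0..1}. \<bar>(deriv ^^ i) f x\<bar>) + \<bar>b\<bar> * (SUP x\<in>{0..1}. \<bar>(deriv ^^ i) g x\<bar>)"
    if "i \<le> n" "x \<in> {0..1}" for i x
  proof -
    have "\<bar>a * (deriv ^^ i) f x + b * (deriv ^^ i) g x\<bar> \<le> \<bar>a\<bar> * \<bar>(deriv ^^ i) f x\<bar> + \<bar>b\<bar> * \<bar>(deriv ^^ i) g x\<bar>"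
      by (metis abs_mult abs_triangle_ineq)
    also have "\<dots> \<le> \<bar>a\<bar> * (SUP x\<in>{0..1}. \<bar>(deriv ^^ i) f x\<bar>) + \<bar>b\<bar> * (SUP x\<in>{0..1}. \<bar>(deriv ^^ i) g x\<bar>)"
      using that bdd by (intro add_mono mult_left_mono cSUP_upper) auto
    finally show ?thesis using that f g by (simp add: deriv_iter_lincomb)
  qed
  from C_norm_le[OF this, of n] show ?thesis
    by (simp add: C_norm_def sum.distrib sum_distrib_left)
qed

lemma C_norm_add:
  assumes "C_diff n f" "C_diff n g"
  shows "C_norm n (\<lambda>x. f x + g x) \<le> C_norm n f + C_norm n g"
  using C_norm_lincomb[OF assms, of 1 1] by simp

lemma C_norm_scale:
  assumes "C_diff n f"
  shows "C_norm n (\<lambda>x. a * f x) \<le> \<bar>a\<bar> * C_norm n f"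
  using C_norm_lincomb[OF assms assms, of a 0] by simp

lemma C_circle_lincomb:
  assumes "f \<in> C_circle n" "g \<in> C_circle n"
  shows "(\<lambda>x. a * f x + b * g x) \<in> C_circle n"
  using assms by (auto simp: C_circle_def periodic_def C_diff_lincomb)

lemma C_circle_mono: "f \<in> C_circle n \<Longrightarrow> m \<le> n \<Longrightarrow> f \<in> C_circle m"
  by (auto simp: C_circle_def intro: C_diff_mono)

lemma smooth_circleI:
  assumes "\<And>i x. (F i has_real_derivative F (Suc i) x) (at x)" "periodic (F 0)"
  shows "F 0 \<in> smooth_circle"
  using assms C_diffI[of F] by (auto simp: smooth_circle_def C_circle_def)

lemma smooth_circle_C: "f \<in> smooth_circle \<Longrightarrow> f \<in> C_circle n"
  by (auto simp: smooth_circle_def)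

lemma smooth_circle_lincomb:
  "f \<in> smooth_circle \<Longrightarrow> g \<in> smooth_circle \<Longrightarrow> (\<lambda>x. a * f x + b * g x) \<in> smooth_circle"
  by (auto simp: smooth_circle_def intro!: C_circle_lincomb)

section \<open>Differentiation under the integral sign\<close>

text \<open>The mean value theorem bounds the difference quotients by the function that dominates the
  derivatives near \<open>x0\<close>, so dominated convergence applies along every sequence tending to zero.
  The measure is arbitrary because the lemma is used both for series (counting measure) and for integrals.\<close>

lemma DERIV_integral:
  fixes k k' :: "real \<Rightarrow> 'a \<Rightarrow> real"
  assumes D: "\<And>x y. y \<in> space M \<Longrightarrow> ((\<lambda>x. k x y) has_real_derivative k' x y) (at x)"
    and int: "\<And>x. integrable M (k x)"
    and meas: "k' x0 \<in> borel_measurable M"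
    and w: "integrable M w"
    and bound: "\<And>x y. \<bar>x - x0\<bar> < 1 \<Longrightarrow> y \<in> space M \<Longrightarrow> \<bar>k' x y\<bar> \<le> w y"
  shows "((\<lambda>x. \<integral>y. k x y \<partial>M) has_real_derivative (\<integral>y. k' x0 y \<partial>M)) (at x0)"
  unfolding DERIV_def tendsto_at_iff_sequentially
proof (intro allI impI)
  fix h :: "nat \<Rightarrow> real"
  assume h0: "\<forall>i. h i \<in> UNIV - {0}" and lim: "h \<longlonglongrightarrow> 0"
  have "\<forall>\<^sub>F i in sequentially. \<bar>h i\<bar> < 1"
    using lim by (auto simp: tendsto_iff dist_real_def dest: spec[of _ 1])
  then obtain N where N: "\<And>i. i \<ge> N \<Longrightarrow> \<bar>h i\<bar> < 1"
    by (auto simp: eventually_sequentially)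
  define q where "q i y = (k (x0 + h (i + N)) y - k x0 y) / h (i + N)" for i y
  have lim': "(\<lambda>i. h (i + N)) \<longlonglongrightarrow> 0"
    using lim by (rule LIMSEQ_ignore_initial_segment)
  have "(\<lambda>i. \<integral>y. q i y \<partial>M) \<longlonglongrightarrow> (\<integral>y. k' x0 y \<partial>M)"
  proof (rule integral_dominated_convergence[OF meas _ w])
    show "q i \<in> borel_measurable M" for i
      unfolding q_def using int by (intro borel_measurable_divide borel_measurable_diff) auto
    show "AE y in M. (\<lambda>i. q i y) \<longlonglongrightarrow> k' x0 y"
    proof (rule AE_I2)
      fix y assume "y \<in> space M"
      from D[OF this, of x0] show "(\<lambda>i. q i y) \<longlonglongrightarrow> k' x0 y"
        unfolding DERIV_def tendsto_at_iff_sequentially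
        using h0 lim' by (auto simp: q_def o_def dest!: spec[of _ "\<lambda>i. h (i + N)"])
    qed
    show "AE y in M. norm (q i y) \<le> w y" for i
    proof (rule AE_I2)
      fix y assume y: "y \<in> space M"
      have "norm (k (x0 + h (i + N)) y - k x0 y) \<le> w y * norm ((x0 + h (i + N)) - x0)"
        using N[of "i + N"] D[OF y] bound[OF _ y]
        by (intro field_differentiable_bound[of "ball x0 1" "\<lambda>x. k x y" "\<lambda>x. k' x y"])
          (simp_all add: dist_real_def abs_minus_commute has_field_derivative_at_within)
      then show "norm (q i y) \<le> w y"
        using h0[rule_format, of "i + N"] by (auto simp: q_def abs_divide divide_simps)
    qed
  qed
  moreover have "(\<integral>y. q i y \<partial>M) = ((\<integral>y. k (x0 + h (i + N)) y \<partial>M) - (\<integral>y. k x0 y \<partial>M)) / h (i + N)" for i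
    unfolding q_def using int by (simp add: Bochner_Integration.integral_diff)
  ultimately have "(\<lambda>i. ((\<integral>y. k (x0 + h (i + N)) y \<partial>M) - (\<integral>y. k x0 y \<partial>M)) / h (i + N)) \<longlonglongrightarrow> (\<integral>y. k' x0 y \<partial>M)"
    by simp
  then show "((\<lambda>h. ((\<integral>y. k (x0 + h) y \<partial>M) - (\<integral>y. k x0 y \<partial>M)) / h) \<circ> h) \<longlonglongrightarrow> (\<integral>y. k' x0 y \<partial>M)"
    by (subst LIMSEQ_offset[of _ N]) (auto simp: o_def)
qed

section \<open>The periodized Gaussian\<close>

text \<open>The derivatives of the Gaussian are polynomials times the Gaussian; differentiating once
  replaces the polynomial \<open>p\<close> by \<open>p' - p x / \<xi>\<^sup>2\<close>.\<close>

definition gauss_poly :: "real \<Rightarrow> nat \<Rightarrow> real poly" where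
  "gauss_poly \<xi> n = ((\<lambda>p. pderiv p - p * [:0, 1 / \<xi>\<^sup>2:]) ^^ n) [:1 / sqrt (2 * pi * \<xi>\<^sup>2):]"

definition gauss_deriv :: "real \<Rightarrow> nat \<Rightarrow> real \<Rightarrow> real" where
  "gauss_deriv \<xi> n x = poly (gauss_poly \<xi> n) x * exp (- x\<^sup>2 / (2 * \<xi>\<^sup>2))"

lemma gauss_deriv_0: "gauss_deriv \<xi> 0 = normal_density 0 \<xi>"
  by (auto simp: fun_eq_iff gauss_deriv_def gauss_poly_def normal_density_def)

lemma DERIV_gauss_deriv:
  assumes "\<xi> \<noteq> 0"
  shows "(gauss_deriv \<xi> n has_real_derivative gauss_deriv \<xi> (Suc n) x) (at x)"
proof -
  have "((\<lambda>x. - x\<^sup>2 / (2 * \<xi>\<^sup>2)) has_real_derivative - (x / \<xi>\<^sup>2)) (at x)"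
    using assms by (auto intro!: derivative_eq_intros simp: divide_simps)
  from DERIV_mult[OF poly_DERIV[of "gauss_poly \<xi> n" x] DERIV_fun_exp[OF this]]
  show ?thesis
    unfolding gauss_deriv_def[abs_def] by (rule DERIV_cong) (simp add: gauss_poly_def algebra_simps)
qed

lemma poly_le_exp:
  fixes p :: "real poly"
  assumes "0 < b"
  shows "\<exists>C. \<forall>x. \<bar>poly p x\<bar> \<le> C * exp (b * \<bar>x\<bar>)"
  using assms
proof (induction p arbitrary: b)
  case 0
  then show ?case by (auto intro!: exI[of _ 0])
next
  case (pCons a p)
  from pCons.IH[of "b/2"] pCons.prems obtain C where C: "\<And>x. \<bar>poly p x\<bar> \<le> C * exp (b / 2 * \<bar>x\<bar>)" by auto
  have "\<bar>poly (pCons a p) x\<bar> \<le> (\<bar>a\<bar> + 2 / b * C) * exp (b * \<bar>x\<bar>)" for x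
  proof -
    have "C \<ge> 0" using C[of 0] by auto
    have e: "exp (b * \<bar>x\<bar>) = exp (b / 2 * \<bar>x\<bar>) * exp (b / 2 * \<bar>x\<bar>)"
      by (simp flip: exp_add)
    have x: "\<bar>x\<bar> \<le> 2 / b * exp (b / 2 * \<bar>x\<bar>)"
      using exp_ge_add_one_self[of "b / 2 * \<bar>x\<bar>"] pCons.prems by (simp add: field_simps)
    have "\<bar>poly (pCons a p) x\<bar> \<le> \<bar>a\<bar> + \<bar>x\<bar> * \<bar>poly p x\<bar>"
      by (simp add: abs_mult[symmetric])
    also have "\<dots> \<le> \<bar>a\<bar> * exp (b * \<bar>x\<bar>) + (2 / b * exp (b / 2 * \<bar>x\<bar>)) * (C * exp (b / 2 * \<bar>x\<bar>))"
      using C[of x] x pCons.prems \<open>C \<ge> 0\<close>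
      by (intro add_mono mult_mono) (auto simp: mult_le_cancel_left1)
    also have "\<dots> = (\<bar>a\<bar> + 2 / b * C) * exp (b * \<bar>x\<bar>)"
      unfolding e by (simp add: algebra_simps)
    finally show ?thesis .
  qed
  then show ?case by blast
qed

text \<open>The polynomial factor, multiplied by \<open>1 + x\<^sup>2\<close>, is at most a multiple of \<open>exp \<bar>x\<bar>\<close>, which the Gaussian
  absorbs. Only summability over the integers matters later, and \<open>1 / (1 + x\<^sup>2)\<close> gives it.\<close>

lemma gauss_deriv_decay:
  assumes "\<xi> \<noteq> 0"
  shows "\<exists>C\<ge>0. \<forall>x. \<bar>gauss_deriv \<xi> n x\<bar> \<le> C / (1 + x\<^sup>2)"
proof -
  obtain C where C: "\<And>x. \<bar>poly (gauss_poly \<xi> n * [:1, 0, 1:]) x\<bar> \<le> C * exp (1 * \<bar>x\<bar>)"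
    using poly_le_exp[of 1 "gauss_poly \<xi> n * [:1, 0, 1:]"] by auto
  have C0: "C \<ge> 0" using C[of 0] by simp
  have "\<bar>gauss_deriv \<xi> n x\<bar> \<le> C * exp (\<xi>\<^sup>2 / 2) / (1 + x\<^sup>2)" for x
  proof -
    have pos: "1 + x\<^sup>2 > 0" by (simp add: add_pos_nonneg)
    \<comment> \<open>completing the square in the exponent \<open>\<bar>x\<bar> - x\<^sup>2 / (2 \<xi>\<^sup>2)\<close>\<close>
    have "0 \<le> (\<bar>x\<bar> - \<xi>\<^sup>2)\<^sup>2" by simp
    then have "2 * \<xi>\<^sup>2 * \<bar>x\<bar> \<le> x\<^sup>2 + (\<xi>\<^sup>2)\<^sup>2" by (simp add: power2_diff algebra_simps)
    then have "\<bar>x\<bar> \<le> (x\<^sup>2 + (\<xi>\<^sup>2)\<^sup>2) / (2 * \<xi>\<^sup>2)"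
      using assms by (subst pos_le_divide_eq) (simp_all add: mult_ac)
    also have "\<dots> = x\<^sup>2 / (2 * \<xi>\<^sup>2) + \<xi>\<^sup>2 / 2"
      using assms by (simp add: add_divide_distrib power4_eq_xxxx power2_eq_square)
    finally have e: "\<bar>x\<bar> + - x\<^sup>2 / (2 * \<xi>\<^sup>2) \<le> \<xi>\<^sup>2 / 2" by simp
    have "\<bar>gauss_deriv \<xi> n x\<bar> * (1 + x\<^sup>2)
        = \<bar>poly (gauss_poly \<xi> n * [:1, 0, 1:]) x\<bar> * exp (- x\<^sup>2 / (2 * \<xi>\<^sup>2))"
    proof -
      have "poly (gauss_poly \<xi> n * [:1, 0, 1:]) x = poly (gauss_poly \<xi> n) x * (1 + x\<^sup>2)"
        by (simp add: power2_eq_square algebra_simps)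
      then show ?thesis
        using pos by (simp only: gauss_deriv_def abs_mult abs_of_pos[OF pos] abs_of_pos[OF exp_gt_zero] mult_ac)
    qed
    also have "\<dots> \<le> C * exp (1 * \<bar>x\<bar>) * exp (- x\<^sup>2 / (2 * \<xi>\<^sup>2))"
      by (intro mult_right_mono C) auto
    also have "\<dots> = C * exp (\<bar>x\<bar> + - x\<^sup>2 / (2 * \<xi>\<^sup>2))"
      by (simp only: exp_add mult_1 mult.assoc)
    also have "\<dots> \<le> C * exp (\<xi>\<^sup>2 / 2)"
      using e C0 by (intro mult_left_mono) auto
    finally show ?thesis using pos by (simp add: pos_le_divide_eq)
  qed
  then show ?thesis using C0 by (intro exI[of _ "C * exp (\<xi>\<^sup>2 / 2)"]) auto
qed

abbreviation int_count :: "int measure" where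
  "int_count \<equiv> count_space UNIV"

lemma integrable_int_inverse_square: "integrable int_count (\<lambda>k. 1 / (1 + (real_of_int k)\<^sup>2))"
proof -
  have "summable (\<lambda>n. 1 / (1 + (real_of_int (int_decode n))\<^sup>2))"
  proof (rule summable_comparison_test')
    show "summable (\<lambda>n. 8 * inverse (real (Suc n) ^ 2))"
      by (intro summable_mult) (subst summable_Suc_iff, rule inverse_power_summable, simp)
    fix n :: nat
    have "real n / 2 \<le> \<bar>real_of_int (int_decode n)\<bar>"
      by (auto simp: int_decode_def sum_decode_def elim!: evenE oddE)
    then have "(real n / 2)\<^sup>2 \<le> (real_of_int (int_decode n))\<^sup>2"
      using power_mono[of "real n / 2" "\<bar>real_of_int (int_decode n)\<bar>" 2] by simp
    moreover have "0 \<le> (real n - 1)\<^sup>2" by simp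
    ultimately have *: "(real (Suc n))\<^sup>2 \<le> 8 * (1 + (real_of_int (int_decode n))\<^sup>2)"
      by (simp add: power2_eq_square algebra_simps)
    have pos: "1 + (real_of_int (int_decode n))\<^sup>2 > 0" by (simp add: add_pos_nonneg)
    have "(real (Suc n))\<^sup>2 > 0" by simp
    with * pos have "1 / (1 + (real_of_int (int_decode n))\<^sup>2) \<le> 8 / (real (Suc n))\<^sup>2"
      by (simp only: divide_le_eq pos_le_divide_eq frac_le_eq) (simp add: field_simps)
    with pos show "norm (1 / (1 + (real_of_int (int_decode n))\<^sup>2)) \<le> 8 * inverse (real (Suc n) ^ 2)"
      by (simp add: divide_inverse)
  qed
  then have "integrable (count_space (UNIV :: nat set)) (\<lambda>n. 1 / (1 + (real_of_int (int_decode n))\<^sup>2))"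
    by (subst integrable_count_space_nat_iff) (simp add: abs_divide)
  then show ?thesis
    using integrable_bij_count_space[OF bij_int_decode, of "\<lambda>k. 1 / (1 + (real_of_int k)\<^sup>2) :: real"] by simp
qed

text \<open>Uniform domination of the translates, which is what makes the periodized series converge.\<close>

lemma inverse_square_translate:
  fixes x R k :: real
  assumes "\<bar>x\<bar> \<le> R"
  shows "1 / (1 + (x + k)\<^sup>2) \<le> 2 * (1 + R\<^sup>2) * (1 / (1 + k\<^sup>2))"
proof -
  have pos: "1 + (x + k)\<^sup>2 > 0" "1 + k\<^sup>2 > 0" by (simp_all add: add_pos_nonneg)
  have "x\<^sup>2 \<le> R\<^sup>2" using power_mono[OF assms, of 2] by simp
  moreover have "0 \<le> (2 * x + k)\<^sup>2" by simp
  moreover have "0 \<le> R\<^sup>2 * (x + k)\<^sup>2" by simp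
  ultimately have "1 + k\<^sup>2 \<le> 2 * (1 + R\<^sup>2) * (1 + (x + k)\<^sup>2)"
    by (simp add: power2_eq_square algebra_simps)
  then have "1 \<le> 2 * (1 + R\<^sup>2) * (1 + (x + k)\<^sup>2) / (1 + k\<^sup>2)"
    using pos(2) by (subst pos_le_divide_eq) simp_all
  then show ?thesis
    by (intro mult_imp_div_pos_le pos(1)) (simp add: mult_ac)
qed

lemma gauss_deriv_translates_dominated:
  assumes "\<xi> \<noteq> 0"
  shows "\<exists>w. integrable int_count w \<and> (\<forall>x k. \<bar>x\<bar> \<le> R \<longrightarrow> \<bar>gauss_deriv \<xi> n (x + of_int k)\<bar> \<le> w k)"
proof -
  obtain C where C: "C \<ge> 0" "\<And>x. \<bar>gauss_deriv \<xi> n x\<bar> \<le> C / (1 + x\<^sup>2)"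
    using gauss_deriv_decay[OF assms, of n] by auto
  have "\<bar>gauss_deriv \<xi> n (x + of_int k)\<bar> \<le> C * (2 * (1 + R\<^sup>2)) * (1 / (1 + (real_of_int k)\<^sup>2))"
    if "\<bar>x\<bar> \<le> R" for x k
  proof -
    have "\<bar>gauss_deriv \<xi> n (x + of_int k)\<bar> \<le> C * (1 / (1 + (x + of_int k)\<^sup>2))"
      using C(2)[of "x + of_int k"] by simp
    also have "\<dots> \<le> C * (2 * (1 + R\<^sup>2) * (1 / (1 + (real_of_int k)\<^sup>2)))"
      by (intro mult_left_mono inverse_square_translate that C(1))
    finally show ?thesis by (simp only: mult.assoc)
  qed
  moreover have "integrable int_count (\<lambda>k. C * (2 * (1 + R\<^sup>2)) * (1 / (1 + (real_of_int k)\<^sup>2)))"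
    by (intro integrable_mult_right integrable_int_inverse_square)
  ultimately show ?thesis by blast
qed

definition per_gauss :: "real \<Rightarrow> nat \<Rightarrow> real \<Rightarrow> real" where
  "per_gauss \<xi> n x = (\<integral>k. gauss_deriv \<xi> n (x + of_int k) \<partial>int_count)"

lemma integrable_gauss_deriv_translates:
  "\<xi> \<noteq> 0 \<Longrightarrow> integrable int_count (\<lambda>k. gauss_deriv \<xi> n (x + of_int k))"
proof -
  assume "\<xi> \<noteq> 0"
  from gauss_deriv_translates_dominated[OF this, of "\<bar>x\<bar>" n] obtain w
    where w: "integrable int_count w"
      "\<forall>z k. \<bar>z\<bar> \<le> \<bar>x\<bar> \<longrightarrow> \<bar>gauss_deriv \<xi> n (z + of_int k)\<bar> \<le> w k" by blast
  have "norm (gauss_deriv \<xi> n (x + of_int k)) \<le> norm (w k)" for k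
    using w(2)[rule_format, of x k] by simp
  then show ?thesis by (intro Bochner_Integration.integrable_bound[OF w(1)] AE_I2) auto
qed

lemma DERIV_per_gauss:
  assumes "\<xi> \<noteq> 0"
  shows "(per_gauss \<xi> n has_real_derivative per_gauss \<xi> (Suc n) x) (at x)"
proof -
  obtain w where w: "integrable int_count w" 
    "\<And>y k. \<bar>y\<bar> \<le> \<bar>x\<bar> + 1 \<Longrightarrow> \<bar>gauss_deriv \<xi> (Suc n) (y + of_int k)\<bar> \<le> w k"
    using gauss_deriv_translates_dominated[OF assms, of "\<bar>x\<bar> + 1" "Suc n"] by blast
  have D: "((\<lambda>x. gauss_deriv \<xi> n (x + of_int k)) has_real_derivative gauss_deriv \<xi> (Suc n) (x + of_int k)) (at x)" for x k
    by (rule iffD1[OF DERIV_shift DERIV_gauss_deriv[OF assms]])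
  show ?thesis
    unfolding per_gauss_def[abs_def]
    by (rule DERIV_integral[OF D integrable_gauss_deriv_translates[OF assms] _ w(1) w(2)]) simp_all
qed

lemma per_gauss_periodic: "per_gauss \<xi> n (x + 1) = per_gauss \<xi> n x"
proof -
  have "bij_betw (\<lambda>k::int. k + 1) UNIV UNIV" 
    by (rule bij_betw_byWitness[of _ "\<lambda>k. k - 1"]) auto
  from integral_bij_count_space[OF this, of "\<lambda>k. gauss_deriv \<xi> n (x + of_int k)"]
  show ?thesis by (simp add: per_gauss_def algebra_simps)
qed

lemma continuous_per_gauss: "\<xi> \<noteq> 0 \<Longrightarrow> continuous_on A (per_gauss \<xi> n)"
  by (meson DERIV_per_gauss DERIV_isCont continuous_at_imp_continuous_on)

lemma per_gauss_measurable [measurable]: "per_gauss \<xi> n \<in> borel_measurable borel" if "\<xi> \<noteq> 0"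
  by (rule borel_measurable_continuous_onI[OF continuous_per_gauss[OF that]])

lemma periodic_of_int:
  assumes "\<And>x. f (x + 1) = f (x::real)"
  shows "f (x + of_int k) = f x"
proof -
  have nat: "f (x + of_nat n) = f x" for x n
  proof (induction n)
    case (Suc n)
    have "f (x + of_nat (Suc n)) = f ((x + of_nat n) + 1)" by (simp add: ac_simps)
    also have "\<dots> = f x" unfolding assms by (rule Suc)
    finally show ?case .
  qed simp
  show ?thesis
  proof (cases "k \<ge> 0")
    case True
    then show ?thesis using nat[of x "nat k"] by simp
  next
    case False
    then show ?thesis using nat[of "x + of_int k" "nat (- k)"] by simp
  qed
qed

lemma periodic_frac: "(\<And>x. f (x + 1) = f (x::real)) \<Longrightarrow> f (frac x) = f x"
  using periodic_of_int[of f "frac x" "\<lfloor>x\<rfloor>"] by (simp add: frac_def)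

lemma per_gauss_bounded:
  assumes "\<xi> \<noteq> 0"
  shows "\<exists>B\<ge>0. \<forall>x. \<bar>per_gauss \<xi> n x\<bar> \<le> B"
proof -
  have "compact ((\<lambda>x. \<bar>per_gauss \<xi> n x\<bar>) ` {0..1})"
    by (intro compact_continuous_image continuous_intros continuous_per_gauss assms) auto
  from bounded_imp_bdd_above[OF compact_imp_bounded[OF this]]
  obtain B where B: "\<And>x. x \<in> {0..1} \<Longrightarrow> \<bar>per_gauss \<xi> n x\<bar> \<le> B"
    unfolding bdd_above_def by blast
  have "\<bar>per_gauss \<xi> n x\<bar> \<le> B" for x
    using B[of "frac x"] periodic_frac[of "per_gauss \<xi> n" x] per_gauss_periodic frac_lt_1[of x]
    by (auto simp: less_imp_le)
  with B[of 0] show ?thesis by (intro exI[of _ B]) force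
qed

text \<open>All terms of the series are positive, and the one in the unit interval is at least the value of the
  Gaussian at \<open>1\<close>. This is the only place where the noise acts as a mixing mechanism.\<close>

lemma per_gauss_lower_bound:
  assumes "\<xi> > 0"
  shows "\<exists>c>0. \<forall>x. c \<le> per_gauss \<xi> 0 x"
proof (intro exI conjI allI)
  show "normal_density 0 \<xi> 1 > 0" using assms by (simp add: normal_density_pos)
  fix x
  have int: "integrable int_count (\<lambda>k. gauss_deriv \<xi> 0 (frac x + of_int k))"
    using integrable_gauss_deriv_translates assms by simp
  have "normal_density 0 \<xi> 1 \<le> normal_density 0 \<xi> (frac x)"
    using assms power_mono[of "frac x" 1 2] frac_lt_1[of x]
    by (auto simp: normal_density_def divide_simps less_imp_le)
  also have "\<dots> = (\<integral>k. indicator {0} k *\<^sub>R normal_density 0 \<xi> (frac x) \<partial>int_count)"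
    by (subst integral_scaleR_left) (auto simp: )
  also have "\<dots> \<le> (\<integral>k. gauss_deriv \<xi> 0 (frac x + of_int k) \<partial>int_count)"
    using assms
    by (intro integral_mono int) (auto simp: gauss_deriv_0 normal_density_nonneg split: split_indicator)
  also have "\<dots> = per_gauss \<xi> 0 x"
    unfolding per_gauss_def[symmetric] by (intro periodic_frac per_gauss_periodic)
  finally show "normal_density 0 \<xi> 1 \<le> per_gauss \<xi> 0 x" .
qed

lemma periodization_normal_density:
  assumes "\<xi> > 0"
  shows "periodization (normal_density 0 \<xi>) = per_gauss \<xi> 0"
proof
  fix x
  have "Infinite_Set_Sum.abs_summable_on (\<lambda>k::int. normal_density 0 \<xi> (x + of_int k)) UNIV"
    unfolding Infinite_Set_Sum.abs_summable_on_def
    using integrable_gauss_deriv_translates[of \<xi> 0 x] assms by (simp add: gauss_deriv_0)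
  from infsetsum_infsum[OF this] show "periodization (normal_density 0 \<xi>) x = per_gauss \<xi> 0 x"
    by (simp add: periodization_def per_gauss_def gauss_deriv_0 infsetsum_def)
qed

section \<open>Integration over the circle\<close>

abbreviation circ :: "real measure" where
  "circ \<equiv> lebesgue_on {0..<1}"

lemma integrable_bounded_mult:
  fixes f g :: "'a \<Rightarrow> real"
  assumes f: "integrable M f" and g: "g \<in> borel_measurable M" and B: "\<And>x. x \<in> space M \<Longrightarrow> \<bar>g x\<bar> \<le> B"
  shows "integrable M (\<lambda>x. g x * f x)"
proof (rule Bochner_Integration.integrable_bound)
  show "integrable M (\<lambda>x. B * \<bar>f x\<bar>)" using f by simp
  show "(\<lambda>x. g x * f x) \<in> borel_measurable M"
    by (intro borel_measurable_times g borel_measurable_integrable[OF f])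
  show "AE x in M. norm (g x * f x) \<le> norm (B * \<bar>f x\<bar>)"
    using order_trans[OF B abs_ge_self] by (intro AE_I2) (fastforce simp: abs_mult intro: mult_right_mono)
qed

lemma circle_integral_circ: "circle_integral f = (\<integral>x. f x \<partial>circ)"
  by (simp add: circle_integral_def set_lebesgue_integral_def integral_restrict_space)

lemma L1_circle_iff: "L1_circle f \<longleftrightarrow> periodic f \<and> integrable circ f"
  by (simp add: L1_circle_def set_integrable_def integrable_restrict_space)

lemma id_circ_measurable: "(\<lambda>x. x) \<in> circ \<rightarrow>\<^sub>M borel"
  by (intro measurable_restrict_space1 measurable_completion) simp

lemma borel_circ_measurable: "f \<in> borel_measurable borel \<Longrightarrow> f \<in> borel_measurable circ"
  using measurable_compose[OF id_circ_measurable] by blast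

lemma emeasure_circ: "emeasure circ (space circ) = 1"
  by (simp add: space_restrict_space emeasure_restrict_space)

interpretation circ: prob_space circ
  by (rule prob_spaceI[OF emeasure_circ])

lemma integral_circ_borel:
  fixes f :: "real \<Rightarrow> real"
  assumes "f \<in> borel_measurable borel"
  shows "(\<integral>x. f x \<partial>circ) = (\<integral>x. indicator {0..<1} x * f x \<partial>lborel)"
proof -
  note assms[measurable]
  have "(\<lambda>x. indicator {0..<1} x * f x) \<in> borel_measurable lborel" by measurable
  from integral_completion[OF this] show ?thesis by (simp add: integral_restrict_space)
qed

text \<open>The exceptional set is a countable union of integer translates of its part in the unit interval.\<close>

lemma AE_circ_imp_AE_lebesgue:
  assumes P: "\<And>x. P (x + 1) = P (x::real)" and AE: "AE x in circ. P x"
  shows "AE x in lebesgue. P x"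
proof -
  from AE have "AE x in lebesgue. x \<in> {0..<1} \<longrightarrow> P x"
    by (simp add: AE_restrict_space_iff)
  then obtain N where "{x \<in> space lebesgue. \<not> (x \<in> {0..<1} \<longrightarrow> P x)} \<subseteq> N" "emeasure lebesgue N = 0" "N \<in> sets lebesgue"
    by (rule AE_E)
  then have neg: "negligible {x \<in> {0..<1}. \<not> P x}"
    by - (rule negligible_subset[of N], auto simp: negligible_iff_null_sets null_sets_def)
  have "negligible (\<Union>k::int. (+) (of_int k) ` {x \<in> {0..<1}. \<not> P x})"
    using negligible_translation[OF neg] by (intro negligible_countable_Union) auto
  moreover have "{x. \<not> P x} \<subseteq> (\<Union>k::int. (+) (of_int k) ` {x \<in> {0..<1}. \<not> P x})"
  proof
    fix x assume x: "x \<in> {x. \<not> P x}"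
    have eq: "P (frac x) = P x" by (rule periodic_frac[of P, OF P])
    have fr: "frac x \<in> {x \<in> {0..<1}. \<not> P x}"
      using x unfolding mem_Collect_eq eq by (simp add: frac_lt_1)
    show "x \<in> (\<Union>k::int. (+) (of_int k) ` {x \<in> {0..<1}. \<not> P x})"
    proof (rule UN_I[of "\<lfloor>x\<rfloor>"])
      show "x \<in> (+) (of_int \<lfloor>x\<rfloor>) ` {x \<in> {0..<1}. \<not> P x}"
        by (rule image_eqI[OF _ fr]) (simp add: frac_def)
    qed simp
  qed
  ultimately have "{x. \<not> P x} \<in> null_sets lebesgue"
    unfolding negligible_iff_null_sets[symmetric] by (rule negligible_subset)
  then show ?thesis by (intro AE_I'[of "{x. \<not> P x}"]) auto
qed

text \<open>Fubini for the product with counting measure on the integers: \<open>\<phi> x\<close> is the sum over \<open>k\<close> of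
  \<open>\<phi> x\<close> cut off to \<open>[k, k + 1)\<close>, and each piece is translated back to the unit interval.\<close>

lemma integral_unfold_period:
  fixes \<phi> :: "real \<Rightarrow> real"
  assumes \<phi>: "integrable lborel \<phi>"
  shows "(\<integral>x. (\<integral>k. \<phi> (x + of_int k) \<partial>int_count) \<partial>circ) = (\<integral>x. \<phi> x \<partial>lborel)"
proof -
  have [measurable]: "\<phi> \<in> borel_measurable borel" using borel_measurable_integrable[OF \<phi>] by simp
  interpret Z: sigma_finite_measure int_count
    by (rule sigma_finite_measure_count_space)
  interpret pair_sigma_finite lborel int_count ..
  interpret sw: pair_sigma_finite int_count lborel ..
  define f where "f = (\<lambda>(x::real, k::int). indicator {0..<1} (x - of_int k) * \<phi> x)"
  define g where "g = (\<lambda>(k::int, x::real). indicator {0..<1} x * \<phi> (x + of_int k))"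
  have [measurable]: "f \<in> borel_measurable (lborel \<Otimes>\<^sub>M int_count)"
    "g \<in> borel_measurable (int_count \<Otimes>\<^sub>M lborel)"
    unfolding f_def g_def by measurable
  have fk: "f (x, k) = indicator {\<lfloor>x\<rfloor>} k *\<^sub>R \<phi> x" for x k
  proof -
    have "x - of_int k \<in> {0..<1} \<longleftrightarrow> k \<in> {\<lfloor>x\<rfloor>}" by (auto simp: floor_eq_iff eq_commute[of k])
    then show ?thesis by (simp add: f_def indicator_def)
  qed
  have int1: "integrable int_count (\<lambda>k. f (x, k))" for x
    unfolding fk by (intro integrable_scaleR_left integrable_real_indicator) auto
  have val: "(\<integral>k. indicator {\<lfloor>x\<rfloor>} k *\<^sub>R c \<partial>int_count) = c" for x c :: real
    by (subst integral_scaleR_left) auto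
  have f_int: "integrable (lborel \<Otimes>\<^sub>M int_count) f"
  proof (rule Fubini_integrable)
    have "norm (f (x, k)) = indicator {\<lfloor>x\<rfloor>} k *\<^sub>R \<bar>\<phi> x\<bar>" for x k
      by (simp add: fk abs_mult)
    then have "(\<lambda>x. \<integral>k. norm (f (x, k)) \<partial>int_count) = (\<lambda>x. \<bar>\<phi> x\<bar>)"
      by (simp only: val)
    then show "integrable lborel (\<lambda>x. \<integral>k. norm (f (x, k)) \<partial>int_count)" using \<phi> by simp
  qed (use int1 in auto)
  have shift: "(\<integral>x. F (f (x, k)) \<partial>lborel) = (\<integral>x. F (g (k, x)) \<partial>lborel)" for F :: "real \<Rightarrow> real" and k
    using lborel_integral_real_affine[of 1 "\<lambda>x. F (f (x, k))" "of_int k"]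
    by (simp add: f_def g_def add.commute)
  have g_int: "integrable (int_count \<Otimes>\<^sub>M lborel) g"
  proof (rule sw.Fubini_integrable)
    have "integrable (int_count \<Otimes>\<^sub>M lborel) (\<lambda>(k, x). norm (f (x, k)))"
      using integrable_product_swap[OF integrable_norm[OF f_int]] by simp
    from sw.integrable_fst'[OF this]
    show "integrable int_count (\<lambda>k. \<integral>x. norm (g (k, x)) \<partial>lborel)"
      using shift[of norm] by simp
    have "integrable lborel (\<lambda>x. g (k, x))" for k
    proof -
      have "integrable lborel (\<lambda>x. \<phi> (of_int k + 1 * x))"
        by (rule lborel_integrable_real_affine[OF \<phi>]) simp
      from integrable_mult_indicator[OF _ this, of "{0..<1}"] show ?thesis
        by (simp add: g_def add.commute)
    qed
    then show "AE k in int_count. integrable lborel (\<lambda>x. g (k, x))" by simp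
  qed simp
  have "(\<integral>x. \<phi> x \<partial>lborel) = (\<integral>x. (\<integral>k. f (x, k) \<partial>int_count) \<partial>lborel)"
    unfolding fk val ..
  also have "\<dots> = (\<integral>k. (\<integral>x. f (x, k) \<partial>lborel) \<partial>int_count)"
    using Fubini_integral[of "\<lambda>x k. f (x, k)"] f_int by simp
  also have "\<dots> = (\<integral>k. (\<integral>x. g (k, x) \<partial>lborel) \<partial>int_count)"
    using shift[of "\<lambda>x. x"] by simp
  also have "\<dots> = (\<integral>x. (\<integral>k. g (k, x) \<partial>int_count) \<partial>lborel)"
    using sw.Fubini_integral[of "\<lambda>k x. g (k, x)"] g_int by simp
  also have "\<dots> = (\<integral>x. indicator {0..<1} x * (\<integral>k. \<phi> (x + of_int k) \<partial>int_count) \<partial>lborel)"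
    by (simp add: g_def)
  also have "\<dots> = (\<integral>x. (\<integral>k. \<phi> (x + of_int k) \<partial>int_count) \<partial>circ)"
  proof (subst integral_circ_borel)
    have "(\<lambda>(x, k). \<phi> (x + of_int k)) \<in> borel_measurable (borel \<Otimes>\<^sub>M int_count)" by measurable
    then show "(\<lambda>x. \<integral>k. \<phi> (x + of_int k) \<partial>int_count) \<in> borel_measurable borel"
      by (rule Z.borel_measurable_lebesgue_integral)
  qed simp
  finally show ?thesis ..
qed

text \<open>Convolving with the periodized Gaussian on the circle is averaging over Gaussian
  translations on the line.\<close>

lemma integral_per_gauss:
  assumes \<xi>: "\<xi> > 0" and g: "g \<in> borel_measurable borel" "bounded (range g)" "\<And>x. g (x + 1) = g x"
  shows "(\<integral>x. per_gauss \<xi> 0 (x - s) * g x \<partial>circ) = (\<integral>z. normal_density 0 \<xi> z * g (z + s) \<partial>lborel)"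
proof -
  note g(1)[measurable]
  obtain B where B: "\<And>x. \<bar>g x\<bar> \<le> B" using g(2) by (auto simp: bounded_iff)
  define \<phi> where "\<phi> x = normal_density 0 \<xi> (x - s) * g x" for x
  have "integrable lborel (\<lambda>x. normal_density 0 \<xi> (- s + 1 * x))"
    by (rule lborel_integrable_real_affine) (simp_all add: integrable_normal_density \<xi>)
  then have "integrable lborel (\<lambda>x. g x * normal_density 0 \<xi> (x - s))"
    using B by (intro integrable_bounded_mult) auto
  then have int: "integrable lborel \<phi>" unfolding \<phi>_def by (simp add: mult.commute)
  have "(\<integral>k. \<phi> (x + of_int k) \<partial>int_count) = per_gauss \<xi> 0 (x - s) * g x" for x
    using periodic_of_int[of g, OF g(3)]
    by (simp add: \<phi>_def per_gauss_def gauss_deriv_0 algebra_simps)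
  with integral_unfold_period[OF int]
  have "(\<integral>x. per_gauss \<xi> 0 (x - s) * g x \<partial>circ) = (\<integral>x. \<phi> x \<partial>lborel)" by simp
  also have "\<dots> = (\<integral>z. normal_density 0 \<xi> z * g (z + s) \<partial>lborel)"
    using lborel_integral_real_affine[of 1 \<phi> s] by (simp add: \<phi>_def add.commute)
  finally show ?thesis .
qed

lemma integral_per_gauss_1: "\<xi> > 0 \<Longrightarrow> (\<integral>x. per_gauss \<xi> 0 (x - s) \<partial>circ) = 1"
  using integral_per_gauss[of \<xi> "\<lambda>_. 1" s] by (simp add: integral_normal_density)

text \<open>The total mass of a translate does not depend on the translation, so differentiating it with
  respect to the translation gives zero.\<close>

lemma integral_per_gauss_Suc:
  assumes \<xi>: "\<xi> > 0"
  shows "(\<integral>x. per_gauss \<xi> (Suc n) (x - s) \<partial>circ) = 0"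
proof -
  have meas: "(\<lambda>x. per_gauss \<xi> n (x - s)) \<in> borel_measurable circ" for s n
    using \<xi> by (intro borel_circ_measurable) simp
  have int: "integrable circ (\<lambda>x. per_gauss \<xi> n (x - s))" for s n
  proof -
    obtain B where "\<And>x. \<bar>per_gauss \<xi> n x\<bar> \<le> B" using per_gauss_bounded[of \<xi> n] \<xi> by auto
    then show ?thesis by (intro circ.integrable_const_bound[of _ B] meas) auto
  qed
  have D: "((\<lambda>s. \<integral>x. per_gauss \<xi> n (x - s) \<partial>circ) has_real_derivative
      (\<integral>x. - per_gauss \<xi> (Suc n) (x - s) \<partial>circ)) (at s)" for n s
  proof -
    obtain B where B: "\<And>x. \<bar>per_gauss \<xi> (Suc n) x\<bar> \<le> B" using per_gauss_bounded[of \<xi> "Suc n"] \<xi> by auto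
    show ?thesis
    proof (rule DERIV_integral[where w = "\<lambda>_. B"])
      show "((\<lambda>s. per_gauss \<xi> n (x - s)) has_real_derivative - per_gauss \<xi> (Suc n) (x - s)) (at s)" for x s
      proof -
        have "((\<lambda>s. x - s) has_real_derivative - 1) (at s)" by (auto intro!: derivative_eq_intros)
        from DERIV_chain2[where f = "per_gauss \<xi> n", OF DERIV_per_gauss this] \<xi> show ?thesis by simp
      qed
    qed (use int meas B in auto)
  qed
  have "(\<integral>x. per_gauss \<xi> (Suc n) (x - s) \<partial>circ) = 0" if "\<And>s. (\<integral>x. per_gauss \<xi> n (x - s) \<partial>circ) = c" for n c s
    using DERIV_unique[OF D[of n s, unfolded that] DERIV_const] by simp
  then show ?thesis
    using integral_per_gauss_1[OF \<xi>] by (induction n arbitrary: s) blast+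
qed

section \<open>Operators with smooth kernels\<close>

definition L1_norm :: "(real \<Rightarrow> real) \<Rightarrow> real" where
  "L1_norm f = (\<integral>x. \<bar>f x\<bar> \<partial>circ)"

lemma L1_norm_nonneg: "0 \<le> L1_norm f"
  by (simp add: L1_norm_def)

lemma L1_norm_lincomb:
  assumes "integrable circ f" "integrable circ g"
  shows "L1_norm (\<lambda>x. a * f x + b * g x) \<le> \<bar>a\<bar> * L1_norm f + \<bar>b\<bar> * L1_norm g"
proof -
  have "L1_norm (\<lambda>x. a * f x + b * g x) \<le> (\<integral>x. \<bar>a\<bar> * \<bar>f x\<bar> + \<bar>b\<bar> * \<bar>g x\<bar> \<partial>circ)"
    unfolding L1_norm_def using assms
    by (intro integral_mono) (auto intro!: order_trans[OF abs_triangle_ineq] simp: abs_mult)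
  then show ?thesis using assms by (simp add: L1_norm_def)
qed

lemma L1_norm_bounded:
  assumes "f \<in> borel_measurable circ" "\<And>x. \<bar>f x\<bar> \<le> B"
  shows "integrable circ f" "L1_norm f \<le> B"
proof -
  show int: "integrable circ f" using assms by (intro circ.integrable_const_bound[of _ B]) auto
  have "L1_norm f \<le> (\<integral>x. B \<partial>circ)"
    unfolding L1_norm_def using int assms by (intro integral_mono) auto
  then show "L1_norm f \<le> B" using circ.prob_space by simp
qed

lemma L1_norm_eq_0_AE: "integrable circ f \<Longrightarrow> L1_norm f = 0 \<Longrightarrow> AE x in circ. f x = 0"
  using integral_nonneg_eq_0_iff_AE[of circ "\<lambda>x. \<bar>f x\<bar>"] by (simp add: L1_norm_def)

lemma C_circle_bounded:
  assumes "f \<in> C_circle n"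
  shows "\<bar>f x\<bar> \<le> C_norm n f" "f \<in> borel_measurable borel" "bounded (range f)"
proof -
  have C: "C_diff n f" and per: "\<And>x. f (x + 1) = f x" using assms by (auto simp: C_circle_def periodic_def)
  show *: "\<bar>f x\<bar> \<le> C_norm n f" for x
    using C_norm_ge[OF C, of 0 "frac x"] frac_lt_1[of x] by (simp add: periodic_frac[of f, OF per] less_imp_le)
  then show "bounded (range f)" by (auto simp: bounded_iff)
  show "f \<in> borel_measurable borel"
    using C_diff_continuous[OF C] by (intro borel_measurable_continuous_onI)
qed

lemma C_circle_L1:
  assumes "f \<in> C_circle n"
  shows "integrable circ f" "L1_norm f \<le> C_norm n f"
  using L1_norm_bounded[of f "C_norm n f", OF borel_circ_measurable[OF C_circle_bounded(2)[OF assms]]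
      C_circle_bounded(1)[OF assms]] by blast+

definition kop :: "(real \<Rightarrow> real \<Rightarrow> real) \<Rightarrow> (real \<Rightarrow> real) \<Rightarrow> real \<Rightarrow> real" where
  "kop k f x = (\<integral>y. k x y * f y \<partial>circ)"

interpretation circ2: pair_prob_space circ circ ..

text \<open>Fubini, in the form of the adjoint of a kernel operator.\<close>

lemma integral_mult_kop:
  assumes \<kappa>: "(\<lambda>(x, y). \<kappa> x y) \<in> borel_measurable (circ \<Otimes>\<^sub>M circ)" "\<And>x y. \<bar>\<kappa> x y\<bar> \<le> B"
    and g: "g \<in> borel_measurable circ" "\<And>x. \<bar>g x\<bar> \<le> C"
    and f: "integrable circ f"
  shows "(\<integral>x. g x * kop \<kappa> f x \<partial>circ) = (\<integral>y. f y * (\<integral>x. g x * \<kappa> x y \<partial>circ) \<partial>circ)"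
proof -
  have B: "0 \<le> B" using \<kappa>(2)[of 0 0] by linarith
  have C: "0 \<le> C" using g(2)[of 0] by linarith
  note g(1)[measurable] \<kappa>(1)[measurable]
  have fm[measurable]: "f \<in> borel_measurable circ" using f by simp
  have "integrable (circ \<Otimes>\<^sub>M circ) (\<lambda>p. f (snd p))"
    using f by (intro circ2.Fubini_integrable) auto
  moreover have "(\<lambda>p. g (fst p) * (\<lambda>(x, y). \<kappa> x y) p) \<in> borel_measurable (circ \<Otimes>\<^sub>M circ)" by measurable
  ultimately have "integrable (circ \<Otimes>\<^sub>M circ) (\<lambda>p. (g (fst p) * (\<lambda>(x, y). \<kappa> x y) p) * f (snd p))"
    using g(2) \<kappa>(2) B C
    by (intro integrable_bounded_mult[of _ _ _ "C * B"]) (auto simp: abs_mult intro!: mult_mono)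
  then have "integrable (circ \<Otimes>\<^sub>M circ) (\<lambda>(x, y). g x * (\<kappa> x y * f y))"
    by (simp add: case_prod_unfold mult.assoc)
  from circ2.Fubini_integral[OF this] have
    "(\<integral>y. (\<integral>x. g x * (\<kappa> x y * f y) \<partial>circ) \<partial>circ) = (\<integral>x. (\<integral>y. g x * (\<kappa> x y * f y) \<partial>circ) \<partial>circ)" .
  moreover have "(\<integral>x. g x * (\<kappa> x y * f y) \<partial>circ) = f y * (\<integral>x. g x * \<kappa> x y \<partial>circ)" for y
  proof -
    have "g x * (\<kappa> x y * f y) = f y * (g x * \<kappa> x y)" for x by (simp only: mult_ac)
    then show ?thesis by (simp only: integral_mult_right_zero)
  qed
  moreover have "(\<integral>y. g x * (\<kappa> x y * f y) \<partial>circ) = g x * kop \<kappa> f x" for x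
    unfolding kop_def by (rule integral_mult_right_zero)
  ultimately show ?thesis by (simp only:)
qed

text \<open>The whole sequence \<open>k i\<close> of \<open>x\<close>-derivatives of the kernel \<open>k 0\<close> is carried along, so that a linear
  combination of kernels is again one and its derivatives need not be computed. Regularity in \<open>y\<close> is
  reduced to measurability, as the underlying map is merely measurable.\<close>

locale smooth_kernel =
  fixes k :: "nat \<Rightarrow> real \<Rightarrow> real \<Rightarrow> real" and B :: "nat \<Rightarrow> real"
  assumes kernel_deriv: "\<And>i x y. ((\<lambda>x. k i x y) has_real_derivative k (Suc i) x y) (at x)"
    and kernel_measurable: "\<And>i x. k i x \<in> borel_measurable circ"
    and kernel_bound: "\<And>i x y. \<bar>k i x y\<bar> \<le> B i"
    and kernel_periodic: "\<And>x y. k 0 (x + 1) y = k 0 x y"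
begin

lemma B_nonneg: "0 \<le> B i"
  using kernel_bound[of i 0 0] by linarith

lemma integrable_kernel_mult: "integrable circ f \<Longrightarrow> integrable circ (\<lambda>y. k i x y * f y)"
  by (intro integrable_bounded_mult[of _ _ _ "B i"] kernel_measurable kernel_bound)

lemma DERIV_kop:
  assumes "integrable circ f"
  shows "(kop (k i) f has_real_derivative kop (k (Suc i)) f x) (at x)"
  unfolding kop_def[abs_def]
proof (rule DERIV_integral[where w = "\<lambda>y. B (Suc i) * \<bar>f y\<bar>"])
  show "((\<lambda>x. k i x y * f y) has_real_derivative k (Suc i) x y * f y) (at x)" for x y
    by (rule DERIV_cmult_right[OF kernel_deriv])
  show "(\<lambda>y. k (Suc i) x y * f y) \<in> borel_measurable circ"
    by (intro borel_measurable_integrable integrable_kernel_mult assms)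
  show "\<bar>k (Suc i) x y * f y\<bar> \<le> B (Suc i) * \<bar>f y\<bar>" for x y
    by (simp add: abs_mult kernel_bound mult_right_mono)
qed (use assms integrable_kernel_mult in auto)

lemma kop_bound:
  assumes "integrable circ f"
  shows "\<bar>kop (k i) f x\<bar> \<le> B i * L1_norm f"
proof -
  have "\<bar>kop (k i) f x\<bar> \<le> (\<integral>y. \<bar>k i x y * f y\<bar> \<partial>circ)"
    unfolding kop_def by (rule integral_abs_bound)
  also have "\<dots> \<le> (\<integral>y. B i * \<bar>f y\<bar> \<partial>circ)"
    using assms integrable_kernel_mult[OF assms]
    by (intro integral_mono integrable_abs integrable_mult_right) (auto simp: abs_mult kernel_bound mult_right_mono)
  finally show ?thesis using assms by (simp add: L1_norm_def)
qed

lemma kop_deriv_iter: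
  assumes "integrable circ f"
  shows "(deriv ^^ i) (kop (k 0) f) = kop (k i) f"
  using deriv_iter_eqI[of i "\<lambda>i. kop (k i) f" i] DERIV_kop[OF assms] by blast

lemma kop_smooth:
  assumes "integrable circ f"
  shows "kop (k 0) f \<in> smooth_circle"
proof (rule smooth_circleI[of "\<lambda>i. kop (k i) f"])
  show "periodic (kop (k 0) f)" by (simp add: periodic_def kop_def kernel_periodic)
qed (rule DERIV_kop[OF assms])

lemma C_norm_kop:
  assumes "integrable circ f"
  shows "C_norm n (kop (k 0) f) \<le> (\<Sum>i\<le>n. B i) * L1_norm f"
  using C_norm_le[of n "kop (k 0) f" "\<lambda>i. B i * L1_norm f"]
  by (simp add: kop_deriv_iter[OF assms] kop_bound[OF assms] sum_distrib_right)

lemma integrable_kop: "integrable circ f \<Longrightarrow> integrable circ (kop (k 0) f)"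
  using C_circle_L1(1)[OF smooth_circle_C[OF kop_smooth]] by blast

lemma kop_lincomb:
  assumes "integrable circ f" "integrable circ g"
  shows "kop (k 0) (\<lambda>x. a * f x + b * g x) = (\<lambda>x. a * kop (k 0) f x + b * kop (k 0) g x)"
proof
  fix x
  have "kop (k 0) (\<lambda>x. a * f x + b * g x) x = (\<integral>y. a * (k 0 x y * f y) + b * (k 0 x y * g y) \<partial>circ)"
    by (simp add: kop_def algebra_simps)
  also have "\<dots> = a * kop (k 0) f x + b * kop (k 0) g x"
    using integrable_kernel_mult[OF assms(1), of 0 x] integrable_kernel_mult[OF assms(2), of 0 x]
    by (simp add: kop_def)
  finally show "kop (k 0) (\<lambda>x. a * f x + b * g x) x = a * kop (k 0) f x + b * kop (k 0) g x" .
qed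

lemma kop_diff:
  assumes "integrable circ f" "integrable circ g"
  shows "kop (k 0) (\<lambda>x. f x - g x) = (\<lambda>x. kop (k 0) f x - kop (k 0) g x)"
  using kop_lincomb[OF assms, of 1 "-1"] by simp

lemma integrable_kop_iter: "integrable circ f \<Longrightarrow> integrable circ ((kop (k 0) ^^ i) f)"
  by (induction i) (auto intro: integrable_kop)

lemma kop_iter_diff:
  assumes "integrable circ f" "integrable circ g"
  shows "(kop (k 0) ^^ i) (\<lambda>x. f x - g x) = (\<lambda>x. (kop (k 0) ^^ i) f x - (kop (k 0) ^^ i) g x)"
  using assms by (induction i) (simp_all add: kop_diff integrable_kop_iter)

end

section \<open>Markov kernels bounded from below\<close>

text \<open>Doeblin's condition: a transition density that is bounded below everywhere by the same constant.\<close>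

locale markov_kernel = smooth_kernel +
  fixes c :: real
  assumes c_pos: "0 < c"
    and kernel_lower: "\<And>x y. c \<le> k 0 x y"
    and kernel_joint: "(\<lambda>(x, y). k 0 x y) \<in> borel_measurable (circ \<Otimes>\<^sub>M circ)"
    and kernel_mass: "\<And>y. (\<integral>x. k 0 x y \<partial>circ) = 1"
begin

abbreviation A :: "(real \<Rightarrow> real) \<Rightarrow> real \<Rightarrow> real" where
  "A \<equiv> kop (k 0)"

lemma integrable_kernel_fst: "integrable circ (\<lambda>x. k 0 x y)"
  using kernel_mass[of y] not_integrable_integral_eq by fastforce

lemma c_le_1: "c \<le> 1"
  using integral_mono[OF circ.integrable_const integrable_kernel_fst kernel_lower, of 0] kernel_mass[of 0]
    circ.prob_space by simp

lemma integral_kop: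
  assumes "integrable circ f"
  shows "(\<integral>x. A f x \<partial>circ) = (\<integral>x. f x \<partial>circ)"
  using integral_mult_kop[OF kernel_joint kernel_bound, of "\<lambda>_. 1" 1 f] assms by (simp add: kernel_mass)

text \<open>On functions of zero mean the constant \<open>c\<close> can be subtracted from the kernel, and what remains
  is a nonnegative kernel of mass \<open>1 - c\<close>.\<close>

lemma L1_contraction:
  assumes f: "integrable circ f" and mean: "(\<integral>x. f x \<partial>circ) = 0"
  shows "L1_norm (A f) \<le> (1 - c) * L1_norm f"
proof -
  have abs_f: "integrable circ (\<lambda>x. \<bar>f x\<bar>)" using f by simp
  have "\<bar>A f x\<bar> \<le> A (\<lambda>y. \<bar>f y\<bar>) x - c * L1_norm f" for x
  proof -
    note int = integrable_kernel_mult[OF f, of 0 x] integrable_kernel_mult[OF abs_f, of 0 x]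
    have "A f x = (\<integral>y. k 0 x y * f y - c * f y \<partial>circ)"
      using int f mean by (simp add: kop_def)
    also have "\<bar>\<dots>\<bar> \<le> (\<integral>y. \<bar>k 0 x y * f y - c * f y\<bar> \<partial>circ)"
      by (rule integral_abs_bound)
    also have "\<dots> = (\<integral>y. k 0 x y * \<bar>f y\<bar> - c * \<bar>f y\<bar> \<partial>circ)"
      using kernel_lower by (simp add: left_diff_distrib[symmetric] abs_mult)
    also have "\<dots> = A (\<lambda>y. \<bar>f y\<bar>) x - c * L1_norm f"
      using int abs_f by (simp add: kop_def L1_norm_def)
    finally show ?thesis .
  qed
  then have "L1_norm (A f) \<le> (\<integral>x. A (\<lambda>y. \<bar>f y\<bar>) x - c * L1_norm f \<partial>circ)"
    unfolding L1_norm_def using integrable_kop[OF f] integrable_kop[OF abs_f] by (intro integral_mono) auto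
  also have "\<dots> = (1 - c) * L1_norm f"
    using integrable_kop[OF abs_f] integral_kop[OF abs_f] circ.prob_space by (simp add: L1_norm_def algebra_simps)
  finally show ?thesis .
qed

lemma L1_iter:
  assumes f: "integrable circ f" and mean: "(\<integral>x. f x \<partial>circ) = 0"
  shows "(\<integral>x. (A ^^ i) f x \<partial>circ) = 0" "L1_norm ((A ^^ i) f) \<le> (1 - c) ^ i * L1_norm f"
proof -
  show m: "(\<integral>x. (A ^^ i) f x \<partial>circ) = 0" for i
    by (induction i) (simp_all add: mean integral_kop integrable_kop_iter f)
  show "L1_norm ((A ^^ i) f) \<le> (1 - c) ^ i * L1_norm f"
  proof (induction i)
    case (Suc i)
    have "L1_norm ((A ^^ Suc i) f) \<le> (1 - c) * L1_norm ((A ^^ i) f)"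
      using L1_contraction[OF integrable_kop_iter[OF f] m, of i] by simp
    also have "\<dots> \<le> (1 - c) * ((1 - c) ^ i * L1_norm f)"
      using Suc c_le_1 by (intro mult_left_mono) auto
    finally show ?case by simp
  qed simp
qed

lemma L1_a_priori:
  assumes f: "integrable circ f" and mean: "(\<integral>x. f x \<partial>circ) = 0"
  shows "c * L1_norm f \<le> L1_norm (\<lambda>x. f x - A f x)"
proof -
  have "L1_norm f \<le> L1_norm (\<lambda>x. f x - A f x) + L1_norm (A f)"
    using L1_norm_lincomb[of "\<lambda>x. f x - A f x" "A f" 1 1] f integrable_kop[OF f] by simp
  with L1_contraction[OF f mean] show ?thesis by (simp add: algebra_simps)
qed

lemma fixed_zero_mean:
  assumes f: "integrable circ f" and mean: "(\<integral>x. f x \<partial>circ) = 0" and fixed: "L1_norm (\<lambda>x. f x - A f x) = 0"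
  shows "L1_norm f = 0"
  using L1_a_priori[OF f mean] c_pos L1_norm_nonneg[of f] unfolding fixed by (simp add: mult_le_0_iff)

lemma kop_eq_0: "integrable circ f \<Longrightarrow> L1_norm f = 0 \<Longrightarrow> A f x = 0"
  using kop_bound[of f 0 x] by simp

text \<open>The Neumann series converges uniformly from its second term on, because the kernel operator maps
  \<open>L\<^sup>1\<close> to bounded functions.\<close>

lemma neumann_solution:
  assumes w: "integrable circ w" and mean: "(\<integral>x. w x \<partial>circ) = 0"
  shows "\<exists>u. integrable circ u \<and> (\<integral>x. u x \<partial>circ) = 0 \<and> (\<forall>x. u x - A u x = w x)"
proof -
  define g where "g i = (A ^^ Suc i) w" for i
  define S where "S x = (\<Sum>i. g i x)" for x
  define b where "b i = B 0 * ((1 - c) ^ i * L1_norm w)" for i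
  have b: "summable b" 
    unfolding b_def using c_pos c_le_1 by (intro summable_mult summable_mult2 summable_geometric) auto
  have g_int: "integrable circ (g i)" for i
    unfolding g_def by (intro integrable_kop_iter w)
  have g_bound: "\<bar>g i x\<bar> \<le> b i" for i x
    using kop_bound[OF integrable_kop_iter[OF w], of 0 i x] mult_left_mono[OF L1_iter(2)[OF w mean] B_nonneg, of 0 i]
    by (simp add: g_def b_def)
  have g_sum: "summable (\<lambda>i. \<bar>g i x\<bar>)" for x
    using g_bound by (intro summable_comparison_test'[OF b, of 0]) auto
  have S_bound: "\<bar>S x\<bar> \<le> suminf b" for x
    unfolding S_def using suminf_le[OF g_bound g_sum b] summable_rabs[OF g_sum] order_trans by blast
  have S_meas: "S \<in> borel_measurable circ"
    unfolding S_def[abs_def] using g_int by (intro borel_measurable_suminf) auto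
  have S_int: "integrable circ S" by (rule L1_norm_bounded(1)[OF S_meas S_bound])
  have exch: "(\<integral>y. h y * S y \<partial>circ) = (\<Sum>i. \<integral>y. h y * g i y \<partial>circ)"
    if h: "h \<in> borel_measurable circ" "\<And>y. \<bar>h y\<bar> \<le> H" for h H
  proof -
    have H: "0 \<le> H" using h(2)[of 0] by linarith
    have hg: "integrable circ (\<lambda>y. h y * g i y)" for i
      using h by (intro integrable_bounded_mult[OF g_int]) auto
    have bd: "\<bar>h y * g i y\<bar> \<le> H * b i" for i y
      unfolding abs_mult using h(2) g_bound H by (intro mult_mono) auto
    have sum: "summable (\<lambda>i. norm (h y * g i y))" for y
      using bd by (intro summable_comparison_test'[OF summable_mult[OF b, of H], of 0]) auto
    have "(\<integral>y. \<bar>h y * g i y\<bar> \<partial>circ) \<le> H * b i" for i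
      using L1_norm_bounded(2)[of "\<lambda>y. h y * g i y", OF _ bd] hg by (simp add: L1_norm_def)
    then have "summable (\<lambda>i. \<integral>y. norm (h y * g i y) \<partial>circ)"
      by (intro summable_comparison_test'[OF summable_mult[OF b, of H], of 0]) auto
    from integral_suminf[OF hg AE_I2[OF sum] this]
    have "(\<integral>y. (\<Sum>i. h y * g i y) \<partial>circ) = (\<Sum>i. \<integral>y. h y * g i y \<partial>circ)" .
    moreover have "(\<Sum>i. h y * g i y) = h y * S y" for y
      unfolding S_def using suminf_mult[OF summable_rabs_cancel[OF g_sum]] by blast
    ultimately show ?thesis by simp
  qed
  have AS: "A S x = (\<Sum>i. g (Suc i) x)" for x
    using exch[OF kernel_measurable kernel_bound, of 0 x] by (simp add: kop_def g_def)
  have S_mean: "(\<integral>x. S x \<partial>circ) = 0"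
    using exch[of "\<lambda>_. 1" 1] L1_iter(1)[OF w mean] by (simp add: g_def del: funpow.simps)
  define u where "u x = w x + S x" for x
  have "A u x = S x" for x
  proof -
    have "A u x = A w x + A S x"
      using kop_lincomb[OF w S_int, of 1 1] by (simp add: u_def[abs_def])
    also have "\<dots> = g 0 x + (\<Sum>i. g (Suc i) x)" by (simp add: AS g_def)
    also have "\<dots> = S x"
      unfolding S_def using suminf_split_head[OF summable_rabs_cancel[OF g_sum], of x] by simp
    finally show ?thesis .
  qed
  then have "\<forall>x. u x - A u x = w x" by (simp add: u_def)
  moreover have "integrable circ u" "(\<integral>x. u x \<partial>circ) = 0"
    using w S_int mean S_mean by (simp_all add: u_def[abs_def])
  ultimately show ?thesis by blast
qed

lemma zero_avg_iff: "f \<in> zero_avg n \<longleftrightarrow> f \<in> C_circle n \<and> (\<integral>x. f x \<partial>circ) = 0"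
  by (simp add: zero_avg_def circle_integral_circ)

lemma zero_avg_integrable: "f \<in> zero_avg n \<Longrightarrow> integrable circ f"
  using C_circle_L1 by (auto simp: zero_avg_def)

lemma id_minus_bij: "bij_betw (id_minus A) (zero_avg n) (zero_avg n)"
proof (rule bij_betw_imageI)
  show "inj_on (id_minus A) (zero_avg n)"
  proof (rule inj_onI)
    fix f g assume fg: "f \<in> zero_avg n" "g \<in> zero_avg n" "id_minus A f = id_minus A g"
    note int = fg(1,2)[THEN zero_avg_integrable]
    define d where "d x = f x - g x" for x
    have d: "integrable circ d" "(\<integral>x. d x \<partial>circ) = 0"
      using int fg by (simp_all add: d_def[abs_def] zero_avg_iff)
    have eq: "d x - A d x = 0" for x
      using fun_cong[OF fg(3), of x] by (simp add: d_def[abs_def] kop_diff[OF int] id_minus_def)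
    have "L1_norm (\<lambda>x. d x - A d x) = 0" by (simp only: eq L1_norm_def) simp
    then have "L1_norm d = 0" by (rule fixed_zero_mean[OF d])
    with eq kop_eq_0[OF d(1)] have "d x = 0" for x by simp
    then show "f = g" by (simp add: d_def fun_eq_iff)
  qed
  show "id_minus A ` zero_avg n = zero_avg n"
  proof (intro equalityI subsetI)
    fix f assume "f \<in> id_minus A ` zero_avg n"
    then obtain g where g: "g \<in> zero_avg n" "f = id_minus A g" by blast
    note int = zero_avg_integrable[OF g(1)]
    have "(\<lambda>x. 1 * g x + -1 * A g x) \<in> C_circle n"
      using g by (intro C_circle_lincomb smooth_circle_C[OF kop_smooth[OF int]]) (simp add: zero_avg_iff)
    then show "f \<in> zero_avg n"
      using g int integrable_kop[OF int] by (simp add: id_minus_def zero_avg_iff integral_kop)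
  next
    fix w assume w: "w \<in> zero_avg n"
    from neumann_solution[OF zero_avg_integrable[OF w]] w obtain u where
      u: "integrable circ u" "(\<integral>x. u x \<partial>circ) = 0" "\<forall>x. u x - A u x = w x"
      by (auto simp: zero_avg_iff)
    have ueq: "(\<lambda>x. 1 * w x + 1 * A u x) = u" by (simp add: fun_eq_iff u(3)[rule_format, symmetric])
    have "(\<lambda>x. 1 * w x + 1 * A u x) \<in> C_circle n"
      using w by (intro C_circle_lincomb smooth_circle_C[OF kop_smooth[OF u(1)]]) (simp add: zero_avg_iff)
    then have "u \<in> zero_avg n" unfolding ueq using u(2) by (simp add: zero_avg_iff)
    moreover have "w = id_minus A u"
      using u(3) by (simp add: id_minus_def fun_eq_iff)
    ultimately show "w \<in> id_minus A ` zero_avg n" by blast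
  qed
qed

lemma resolvent_in: "w \<in> zero_avg n \<Longrightarrow> resolvent A n w \<in> zero_avg n"
  unfolding resolvent_def using id_minus_bij[of n] by (auto simp: bij_betw_def intro: inv_into_into)

lemma resolvent_eq:
  assumes "w \<in> zero_avg n"
  shows "resolvent A n w x - A (resolvent A n w) x = w x"
  using f_inv_into_f[of w "id_minus A" "zero_avg n"] id_minus_bij[of n] assms
  by (auto simp: resolvent_def id_minus_def bij_betw_def fun_eq_iff)

definition res_const :: "nat \<Rightarrow> real" where
  "res_const n = 1 + (\<Sum>i\<le>n. B i) / c"

lemma sum_B_nonneg: "0 \<le> (\<Sum>i\<le>n. B i)"
  by (simp add: sum_nonneg B_nonneg)

text \<open>The smoothing of the kernel upgrades the \<open>L\<^sup>1\<close> bound to any number of derivatives, through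
  \<open>u = (u - A u) + A u\<close>.\<close>

lemma C_norm_a_priori:
  assumes u: "u \<in> zero_avg n"
  shows "C_norm n u \<le> res_const n * C_norm n (\<lambda>x. u x - A u x)"
proof -
  note int = zero_avg_integrable[OF u]
  define w where "w = (\<lambda>x. u x - A u x)"
  have w: "w \<in> zero_avg n"
    using bij_betwE[OF id_minus_bij] u by (auto simp: w_def id_minus_def[abs_def])
  have cd: "C_diff n w" "C_diff n (A u)"
    using w smooth_circle_C[OF kop_smooth[OF int], of n] by (auto simp: zero_avg_iff C_circle_def)
  have "C_norm n u \<le> C_norm n w + C_norm n (A u)"
    using C_norm_add[OF cd] by (simp add: w_def)
  also have "C_norm n (A u) \<le> (\<Sum>i\<le>n. B i) * L1_norm u"
    by (rule C_norm_kop[OF int])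
  also have "\<dots> \<le> (\<Sum>i\<le>n. B i) * (C_norm n w / c)"
  proof (intro mult_left_mono sum_B_nonneg)
    have "c * L1_norm u \<le> L1_norm w"
      unfolding w_def using u by (intro L1_a_priori int) (simp add: zero_avg_iff)
    also have "\<dots> \<le> C_norm n w" using w by (intro C_circle_L1) (simp add: zero_avg_iff)
    finally show "L1_norm u \<le> C_norm n w / c" using c_pos by (simp add: field_simps)
  qed
  finally show ?thesis by (simp add: res_const_def w_def algebra_simps)
qed

lemma neumann_remainder:
  assumes w: "integrable circ w" and u: "integrable circ u" and eq: "\<And>x. u x - A u x = w x"
  shows "u x - (\<Sum>i<N. (A ^^ i) w x) = (A ^^ N) u x"
proof (induction N)
  case (Suc N)
  have "A u = (\<lambda>x. u x - w x)" using eq by (simp add: fun_eq_iff algebra_simps)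
  then have "(A ^^ Suc N) u = (\<lambda>x. (A ^^ N) u x - (A ^^ N) w x)"
    using kop_iter_diff[OF u w, of N] by (simp add: funpow_swap1)
  then show ?case using Suc by simp
qed simp

theorem resolvent_well_defined: "resolvent_well_defined A n"
  unfolding resolvent_well_defined_def
proof (intro conjI allI impI)
  show "bij_betw (id_minus A) (zero_avg n) (zero_avg n)" by (rule id_minus_bij)
  have bound: "C_norm n (resolvent A n f) \<le> res_const n * C_norm n f" if "f \<in> zero_avg n" for f
    using C_norm_a_priori[OF resolvent_in[OF that]] by (simp add: resolvent_eq[OF that])
  then show "\<exists>C. \<forall>f\<in>zero_avg n. C_norm n (resolvent A n f) \<le> C * C_norm n f" by blast
  fix \<epsilon> :: real assume \<epsilon>: "\<epsilon> > 0"
  define D where "D = (\<Sum>i\<le>n. B i) * res_const n"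
  have "(\<lambda>N. (1 - c) ^ N * D) \<longlonglongrightarrow> 0 * D"
    using c_pos c_le_1 by (intro tendsto_mult LIMSEQ_power_zero tendsto_const) auto
  then have "\<forall>\<^sub>F N in sequentially. (1 - c) ^ N * D < \<epsilon>"
    using \<epsilon> by (intro order_tendstoD) auto
  then have "\<forall>\<^sub>F N in sequentially. (1 - c) ^ (N - 1) * D < \<epsilon> \<and> N > 0"
    by (subst eventually_sequentially_Suc[symmetric]) simp
  then show "\<forall>\<^sub>F N in sequentially. \<forall>f\<in>zero_avg n.
      C_norm n (\<lambda>x. resolvent A n f x - (\<Sum>i<N. (A ^^ i) f x)) \<le> \<epsilon> * C_norm n f"
  proof eventually_elim
    case (elim N)
    show ?case
    proof
      fix f assume f: "f \<in> zero_avg n"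
      define u where "u = resolvent A n f"
      have u: "u \<in> zero_avg n" unfolding u_def by (rule resolvent_in[OF f])
      note ui = zero_avg_integrable[OF u]
      have m: "(\<integral>x. u x \<partial>circ) = 0" using u by (simp add: zero_avg_iff)
      have nn: "0 \<le> C_norm n f" using f by (intro C_norm_nonneg) (simp add: zero_avg_iff C_circle_def)
      obtain M where N: "N = Suc M" using elim by (cases N) auto
      have "C_norm n (\<lambda>x. u x - (\<Sum>i<N. (A ^^ i) f x)) = C_norm n (A ((A ^^ M) u))"
      proof -
        have "u x - A u x = f x" for x unfolding u_def by (rule resolvent_eq[OF f])
        from neumann_remainder[OF zero_avg_integrable[OF f] ui this]
        have "(\<lambda>x. u x - (\<Sum>i<N. (A ^^ i) f x)) = (A ^^ N) u" by (rule ext)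
        then have "C_norm n (\<lambda>x. u x - (\<Sum>i<N. (A ^^ i) f x)) = C_norm n ((A ^^ N) u)" by (rule arg_cong)
        then show ?thesis by (simp only: N funpow.simps o_apply)
      qed
      also have "\<dots> \<le> (\<Sum>i\<le>n. B i) * L1_norm ((A ^^ M) u)"
        by (rule C_norm_kop[OF integrable_kop_iter[OF ui]])
      also have "\<dots> \<le> (\<Sum>i\<le>n. B i) * ((1 - c) ^ M * (res_const n * C_norm n f))"
      proof (intro mult_left_mono sum_B_nonneg order_trans[OF L1_iter(2)[OF ui m]])
        have "L1_norm u \<le> C_norm n u" using u by (intro C_circle_L1) (simp add: zero_avg_iff)
        also have "\<dots> \<le> res_const n * C_norm n f" unfolding u_def by (rule bound[OF f])
        finally show "L1_norm u \<le> res_const n * C_norm n f" .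
      qed (use c_le_1 in auto)
      also have "\<dots> = ((1 - c) ^ M * D) * C_norm n f" by (simp add: D_def)
      also have "\<dots> \<le> \<epsilon> * C_norm n f" using elim nn N by (intro mult_right_mono) auto
      finally show "C_norm n (\<lambda>x. resolvent A n f x - (\<Sum>i<N. (A ^^ i) f x)) \<le> \<epsilon> * C_norm n f"
        by (simp add: u_def)
    qed
  qed
qed

text \<open>The stationary density is \<open>1 + u\<close>, where \<open>u\<close> solves \<open>u - A u = A 1 - 1\<close>. It is nonnegative as the
  uniform limit of the iterates \<open>A\<^sup>N 1\<close>: the difference is \<open>A\<^sup>N u\<close>, which the contraction makes small.\<close>

lemma stationary_density_exists:
  "\<exists>h. h \<in> smooth_circle \<and> A h = h \<and> (\<forall>x. 0 \<le> h x) \<and> (\<integral>x. h x \<partial>circ) = 1"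
proof -
  define e :: "real \<Rightarrow> real" where "e = (\<lambda>_. 1)"
  have e: "integrable circ e" by (simp add: e_def)
  define w where "w x = A e x - e x" for x
  have w: "integrable circ w" "(\<integral>x. w x \<partial>circ) = 0"
    using e integrable_kop[OF e] by (simp_all add: w_def[abs_def] integral_kop)
  from neumann_solution[OF w] obtain u
    where u: "integrable circ u" "(\<integral>x. u x \<partial>circ) = 0" "\<forall>x. u x - A u x = w x" by blast
  define h where "h x = e x + u x" for x
  have h_int: "integrable circ h" unfolding h_def[abs_def] using e u by simp
  have Ah: "A h = h"
  proof
    fix x
    have "A h x = A e x + A u x" using kop_lincomb[OF e u(1), of 1 1] by (simp add: h_def[abs_def])
    also have "\<dots> = h x" using u(3)[rule_format, of x] by (simp add: h_def w_def)
    finally show "A h x = h x" .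
  qed
  have iter_h: "(A ^^ N) h = h" for N by (induction N) (simp_all add: Ah)
  have nonneg: "0 \<le> (A ^^ N) e x" for N x
  proof (induction N arbitrary: x)
    case (Suc N)
    have "0 \<le> k 0 x y" for y using kernel_lower[of x y] c_pos by linarith
    with Suc show ?case by (simp add: kop_def integral_nonneg)
  qed (simp add: e_def)
  have ue: "u = (\<lambda>x. h x - e x)" by (simp add: h_def)
  have diff: "\<bar>h x - (A ^^ Suc N) e x\<bar> \<le> B 0 * ((1 - c) ^ N * L1_norm u)" for N x
  proof -
    have "h x - (A ^^ Suc N) e x = (A ^^ Suc N) u x"
      using fun_cong[OF kop_iter_diff[OF h_int e, of "Suc N"], of x] unfolding iter_h ue by simp
    moreover have "\<bar>(A ^^ Suc N) u x\<bar> \<le> B 0 * L1_norm ((A ^^ N) u)"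
      using kop_bound[OF integrable_kop_iter[OF u(1)], of 0 N x] by simp
    moreover have "B 0 * L1_norm ((A ^^ N) u) \<le> B 0 * ((1 - c) ^ N * L1_norm u)"
      by (intro mult_left_mono L1_iter u B_nonneg)
    ultimately show ?thesis by linarith
  qed
  have "0 \<le> h x" for x
  proof -
    have "(\<lambda>N. B 0 * ((1 - c) ^ N * L1_norm u)) \<longlonglongrightarrow> B 0 * (0 * L1_norm u)"
      using c_pos c_le_1 by (intro tendsto_mult LIMSEQ_power_zero tendsto_const) auto
    then have lim0: "(\<lambda>N. B 0 * ((1 - c) ^ N * L1_norm u)) \<longlonglongrightarrow> 0" by simp
    have "(\<lambda>N. h x - (A ^^ Suc N) e x) \<longlonglongrightarrow> 0"
      by (rule Lim_null_comparison[OF always_eventually lim0]) (use diff in \<open>simp only: real_norm_def simp_thms\<close>)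
    from tendsto_diff[OF tendsto_const[of "h x"] this]
    have "(\<lambda>N. (A ^^ Suc N) e x) \<longlonglongrightarrow> h x" by (simp only: diff_diff_eq2 add_diff_cancel_left' diff_zero)
    from LIMSEQ_le_const[OF this] nonneg show ?thesis by (simp only: simp_thms)
  qed
  moreover have "h \<in> smooth_circle" using kop_smooth[OF h_int] by (simp add: Ah)
  moreover have "(\<integral>x. h x \<partial>circ) = 1"
    using e u circ.prob_space by (simp add: h_def[abs_def] e_def)
  ultimately show ?thesis using Ah by blast
qed

lemma stationary_density_unique:
  assumes f: "integrable circ f" "AE x in circ. A f x = f x"
    and h: "integrable circ h" "A h = h" "(\<integral>x. f x \<partial>circ) = (\<integral>x. h x \<partial>circ)"
  shows "AE x in circ. f x = h x"
proof -
  define d where "d = (\<lambda>x. f x - h x)"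
  have d: "integrable circ d" "(\<integral>x. d x \<partial>circ) = 0" using f h by (simp_all add: d_def)
  have "AE x in circ. \<bar>d x - A d x\<bar> = 0"
    using f(2) by eventually_elim (simp add: d_def kop_diff[OF f(1) h(1)] h(2))
  then have "L1_norm (\<lambda>x. d x - A d x) = 0"
    unfolding L1_norm_def by (rule integral_eq_zero_AE)
  from L1_norm_eq_0_AE[OF d(1) fixed_zero_mean[OF d this]] show ?thesis by (simp add: d_def)
qed

end

section \<open>Linear and quadratic response for perturbations of a Markov kernel\<close>

text \<open>The abstract setting: a family \<open>L \<delta>\<close> of Markov kernel operators with a common lower bound, expanded to
  second order around \<open>A\<close> in the operator norms from \<open>L\<^sup>1\<close> to \<open>C\<^sup>n\<close>. Since these norms gain regularity, no
  derivative is lost in passing from one order of the response to the next.\<close>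

locale kernel_response = markov_kernel +
  fixes L :: "real \<Rightarrow> (real \<Rightarrow> real) \<Rightarrow> real \<Rightarrow> real" and D1 D2 :: "(real \<Rightarrow> real) \<Rightarrow> real \<Rightarrow> real"
    and h0 :: "real \<Rightarrow> real" and h :: "real \<Rightarrow> real \<Rightarrow> real"
  assumes L_markov: "\<forall>\<^sub>F \<delta> in at_right 0. \<exists>k' B'. markov_kernel k' B' c \<and> L \<delta> = kop (k' 0)"
    and D1_kernel: "\<exists>k' B'. smooth_kernel k' B' \<and> D1 = kop (k' 0)"
    and D2_kernel: "\<exists>k' B'. smooth_kernel k' B' \<and> D2 = kop (k' 0)"
    and D1_mean: "\<And>f. integrable circ f \<Longrightarrow> (\<integral>x. D1 f x \<partial>circ) = 0"
    and D2_mean: "\<And>f. integrable circ f \<Longrightarrow> (\<integral>x. D2 f x \<partial>circ) = 0"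
    and h0: "h0 \<in> smooth_circle" "A h0 = h0" "(\<integral>x. h0 x \<partial>circ) = 1"
    and h: "\<forall>\<^sub>F \<delta> in at_right 0. h \<delta> \<in> smooth_circle \<and> L \<delta> (h \<delta>) = h \<delta> \<and> (\<integral>x. h \<delta> x \<partial>circ) = 1"
    and order0: "\<And>n. \<exists>C. \<forall>\<^sub>F \<delta> in at_right 0. \<forall>f. integrable circ f \<longrightarrow>
      C_norm n (\<lambda>x. L \<delta> f x - A f x) \<le> C * \<delta> * L1_norm f"
    and order1: "\<And>n. \<exists>C. \<forall>\<^sub>F \<delta> in at_right 0. \<forall>f. integrable circ f \<longrightarrow>
      C_norm n (\<lambda>x. L \<delta> f x - A f x - \<delta> * D1 f x) \<le> C * \<delta>\<^sup>2 * L1_norm f"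
    and order2: "\<And>n \<epsilon>. 0 < \<epsilon> \<Longrightarrow> \<forall>\<^sub>F \<delta> in at_right 0. \<forall>f. integrable circ f \<longrightarrow>
      C_norm n (\<lambda>x. L \<delta> f x - A f x - \<delta> * D1 f x - \<delta>\<^sup>2 / 2 * D2 f x) \<le> \<epsilon> * \<delta>\<^sup>2 * L1_norm f"
begin

lemma smooth_integrable: "f \<in> smooth_circle \<Longrightarrow> integrable circ f"
  using C_circle_L1(1)[OF smooth_circle_C] .

lemma D_smooth: "integrable circ f \<Longrightarrow> D1 f \<in> smooth_circle" "integrable circ f \<Longrightarrow> D2 f \<in> smooth_circle"
proof -
  obtain k1 B1 k2 B2 where k: "smooth_kernel k1 B1" "D1 = kop (k1 0)" "smooth_kernel k2 B2" "D2 = kop (k2 0)"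
    using D1_kernel D2_kernel by blast
  show "integrable circ f \<Longrightarrow> D1 f \<in> smooth_circle" "integrable circ f \<Longrightarrow> D2 f \<in> smooth_circle"
    unfolding k using smooth_kernel.kop_smooth[OF k(1)] smooth_kernel.kop_smooth[OF k(3)] by auto
qed

lemma D1_lincomb:
  "integrable circ f \<Longrightarrow> integrable circ g \<Longrightarrow> D1 (\<lambda>x. a * f x + b * g x) = (\<lambda>x. a * D1 f x + b * D1 g x)"
proof -
  obtain k1 B1 where k: "smooth_kernel k1 B1" "D1 = kop (k1 0)" using D1_kernel by blast
  show "integrable circ f \<Longrightarrow> integrable circ g \<Longrightarrow> D1 (\<lambda>x. a * f x + b * g x) = (\<lambda>x. a * D1 f x + b * D1 g x)"
    unfolding k by (rule smooth_kernel.kop_lincomb[OF k(1)])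
qed

lemma D_zero_avg: "integrable circ f \<Longrightarrow> D1 f \<in> zero_avg n" "integrable circ f \<Longrightarrow> D2 f \<in> zero_avg n"
  using D_smooth D1_mean D2_mean smooth_circle_C by (auto simp: zero_avg_iff)

definition stationary_at :: "real \<Rightarrow> bool" where
  "stationary_at \<delta> \<longleftrightarrow> 0 < \<delta> \<and> (\<exists>k' B'. markov_kernel k' B' c \<and> L \<delta> = kop (k' 0)) \<and>
    h \<delta> \<in> smooth_circle \<and> L \<delta> (h \<delta>) = h \<delta> \<and> (\<integral>x. h \<delta> x \<partial>circ) = 1"

lemma eventually_stationary_at: "\<forall>\<^sub>F \<delta> in at_right 0. stationary_at \<delta>"
  using L_markov h eventually_at_right_less[of 0] by eventually_elim (simp add: stationary_at_def)

lemma h0_int: "integrable circ h0" by (rule smooth_integrable[OF h0(1)])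

context
  fixes \<delta> assumes g: "stationary_at \<delta>"
begin

lemma L_kernel: "\<exists>k' B'. smooth_kernel k' B' \<and> L \<delta> = kop (k' 0)"
  using g unfolding stationary_at_def markov_kernel_def by blast

lemma L_smooth: "integrable circ f \<Longrightarrow> L \<delta> f \<in> smooth_circle"
  using L_kernel smooth_kernel.kop_smooth by (elim exE conjE) simp

lemma L_diff: "integrable circ f \<Longrightarrow> integrable circ f' \<Longrightarrow> L \<delta> (\<lambda>x. f x - f' x) = (\<lambda>x. L \<delta> f x - L \<delta> f' x)"
  using L_kernel smooth_kernel.kop_diff by (elim exE conjE) simp

lemma h_smooth: "h \<delta> \<in> smooth_circle" using g by (simp add: stationary_at_def)

lemma h_int: "integrable circ (h \<delta>)" by (rule smooth_integrable[OF h_smooth])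

definition deviation :: "real \<Rightarrow> real" where "deviation = (\<lambda>x. h \<delta> x - h0 x)"

lemma deviation_smooth: "deviation \<in> smooth_circle"
  using smooth_circle_lincomb[OF h_smooth h0(1), of 1 "-1"] by (simp add: deviation_def)

lemma deviation_int: "integrable circ deviation" by (rule smooth_integrable[OF deviation_smooth])

lemma deviation_mean: "(\<integral>x. deviation x \<partial>circ) = 0"
  using g h_int h0_int h0(3) by (simp add: deviation_def stationary_at_def)

text \<open>This uses the contraction of the perturbed operator and not of \<open>A\<close>:
  \<open>deviation - L \<delta> deviation = (L \<delta> - A) h0\<close> contains no unknown on the right-hand side.\<close>

lemma deviation_L1: "c * L1_norm deviation \<le> C_norm 0 (\<lambda>x. L \<delta> h0 x - A h0 x)"
proof -
  obtain k' B' where k': "markov_kernel k' B' c" "L \<delta> = kop (k' 0)" using g by (auto simp: stationary_at_def)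
  interpret k': markov_kernel k' B' c by (rule k')
  have "(\<lambda>x. deviation x - L \<delta> deviation x) = (\<lambda>x. L \<delta> h0 x - A h0 x)"
    using L_diff[OF h_int h0_int] g h0(2) by (auto simp: stationary_at_def deviation_def fun_eq_iff)
  with k'.L1_a_priori[OF deviation_int deviation_mean]
  have "c * L1_norm deviation \<le> L1_norm (\<lambda>x. L \<delta> h0 x - A h0 x)" by (simp add: k')
  also have "\<dots> \<le> C_norm 0 (\<lambda>x. L \<delta> h0 x - A h0 x)"
    using smooth_circle_lincomb[OF L_smooth[OF h0_int] h0(1), of 1 "-1"]
    by (intro C_circle_L1 smooth_circle_C) (simp add: h0(2))
  finally show ?thesis .
qed

lemma deviation_eq: "deviation x - A deviation x = (L \<delta> h0 x - A h0 x) + (L \<delta> deviation x - A deviation x)"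
proof -
  have "L \<delta> deviation x = L \<delta> (h \<delta>) x - L \<delta> h0 x" unfolding deviation_def by (simp add: L_diff[OF h_int h0_int])
  then show ?thesis using g h0(2) by (simp add: stationary_at_def deviation_def)
qed

end

lemma deviation_bound: "\<exists>C\<ge>0. \<forall>\<^sub>F \<delta> in at_right 0. L1_norm (deviation \<delta>) \<le> C * \<delta>"
proof -
  obtain C where C: "\<forall>\<^sub>F \<delta> in at_right 0. \<forall>f. integrable circ f \<longrightarrow>
      C_norm 0 (\<lambda>x. L \<delta> f x - A f x) \<le> C * \<delta> * L1_norm f" using order0 by blast
  have "\<forall>\<^sub>F \<delta> in at_right 0. L1_norm (deviation \<delta>) \<le> \<bar>C\<bar> * L1_norm h0 / c * \<delta>"
    using C eventually_stationary_at
  proof eventually_elim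
    case (elim \<delta>)
    have "c * L1_norm (deviation \<delta>) \<le> C * \<delta> * L1_norm h0"
      using deviation_L1[OF elim(2)] elim(1)[rule_format, OF h0_int] by linarith
    also have "\<dots> \<le> \<bar>C\<bar> * \<delta> * L1_norm h0"
      using elim(2) by (intro mult_right_mono L1_norm_nonneg) (auto simp: stationary_at_def)
    finally show ?case using c_pos by (simp add: field_simps)
  qed
  moreover have "0 \<le> \<bar>C\<bar> * L1_norm h0 / c" using c_pos L1_norm_nonneg by simp
  ultimately show ?thesis by blast
qed

text \<open>The equation \<open>(1 - A)(deviation - \<delta> h1) = (L \<delta> - A - \<delta> D1) h0 + (L \<delta> - A) deviation\<close> has both
  terms on the right of order \<open>\<delta>\<^sup>2\<close>; the a priori estimate passes this on to the left.\<close>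

lemma first_order:
  assumes h1: "h1 \<in> zero_avg n" "\<And>x. h1 x - A h1 x = D1 h0 x"
  shows "\<exists>K\<ge>0. \<forall>\<^sub>F \<delta> in at_right 0. C_norm n (\<lambda>x. deviation \<delta> x - \<delta> * h1 x) \<le> K * \<delta>\<^sup>2"
proof -
  obtain C where C: "C \<ge> 0" "\<forall>\<^sub>F \<delta> in at_right 0. L1_norm (deviation \<delta>) \<le> C * \<delta>" using deviation_bound by blast
  obtain C0 where C0: "\<forall>\<^sub>F \<delta> in at_right 0. \<forall>f. integrable circ f \<longrightarrow>
      C_norm n (\<lambda>x. L \<delta> f x - A f x) \<le> C0 * \<delta> * L1_norm f" using order0 by blast
  obtain C1 where C1: "\<forall>\<^sub>F \<delta> in at_right 0. \<forall>f. integrable circ f \<longrightarrow>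
      C_norm n (\<lambda>x. L \<delta> f x - A f x - \<delta> * D1 f x) \<le> C1 * \<delta>\<^sup>2 * L1_norm f" using order1 by blast
  define K where "K = \<bar>res_const n * (C1 * L1_norm h0 + \<bar>C0\<bar> * C)\<bar>"
  have "\<forall>\<^sub>F \<delta> in at_right 0. C_norm n (\<lambda>x. deviation \<delta> x - \<delta> * h1 x) \<le> K * \<delta>\<^sup>2"
    using C(2) C0 C1 eventually_stationary_at
  proof eventually_elim
    case (elim \<delta>)
    note g = elim(4)
    have \<delta>: "\<delta> > 0" using g by (simp add: stationary_at_def)
    note di = deviation_int[OF g] and hi = zero_avg_integrable[OF h1(1)]
    define u where "u = (\<lambda>x. deviation \<delta> x - \<delta> * h1 x)"
    define f1 where "f1 = (\<lambda>x. L \<delta> h0 x - A h0 x - \<delta> * D1 h0 x)"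
    define f2 where "f2 = (\<lambda>x. L \<delta> (deviation \<delta>) x - A (deviation \<delta>) x)"
    have f1s: "f1 \<in> smooth_circle"
      using smooth_circle_lincomb[OF smooth_circle_lincomb[OF L_smooth[OF g h0_int] kop_smooth[OF h0_int], of 1 "-1"]
          D_smooth(1)[OF h0_int], of 1 "-\<delta>"] by (simp add: f1_def)
    have f2s: "f2 \<in> smooth_circle"
      using smooth_circle_lincomb[OF L_smooth[OF g di] kop_smooth[OF di], of 1 "-1"] by (simp add: f2_def)
    have "(\<lambda>x. 1 * deviation \<delta> x + (-\<delta>) * h1 x) \<in> C_circle n"
      using h1 by (intro C_circle_lincomb smooth_circle_C[OF deviation_smooth[OF g]]) (simp add: zero_avg_iff)
    then have u: "u \<in> zero_avg n"
      using deviation_mean[OF g] h1(1) di hi by (simp add: zero_avg_iff u_def)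
    have "(\<lambda>x. u x - A u x) = (\<lambda>x. f1 x + f2 x)"
    proof
      fix x
      have "A u x = A (deviation \<delta>) x - \<delta> * A h1 x"
        using fun_cong[OF kop_lincomb[OF di hi, of 1 "-\<delta>"], of x] by (simp add: u_def)
      then show "u x - A u x = f1 x + f2 x"
        using deviation_eq[OF g, of x] arg_cong[OF h1(2)[of x], of "\<lambda>t. \<delta> * t"]
        by (simp add: u_def f1_def f2_def algebra_simps)
    qed
    with C_norm_a_priori[OF u] have "C_norm n u \<le> res_const n * C_norm n (\<lambda>x. f1 x + f2 x)" by simp
    also have "\<dots> \<le> res_const n * (C1 * \<delta>\<^sup>2 * L1_norm h0 + \<bar>C0\<bar> * \<delta> * (C * \<delta>))"
    proof (rule mult_left_mono)
      have "C_norm n (\<lambda>x. f1 x + f2 x) \<le> C_norm n f1 + C_norm n f2"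
        using f1s f2s by (intro C_norm_add) (auto simp: smooth_circle_def C_circle_def)
      moreover have "C_norm n f1 \<le> C1 * \<delta>\<^sup>2 * L1_norm h0"
        unfolding f1_def using elim(3) h0_int by blast
      moreover have "C_norm n f2 \<le> C0 * \<delta> * L1_norm (deviation \<delta>)"
        unfolding f2_def using elim(2) di by blast
      moreover have "C0 * \<delta> * L1_norm (deviation \<delta>) \<le> \<bar>C0\<bar> * \<delta> * (C * \<delta>)"
        using \<delta> elim(1) L1_norm_nonneg by (intro mult_mono) auto
      ultimately show "C_norm n (\<lambda>x. f1 x + f2 x) \<le> C1 * \<delta>\<^sup>2 * L1_norm h0 + \<bar>C0\<bar> * \<delta> * (C * \<delta>)" by linarith
      show "0 \<le> res_const n" using c_pos sum_B_nonneg by (simp add: res_const_def add_nonneg_nonneg)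
    qed
    also have "\<dots> = res_const n * (C1 * L1_norm h0 + \<bar>C0\<bar> * C) * \<delta>\<^sup>2"
      by (simp add: power2_eq_square algebra_simps)
    also have "\<dots> \<le> K * \<delta>\<^sup>2" unfolding K_def by (intro mult_right_mono) auto
    finally show ?case by (simp add: u_def)
  qed
  moreover have "K \<ge> 0" by (simp add: K_def)
  ultimately show ?thesis by blast
qed

theorem linear_response:
  assumes h1: "h1 \<in> zero_avg n" "\<And>x. h1 x - A h1 x = D1 h0 x"
  shows "((\<lambda>\<delta>. C_norm n (\<lambda>x. (h \<delta> x - h0 x) / \<delta> - h1 x)) \<longlongrightarrow> 0) (at_right 0)"
proof -
  obtain K where K: "\<forall>\<^sub>F \<delta> in at_right 0. C_norm n (\<lambda>x. deviation \<delta> x - \<delta> * h1 x) \<le> K * \<delta>\<^sup>2"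
    using first_order[OF h1] by blast
  show ?thesis
  proof (rule Lim_null_comparison)
    show "((\<lambda>\<delta>. K * \<delta>) \<longlongrightarrow> 0) (at_right 0)"
      by (auto intro!: tendsto_eq_intros)
    show "\<forall>\<^sub>F \<delta> in at_right 0. norm (C_norm n (\<lambda>x. (h \<delta> x - h0 x) / \<delta> - h1 x)) \<le> K * \<delta>"
      using K eventually_stationary_at
    proof eventually_elim
      case (elim \<delta>)
      have \<delta>: "\<delta> > 0" using elim(2) by (simp add: stationary_at_def)
      have "(\<lambda>x. 1 * deviation \<delta> x + (-\<delta>) * h1 x) \<in> C_circle n"
        using h1 by (intro C_circle_lincomb smooth_circle_C[OF deviation_smooth[OF elim(2)]]) (simp add: zero_avg_iff)
      then have cd: "C_diff n (\<lambda>x. deviation \<delta> x - \<delta> * h1 x)" by (simp add: C_circle_def)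
      have eq: "(\<lambda>x. (h \<delta> x - h0 x) / \<delta> - h1 x) = (\<lambda>x. (1 / \<delta>) * (deviation \<delta> x - \<delta> * h1 x))"
        using \<delta> by (simp add: deviation_def[OF elim(2)] fun_eq_iff field_simps)
      have "C_norm n (\<lambda>x. (h \<delta> x - h0 x) / \<delta> - h1 x) \<le> (1 / \<delta>) * C_norm n (\<lambda>x. deviation \<delta> x - \<delta> * h1 x)"
        unfolding eq using C_norm_scale[OF cd, of "1 / \<delta>"] \<delta> by simp
      also have "\<dots> \<le> (1 / \<delta>) * (K * \<delta>\<^sup>2)" using elim(1) \<delta> by (intro mult_left_mono) auto
      also have "\<dots> = K * \<delta>" using \<delta> by (simp add: power2_eq_square)
      finally have "C_norm n (\<lambda>x. (h \<delta> x - h0 x) / \<delta> - h1 x) \<le> K * \<delta>" .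
      moreover have "0 \<le> C_norm n (\<lambda>x. (h \<delta> x - h0 x) / \<delta> - h1 x)"
        unfolding eq using C_diff_lincomb[OF cd cd, of "1 / \<delta>" 0] by (intro C_norm_nonneg) simp
      ultimately show ?case by simp
    qed
  qed
qed

text \<open>Subtracting also \<open>\<delta>\<^sup>2 h2\<close>, the right-hand side becomes
  \<open>(L \<delta> - A - \<delta> D1 - \<delta>\<^sup>2/2 D2) h0 + (L \<delta> - A - \<delta> D1) deviation + \<delta> D1 (deviation - \<delta> h1)\<close>. The first term
  is \<open>o(\<delta>\<^sup>2)\<close> and the other two are \<open>O(\<delta>\<^sup>3)\<close>.\<close>

theorem quadratic_response:
  assumes h1: "h1 \<in> zero_avg n" "\<And>x. h1 x - A h1 x = D1 h0 x"
    and h2: "h2 \<in> zero_avg n" "\<And>x. h2 x - A h2 x = 1 / 2 * D2 h0 x + D1 h1 x"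
  shows "((\<lambda>\<delta>. C_norm n (\<lambda>x. (h \<delta> x - h0 x - \<delta> * h1 x) / \<delta>\<^sup>2 - h2 x)) \<longlongrightarrow> 0) (at_right 0)"
proof -
  obtain C where C: "C \<ge> 0" "\<forall>\<^sub>F \<delta> in at_right 0. L1_norm (deviation \<delta>) \<le> C * \<delta>" using deviation_bound by blast
  obtain K where K: "K \<ge> 0" "\<forall>\<^sub>F \<delta> in at_right 0. C_norm n (\<lambda>x. deviation \<delta> x - \<delta> * h1 x) \<le> K * \<delta>\<^sup>2"
    using first_order[OF h1] by blast
  obtain C1 where C1: "\<forall>\<^sub>F \<delta> in at_right 0. \<forall>f. integrable circ f \<longrightarrow>
      C_norm n (\<lambda>x. L \<delta> f x - A f x - \<delta> * D1 f x) \<le> C1 * \<delta>\<^sup>2 * L1_norm f" using order1 by blast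
  obtain k1 B1 where k1: "smooth_kernel k1 B1" "D1 = kop (k1 0)" using D1_kernel by blast
  interpret k1: smooth_kernel k1 B1 by (rule k1)
  define S where "S = (\<Sum>i\<le>n. B1 i)"
  have S: "0 \<le> S" by (simp add: S_def sum_nonneg k1.B_nonneg)
  have R: "0 \<le> res_const n" using c_pos sum_B_nonneg by (simp add: res_const_def add_nonneg_nonneg)
  define V where "V \<delta> = C_norm n (\<lambda>x. (h \<delta> x - h0 x - \<delta> * h1 x) / \<delta>\<^sup>2 - h2 x)" for \<delta>
  have bound: "\<forall>\<^sub>F \<delta> in at_right 0. 0 \<le> V \<delta> \<and> V \<delta> \<le> res_const n * (\<epsilon> * L1_norm h0 + (\<bar>C1\<bar> * C + S * K) * \<delta>)"
    if "0 < \<epsilon>" for \<epsilon>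
    using C(2) K(2) C1 eventually_stationary_at order2[OF that, of n]
  proof eventually_elim
    case (elim \<delta>)
    note g = elim(4)
    have \<delta>: "\<delta> > 0" using g by (simp add: stationary_at_def)
    note di = deviation_int[OF g] and hi1 = zero_avg_integrable[OF h1(1)] and hi2 = zero_avg_integrable[OF h2(1)]
    define u1 where "u1 = (\<lambda>x. deviation \<delta> x - \<delta> * h1 x)"
    define u where "u = (\<lambda>x. u1 x - \<delta>\<^sup>2 * h2 x)"
    define f1 where "f1 = (\<lambda>x. L \<delta> h0 x - A h0 x - \<delta> * D1 h0 x - \<delta>\<^sup>2 / 2 * D2 h0 x)"
    define f2 where "f2 = (\<lambda>x. L \<delta> (deviation \<delta>) x - A (deviation \<delta>) x - \<delta> * D1 (deviation \<delta>) x)"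
    have f1s: "f1 \<in> smooth_circle"
      using smooth_circle_lincomb[OF smooth_circle_lincomb[OF smooth_circle_lincomb[OF L_smooth[OF g h0_int] kop_smooth[OF h0_int], of 1 "-1"]
          D_smooth(1)[OF h0_int], of 1 "-\<delta>"] D_smooth(2)[OF h0_int], of 1 "-(\<delta>\<^sup>2 / 2)"] by (simp add: f1_def)
    have f2s: "f2 \<in> smooth_circle"
      using smooth_circle_lincomb[OF smooth_circle_lincomb[OF L_smooth[OF g di] kop_smooth[OF di], of 1 "-1"]
          D_smooth(1)[OF di], of 1 "-\<delta>"] by (simp add: f2_def)
    have "(\<lambda>x. 1 * deviation \<delta> x + (-\<delta>) * h1 x) \<in> C_circle n"
      using h1 by (intro C_circle_lincomb smooth_circle_C[OF deviation_smooth[OF g]]) (simp add: zero_avg_iff)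
    then have u1: "u1 \<in> C_circle n" "integrable circ u1" "(\<integral>x. u1 x \<partial>circ) = 0"
      using deviation_mean[OF g] h1(1) di hi1 by (simp_all add: zero_avg_iff u1_def)
    have "(\<lambda>x. 1 * u1 x + (-\<delta>\<^sup>2) * h2 x) \<in> C_circle n"
      using h2 u1 by (intro C_circle_lincomb) (simp_all add: zero_avg_iff)
    then have u: "u \<in> zero_avg n"
      using u1 h2(1) hi2 by (simp add: zero_avg_iff u_def)
    have Du1s: "D1 u1 \<in> smooth_circle" by (rule D_smooth(1)[OF u1(2)])
    have "(\<lambda>x. u x - A u x) = (\<lambda>x. (f1 x + f2 x) + \<delta> * D1 u1 x)"
    proof
      fix x
      have Au: "A u x = A (deviation \<delta>) x - \<delta> * A h1 x - \<delta>\<^sup>2 * A h2 x"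
        using fun_cong[OF kop_lincomb[OF di hi1, of 1 "-\<delta>"], of x]
          fun_cong[OF kop_lincomb[OF u1(2) hi2, of 1 "-\<delta>\<^sup>2"], of x] by (simp add: u_def u1_def)
      have Du1: "D1 u1 x = D1 (deviation \<delta>) x - \<delta> * D1 h1 x"
        using fun_cong[OF D1_lincomb[OF di hi1, of 1 "-\<delta>"], of x] by (simp add: u1_def)
      have "u x - A u x = (deviation \<delta> x - A (deviation \<delta>) x) - \<delta> * (h1 x - A h1 x) - \<delta>\<^sup>2 * (h2 x - A h2 x)"
        unfolding Au by (simp add: u_def u1_def algebra_simps)
      also have "\<dots> = (f1 x + f2 x) + \<delta> * D1 u1 x"
        unfolding deviation_eq[OF g] h1(2) h2(2) Du1 f1_def f2_def by (simp add: power2_eq_square algebra_simps)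
      finally show "u x - A u x = (f1 x + f2 x) + \<delta> * D1 u1 x" .
    qed
    with C_norm_a_priori[OF u] have "C_norm n u \<le> res_const n * C_norm n (\<lambda>x. (f1 x + f2 x) + \<delta> * D1 u1 x)" by simp
    also have "\<dots> \<le> res_const n * (\<epsilon> * \<delta>\<^sup>2 * L1_norm h0 + \<bar>C1\<bar> * \<delta>\<^sup>2 * (C * \<delta>) + \<delta> * (S * (K * \<delta>\<^sup>2)))"
    proof (rule mult_left_mono[OF _ R])
      have cd: "C_diff n f1" "C_diff n f2" "C_diff n (D1 u1)"
        using f1s f2s Du1s by (auto simp: smooth_circle_def C_circle_def)
      have "C_norm n (\<lambda>x. 1 * (1 * f1 x + 1 * f2 x) + \<delta> * D1 u1 x)
          \<le> \<bar>1\<bar> * C_norm n (\<lambda>x. 1 * f1 x + 1 * f2 x) + \<bar>\<delta>\<bar> * C_norm n (D1 u1)"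
        by (intro C_norm_lincomb C_diff_lincomb cd)
      then have "C_norm n (\<lambda>x. (f1 x + f2 x) + \<delta> * D1 u1 x) \<le> C_norm n (\<lambda>x. f1 x + f2 x) + \<delta> * C_norm n (D1 u1)"
        using \<delta> by simp
      moreover have "C_norm n (\<lambda>x. f1 x + f2 x) \<le> C_norm n f1 + C_norm n f2"
        by (intro C_norm_add cd)
      moreover have "C_norm n f1 \<le> \<epsilon> * \<delta>\<^sup>2 * L1_norm h0"
        unfolding f1_def using elim(5) h0_int by blast
      moreover have "C_norm n f2 \<le> C1 * \<delta>\<^sup>2 * L1_norm (deviation \<delta>)"
        unfolding f2_def using elim(3) di by blast
      moreover have "C1 * \<delta>\<^sup>2 * L1_norm (deviation \<delta>) \<le> \<bar>C1\<bar> * \<delta>\<^sup>2 * (C * \<delta>)"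
        using \<delta> elim(1) L1_norm_nonneg by (intro mult_mono) auto
      moreover have "\<delta> * C_norm n (D1 u1) \<le> \<delta> * (S * (K * \<delta>\<^sup>2))"
      proof (rule mult_left_mono)
        have "C_norm n (D1 u1) \<le> S * L1_norm u1"
          unfolding k1(2) S_def by (rule k1.C_norm_kop[OF u1(2)])
        also have "\<dots> \<le> S * (K * \<delta>\<^sup>2)"
          using C_circle_L1(2)[OF u1(1)] elim(2) by (intro mult_left_mono S) (simp add: u1_def)
        finally show "C_norm n (D1 u1) \<le> S * (K * \<delta>\<^sup>2)" .
      qed (use \<delta> in simp)
      ultimately show "C_norm n (\<lambda>x. (f1 x + f2 x) + \<delta> * D1 u1 x)
          \<le> \<epsilon> * \<delta>\<^sup>2 * L1_norm h0 + \<bar>C1\<bar> * \<delta>\<^sup>2 * (C * \<delta>) + \<delta> * (S * (K * \<delta>\<^sup>2))" by linarith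
    qed
    also have "\<dots> = \<delta>\<^sup>2 * (res_const n * (\<epsilon> * L1_norm h0 + (\<bar>C1\<bar> * C + S * K) * \<delta>))"
      by (simp add: power2_eq_square algebra_simps)
    finally have le: "C_norm n u \<le> \<delta>\<^sup>2 * (res_const n * (\<epsilon> * L1_norm h0 + (\<bar>C1\<bar> * C + S * K) * \<delta>))" .
    have cd: "C_diff n u" using u by (simp add: zero_avg_iff C_circle_def)
    have eq: "(\<lambda>x. (h \<delta> x - h0 x - \<delta> * h1 x) / \<delta>\<^sup>2 - h2 x) = (\<lambda>x. (1 / \<delta>\<^sup>2) * u x)"
      using \<delta> by (simp add: deviation_def[OF g] u_def u1_def fun_eq_iff field_simps)
    have "V \<delta> \<le> (1 / \<delta>\<^sup>2) * C_norm n u"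
      unfolding V_def eq using C_norm_scale[OF cd, of "1 / \<delta>\<^sup>2"] by simp
    also have "\<dots> \<le> (1 / \<delta>\<^sup>2) * (\<delta>\<^sup>2 * (res_const n * (\<epsilon> * L1_norm h0 + (\<bar>C1\<bar> * C + S * K) * \<delta>)))"
      using le by (rule mult_left_mono) simp
    also have "\<dots> = res_const n * (\<epsilon> * L1_norm h0 + (\<bar>C1\<bar> * C + S * K) * \<delta>)" using \<delta> by simp
    finally have "V \<delta> \<le> res_const n * (\<epsilon> * L1_norm h0 + (\<bar>C1\<bar> * C + S * K) * \<delta>)" .
    moreover have "0 \<le> V \<delta>"
      unfolding V_def eq using C_diff_lincomb[OF cd cd, of "1 / \<delta>\<^sup>2" 0] by (intro C_norm_nonneg) simp
    ultimately show ?case by simp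
  qed
  have "(V \<longlongrightarrow> 0) (at_right 0)"
  proof (rule tendstoI)
    fix r :: real assume r: "r > 0"
    \<comment> \<open>\<open>+ 1\<close> only keeps the denominator of \<open>\<epsilon>\<close> away from zero\<close>
    define m where "m = res_const n * L1_norm h0 + 1"
    define \<epsilon> where "\<epsilon> = r / 2 / m"
    have den: "0 < m" using R L1_norm_nonneg by (simp add: m_def add_nonneg_pos)
    have \<epsilon>: "\<epsilon> > 0" using r den by (simp add: \<epsilon>_def)
    have small: "res_const n * (\<epsilon> * L1_norm h0) \<le> r / 2"
    proof -
      have "\<epsilon> * (res_const n * L1_norm h0) \<le> \<epsilon> * m"
        using \<epsilon> by (intro mult_left_mono) (auto simp: m_def)
      also have "\<dots> = r / 2" using den by (simp add: \<epsilon>_def)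
      finally show ?thesis by (simp add: mult_ac)
    qed
    have "((\<lambda>\<delta>. res_const n * ((\<bar>C1\<bar> * C + S * K) * \<delta>)) \<longlongrightarrow> res_const n * ((\<bar>C1\<bar> * C + S * K) * 0)) (at_right 0)"
      by (intro tendsto_mult_left tendsto_ident_at)
    then have "((\<lambda>\<delta>. res_const n * ((\<bar>C1\<bar> * C + S * K) * \<delta>)) \<longlongrightarrow> 0) (at_right 0)"
      by (simp only: mult_zero_right)
    then have "\<forall>\<^sub>F \<delta> in at_right 0. res_const n * ((\<bar>C1\<bar> * C + S * K) * \<delta>) < r / 2"
      using r by (intro order_tendstoD) auto
    then show "\<forall>\<^sub>F \<delta> in at_right 0. dist (V \<delta>) 0 < r"
      using bound[OF \<epsilon>]
    proof eventually_elim
      case (elim \<delta>)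
      then have "V \<delta> < r" using small by (simp only: distrib_left) linarith
      with elim show ?case by (simp add: dist_real_def)
    qed
  qed
  then show ?thesis unfolding V_def[abs_def] .
qed

end

section \<open>The transfer operator\<close>

text \<open>The circle map itself, with values in the fundamental domain, also pulls null sets back to null
  sets, because the union of the integer translates of a null set is null.\<close>

lemma nonsingular_circle_map_frac:
  assumes "nonsingular_circle_map T"
  shows "(\<lambda>y. frac (T y)) \<in> borel_measurable circ"
    and "negligible N \<Longrightarrow> negligible ((\<lambda>y. frac (T y)) -` N)"
proof -
  have T: "T \<in> borel_measurable lebesgue" "\<And>N. negligible N \<Longrightarrow> negligible (T -` N)"
    using assms by (auto simp: nonsingular_circle_map_def negligible_iff_null_sets)
  have fr: "(frac :: real \<Rightarrow> real) \<in> borel_measurable borel"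
    unfolding frac_def[abs_def] by measurable
  show "(\<lambda>y. frac (T y)) \<in> borel_measurable circ"
    by (intro measurable_restrict_space1 measurable_compose[OF T(1) fr])
  assume N: "negligible N"
  have "negligible (\<Union>k::int. (+) (of_int k) ` N)"
    using negligible_translation[OF N] by (intro negligible_countable_Union) auto
  from T(2)[OF this] show "negligible ((\<lambda>y. frac (T y)) -` N)"
  proof (rule negligible_subset)
    show "(\<lambda>y. frac (T y)) -` N \<subseteq> T -` (\<Union>k::int. (+) (of_int k) ` N)"
    proof
      fix y assume "y \<in> (\<lambda>y. frac (T y)) -` N"
      then have "frac (T y) \<in> N" by simp
      then have "T y \<in> (+) (of_int \<lfloor>T y\<rfloor>) ` N"
        by (intro image_eqI[of _ _ "frac (T y)"]) (simp_all add: frac_def)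
      then show "y \<in> T -` (\<Union>k::int. (+) (of_int k) ` N)" by blast
    qed
  qed
qed

text \<open>The density is the Radon-Nikodym derivative of the image under \<open>t\<close> of the measure with density \<open>f\<close>;
  nonsingularity is exactly the absolute continuity that this needs.\<close>

lemma transfer_density_nonneg:
  fixes f t :: "real \<Rightarrow> real"
  assumes t: "t \<in> borel_measurable circ" "\<And>N. negligible N \<Longrightarrow> negligible (t -` N)"
    and f: "integrable circ f" "\<And>x. 0 \<le> f x"
  shows "\<exists>d. integrable lborel d \<and>
    (\<forall>g. g \<in> borel_measurable borel \<and> bounded (range g) \<longrightarrow>
      (\<integral>x. d x * g x \<partial>lborel) = (\<integral>y. f y * g (t y) \<partial>circ))"
proof -
  note t(1)[measurable]
  have fm[measurable]: "f \<in> borel_measurable circ" using f(1) by simp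
  have tm: "t \<in> density circ f \<rightarrow>\<^sub>M lborel" by simp
  define \<nu> where "\<nu> = distr (density circ f) lborel t"
  have fin: "finite_measure \<nu>"
  proof
    have "emeasure \<nu> (space \<nu>) = (\<integral>\<^sup>+x. f x \<partial>circ)"
      unfolding \<nu>_def by (subst emeasure_distr[OF tm])
        (auto simp: emeasure_density intro!: nn_integral_cong)
    also have "\<dots> = ennreal (\<integral>x. f x \<partial>circ)"
      using f by (intro nn_integral_eq_integral) auto
    finally show "emeasure \<nu> (space \<nu>) \<noteq> \<infinity>" by simp
  qed
  have ac: "absolutely_continuous lborel \<nu>"
    unfolding absolutely_continuous_def
  proof
    fix N assume N: "N \<in> null_sets (lborel :: real measure)"
    then have Ns: "N \<in> sets lborel" by auto
    have "negligible N"
      using N by (simp add: negligible_iff_null_sets null_sets_completionI)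
    from t(2)[OF this] have "negligible (t -` N \<inter> {0..<1})" by (rule negligible_subset) auto
    then have "AE x in lebesgue. x \<notin> t -` N \<inter> {0..<1}"
      unfolding negligible_iff_null_sets by (rule AE_not_in)
    then have "AE x in circ. t x \<notin> N"
      by (subst AE_restrict_space_iff) (auto elim!: eventually_mono)
    then have "AE x in circ. ennreal (f x) * indicator (t -` N \<inter> space (density circ f)) x = 0"
      by eventually_elim (auto simp: indicator_def)
    then have "(\<integral>\<^sup>+x. ennreal (f x) * indicator (t -` N \<inter> space (density circ f)) x \<partial>circ) = 0"
      by (subst nn_integral_cong_AE[where v = "\<lambda>_. 0"]) auto
    moreover have "t -` N \<inter> space (density circ f) \<in> sets circ"
      using measurable_sets[OF tm Ns] by simp
    ultimately have "emeasure \<nu> N = 0"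
      unfolding \<nu>_def by (subst emeasure_distr[OF tm Ns]) (simp add: emeasure_density)
    then show "N \<in> null_sets \<nu>" using Ns by (auto simp: \<nu>_def)
  qed
  have sets: "sets \<nu> = sets lborel" by (simp add: \<nu>_def)
  obtain d where d: "d \<in> borel_measurable lborel" "AE x in lborel. RN_deriv lborel \<nu> x = ennreal (d x)"
      "AE x in \<nu>. 0 < d x" "\<And>x. 0 \<le> d x"
    by (rule sigma_finite_measure.real_RN_deriv[OF sigma_finite_lborel fin ac sets]) blast
  note d(1)[measurable]
  have "\<nu> = density lborel (RN_deriv lborel \<nu>)" 
    using sigma_finite_measure.density_RN_deriv[OF sigma_finite_lborel ac sets] ..
  also have "\<dots> = density lborel (\<lambda>x. ennreal (d x))"
    using d by (intro density_cong) auto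
  finally have \<nu>: "\<nu> = density lborel (\<lambda>x. ennreal (d x))" .
  interpret fin: finite_measure \<nu> by (rule fin)
  have "integrable \<nu> (\<lambda>_. 1 :: real)" by simp
  then have "integrable lborel d"
    unfolding \<nu> by (subst (asm) integrable_density) (use d in auto)
  moreover have "(\<integral>x. d x * g x \<partial>lborel) = (\<integral>y. f y * g (t y) \<partial>circ)"
    if g: "g \<in> borel_measurable borel" for g :: "real \<Rightarrow> real"
  proof -
    note g[measurable]
    have "(\<integral>x. d x * g x \<partial>lborel) = (\<integral>x. g x \<partial>\<nu>)"
      unfolding \<nu> by (subst integral_density) (use d in auto)
    also have "\<dots> = (\<integral>x. g (t x) \<partial>density circ f)"
      unfolding \<nu>_def by (rule integral_distr[OF tm]) simp
    also have "\<dots> = (\<integral>y. f y * g (t y) \<partial>circ)"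
      by (subst integral_density) (use f in auto)
    finally show ?thesis .
  qed
  ultimately show ?thesis by blast
qed

text \<open>The duality that characterizes the transfer operator holds because a function satisfying it exists:
  treat the positive and the negative part of \<open>f\<close> separately and extend the densities periodically.\<close>

lemma transfer_op_duality:
  assumes T: "nonsingular_circle_map T" and f: "integrable circ f"
  shows "integrable circ (transfer_op T f)"
    and "\<And>g. periodic g \<Longrightarrow> g \<in> borel_measurable borel \<Longrightarrow> bounded (range g) \<Longrightarrow>
      (\<integral>x. transfer_op T f x * g x \<partial>circ) = (\<integral>y. f y * g (T y) \<partial>circ)"
proof -
  define t where "t y = frac (T y)" for y
  have t: "t \<in> borel_measurable circ" "\<And>N. negligible N \<Longrightarrow> negligible (t -` N)"
    using nonsingular_circle_map_frac[OF T] unfolding t_def[abs_def] by blast+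
  have ex: "\<exists>d. integrable circ d \<and> (\<forall>g. periodic g \<and> g \<in> borel_measurable borel \<and> bounded (range g) \<longrightarrow>
      (\<integral>x. d x * g x \<partial>circ) = (\<integral>y. f y * g (T y) \<partial>circ))"
    if f: "integrable circ f" "\<And>x. 0 \<le> f x" for f
  proof -
    from transfer_density_nonneg[OF t f] obtain d where d: "integrable lborel d"
      "\<And>g. g \<in> borel_measurable borel \<Longrightarrow> bounded (range g) \<Longrightarrow> (\<integral>x. d x * g x \<partial>lborel) = (\<integral>y. f y * g (t y) \<partial>circ)"
      by blast
    have dm: "d \<in> borel_measurable borel" using borel_measurable_integrable[OF d(1)] by simp
    have "integrable lebesgue (\<lambda>x. indicator {0..<1} x *\<^sub>R d x)"
      using integrable_mult_indicator[OF _ d(1), of "{0..<1}"] dm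
      by (subst integrable_completion) simp_all
    then have "integrable circ d" by (subst integrable_restrict_space) auto
    moreover have "(\<integral>x. d x * g x \<partial>circ) = (\<integral>y. f y * g (T y) \<partial>circ)"
      if g: "periodic g" "g \<in> borel_measurable borel" "bounded (range g)" for g
    proof -
      define g' where "g' x = indicator {0..<1} x * g x" for x
      note dm[measurable] g(2)[measurable]
      have "bounded (range g')"
      proof -
        obtain B where "\<And>x. \<bar>g x\<bar> \<le> B" using g(3) by (auto simp: bounded_iff)
        then have "norm (g' x) \<le> \<bar>B\<bar>" for x
          unfolding g'_def indicator_def by (cases "x \<in> {0..<1}") (simp_all add: order_trans[OF _ abs_ge_self])
        then show ?thesis by (auto simp: bounded_iff)
      qed
      moreover have "g' \<in> borel_measurable borel" unfolding g'_def[abs_def] by measurable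
      ultimately have "(\<integral>x. d x * g' x \<partial>lborel) = (\<integral>y. f y * g' (t y) \<partial>circ)" by (intro d(2))
      moreover have "g' (t y) = g (T y)" for y
        using g(1) periodic_frac[of g "T y"] by (simp add: g'_def t_def periodic_def frac_lt_1)
      moreover have "(\<integral>x. d x * g x \<partial>circ) = (\<integral>x. d x * g' x \<partial>lborel)"
        by (subst integral_circ_borel) (auto simp: g'_def mult_ac)
      ultimately show ?thesis by simp
    qed
    ultimately show ?thesis by blast
  qed
  define fp where "fp x = max (f x) 0" for x
  define fm where "fm x = max (- f x) 0" for x
  have fpm: "integrable circ fp" "integrable circ fm" "\<And>x. 0 \<le> fp x" "\<And>x. 0 \<le> fm x" "\<And>x. f x = fp x - fm x"
    using f by (auto simp: fp_def[abs_def] fm_def[abs_def])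
  from ex[OF fpm(1,3)] obtain dp where dp: "integrable circ dp"
    "\<And>g. periodic g \<Longrightarrow> g \<in> borel_measurable borel \<Longrightarrow> bounded (range g) \<Longrightarrow>
      (\<integral>x. dp x * g x \<partial>circ) = (\<integral>y. fp y * g (T y) \<partial>circ)" by blast
  from ex[OF fpm(2,4)] obtain dm where dm: "integrable circ dm"
    "\<And>g. periodic g \<Longrightarrow> g \<in> borel_measurable borel \<Longrightarrow> bounded (range g) \<Longrightarrow>
      (\<integral>x. dm x * g x \<partial>circ) = (\<integral>y. fm y * g (T y) \<partial>circ)" by blast
  define d where "d x = dp (frac x) - dm (frac x)" for x
  have fr: "frac x = x" if "x \<in> space circ" for x :: real using that by (simp add: frac_eq)
  have d_int: "integrable circ d"
    using Bochner_Integration.integrable_diff[OF dp(1) dm(1)]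
    by (rule iffD1[OF Bochner_Integration.integrable_cong, rotated -1]) (simp_all add: d_def fr)
  have "L1_circle d" using d_int by (auto simp: L1_circle_iff periodic_def d_def frac_1_eq)
  moreover have "(\<integral>x. d x * g x \<partial>circ) = (\<integral>y. f y * g (T y) \<partial>circ)"
    if g: "periodic g" "g \<in> borel_measurable borel" "bounded (range g)" for g
  proof -
    obtain B where B: "\<And>x. \<bar>g x\<bar> \<le> B" using g(3) by (auto simp: bounded_iff)
    have gT: "(\<lambda>y. g (T y)) \<in> borel_measurable circ"
    proof -
      have "g (T y) = g (t y)" for y
        using g(1) periodic_frac[of g "T y"] by (simp add: t_def periodic_def)
      then show ?thesis using measurable_compose[OF t(1) g(2)] by simp
    qed
    have gi: "integrable circ (\<lambda>x. dp x * g x)" "integrable circ (\<lambda>x. dm x * g x)"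
      "integrable circ (\<lambda>x. fp x * g (T x))" "integrable circ (\<lambda>x. fm x * g (T x))"
      using integrable_bounded_mult[OF dp(1) borel_circ_measurable[OF g(2)] B]
        integrable_bounded_mult[OF dm(1) borel_circ_measurable[OF g(2)] B]
        integrable_bounded_mult[OF fpm(1) gT B] integrable_bounded_mult[OF fpm(2) gT B]
      by (simp_all add: mult.commute)
    have "(\<integral>x. d x * g x \<partial>circ) = (\<integral>x. dp x * g x - dm x * g x \<partial>circ)"
      by (intro Bochner_Integration.integral_cong) (simp_all add: d_def fr left_diff_distrib)
    also have "\<dots> = (\<integral>y. fp y * g (T y) \<partial>circ) - (\<integral>y. fm y * g (T y) \<partial>circ)"
      using gi dp(2)[OF g] dm(2)[OF g] by simp
    also have "\<dots> = (\<integral>y. f y * g (T y) \<partial>circ)"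
      using gi by (simp add: fpm(5) left_diff_distrib)
    finally show ?thesis .
  qed
  ultimately have "\<exists>h. L1_circle h \<and> (\<forall>g. periodic g \<and> g \<in> borel_measurable borel \<and> bounded (range g) \<longrightarrow>
        circle_integral (\<lambda>x. h x * g x) = circle_integral (\<lambda>x. f x * g (T x)))"
    unfolding circle_integral_circ by blast
  from someI_ex[OF this] have *: "L1_circle (transfer_op T f) \<and> (\<forall>g. periodic g \<and> g \<in> borel_measurable borel \<and> bounded (range g) \<longrightarrow>
        circle_integral (\<lambda>x. transfer_op T f x * g x) = circle_integral (\<lambda>x. f x * g (T x)))"
    unfolding transfer_op_def .
  then show "integrable circ (transfer_op T f)" by (simp add: L1_circle_iff)
  show "\<And>g. periodic g \<Longrightarrow> g \<in> borel_measurable borel \<Longrightarrow> bounded (range g) \<Longrightarrow>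
      (\<integral>x. transfer_op T f x * g x \<partial>circ) = (\<integral>y. f y * g (T y) \<partial>circ)"
    using * by (simp add: circle_integral_circ)
qed

lemma circle_diffeo_shift:
  assumes "circle_diffeo n F"
  shows "\<exists>s\<in>{1, -1}. \<forall>x k. F (x + of_int k) = F x + s * of_int k"
proof -
  from assms consider "\<forall>x. F (x + 1) = F x + 1" | "\<forall>x. F (x + 1) = F x - 1"
    by (auto simp: circle_diffeo_def)
  then show ?thesis
  proof cases
    case 1
    then have "F (x + of_int k) - (x + of_int k) = F x - x" for x k
      using periodic_of_int[of "\<lambda>x. F x - x" x k] by simp
    then have "F (x + of_int k) = F x + 1 * of_int k" for x k
      by (simp add: algebra_simps)
    then show ?thesis by blast
  next
    case 2
    then have "F (x + of_int k) + (x + of_int k) = F x + x" for x k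
      using periodic_of_int[of "\<lambda>x. F x + x" x k] by simp
    then have "F (x + of_int k) = F x + (-1) * of_int k" for x k
      by (simp add: algebra_simps)
    then show ?thesis by blast
  qed
qed

text \<open>The preimage of a null set under a diffeomorphism is its image under the differentiable inverse,
  hence null.\<close>

lemma nonsingular_diffeo_comp:
  assumes F: "circle_diffeo n F" "0 < n" and T: "nonsingular_circle_map T"
  shows "nonsingular_circle_map (F \<circ> T)"
  unfolding nonsingular_circle_map_def
proof (intro conjI allI ballI)
  have C: "C_diff n F" "C_diff n (inv F)" "bij F" using F by (auto simp: circle_diffeo_def)
  fix x
  obtain s where s: "s \<in> {1, -1}" "\<And>x k. F (x + of_int k) = F x + s * of_int k"
    using circle_diffeo_shift[OF F(1)] by blast
  have "T (x + 1) - T x \<in> \<int>" using T by (simp add: nonsingular_circle_map_def)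
  then obtain k where "T (x + 1) - T x = of_int k" by (auto elim: Ints_cases)
  then have "T (x + 1) = T x + of_int k" by simp
  then show "(F \<circ> T) (x + 1) - (F \<circ> T) x \<in> \<int>" using s by auto
next
  have C: "C_diff n F" using F by (auto simp: circle_diffeo_def)
  have "F \<in> borel_measurable borel"
    by (intro borel_measurable_continuous_onI C_diff_continuous[OF C])
  then show "F \<circ> T \<in> borel_measurable lebesgue"
    using T by (auto simp: nonsingular_circle_map_def intro: measurable_comp)
next
  have C: "C_diff n (inv F)" "bij F" using F by (auto simp: circle_diffeo_def)
  fix N :: "real set" assume N: "N \<in> null_sets lebesgue"
  have "inv F differentiable_on N"
    using C_diff_has_derivative[OF C(1) F(2)]
    by (auto simp: differentiable_on_def real_differentiable_def intro: has_field_derivative_at_within)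
  with N have "negligible (inv F ` N)"
    by (intro negligible_differentiable_image_negligible) (auto simp: negligible_iff_null_sets)
  moreover have "F -` N = inv F ` N" using C(2) by (simp add: bij_vimage_eq_inv_image)
  ultimately have "F -` N \<in> null_sets lebesgue" by (simp add: negligible_iff_null_sets)
  moreover have "(F \<circ> T) -` N = T -` (F -` N)" by auto
  ultimately show "(F \<circ> T) -` N \<in> null_sets lebesgue"
    using T by (simp add: nonsingular_circle_map_def)
qed

section \<open>Gaussian kernels\<close>

lemma per_gauss_even: "per_gauss \<xi> 0 (- x) = per_gauss \<xi> 0 x"
proof -
  have "bij_betw (\<lambda>k::int. - k) UNIV UNIV"
    by (rule bij_betw_byWitness[of _ uminus]) auto
  from integral_bij_count_space[OF this, of "\<lambda>k. gauss_deriv \<xi> 0 (- x + of_int k)"]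
  have "per_gauss \<xi> 0 (- x) = (\<integral>k. gauss_deriv \<xi> 0 (- x + of_int (- k)) \<partial>int_count)"
    by (simp add: per_gauss_def)
  also have "\<dots> = per_gauss \<xi> 0 x"
  proof -
    have "gauss_deriv \<xi> 0 (- x + of_int (- k)) = gauss_deriv \<xi> 0 (x + of_int k)" for k
      using power2_minus[of "x + of_int k"] by (simp add: gauss_deriv_def gauss_poly_def)
    then show ?thesis by (simp only: per_gauss_def)
  qed
  finally show ?thesis .
qed

lemma per_gauss_parity:
  assumes "\<xi> \<noteq> 0"
  shows "per_gauss \<xi> n (- x) = (- 1) ^ n * per_gauss \<xi> n x"
proof (induction n arbitrary: x)
  case (Suc n)
  have "((\<lambda>x. per_gauss \<xi> n (- x)) has_real_derivative per_gauss \<xi> (Suc n) (- x) * (- 1)) (at x)"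
    by (rule DERIV_chain2[where f = "per_gauss \<xi> n", OF DERIV_per_gauss[OF assms]])
      (auto intro!: derivative_eq_intros)
  moreover have "((\<lambda>x. (- 1) ^ n * per_gauss \<xi> n x) has_real_derivative (- 1) ^ n * per_gauss \<xi> (Suc n) x) (at x)"
    by (rule DERIV_cmult[OF DERIV_per_gauss[OF assms]])
  ultimately have "per_gauss \<xi> (Suc n) (- x) * (- 1) = (- 1) ^ n * per_gauss \<xi> (Suc n) x"
    unfolding Suc by (rule DERIV_unique)
  then show ?case by simp
qed (simp add: per_gauss_even)

definition gauss_bound :: "real \<Rightarrow> nat \<Rightarrow> real" where
  "gauss_bound \<xi> n = (SOME B. \<forall>x. \<bar>per_gauss \<xi> n x\<bar> \<le> B)"

definition gauss_min :: "real \<Rightarrow> real" where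
  "gauss_min \<xi> = (SOME c. 0 < c \<and> (\<forall>x. c \<le> per_gauss \<xi> 0 x))"

lemma gauss_bound: "\<xi> \<noteq> 0 \<Longrightarrow> \<bar>per_gauss \<xi> n x\<bar> \<le> gauss_bound \<xi> n"
  using someI_ex[of "\<lambda>B. \<forall>x. \<bar>per_gauss \<xi> n x\<bar> \<le> B"] per_gauss_bounded[of \<xi> n]
  unfolding gauss_bound_def by blast

lemma gauss_bound_nonneg: "\<xi> \<noteq> 0 \<Longrightarrow> 0 \<le> gauss_bound \<xi> n"
  using gauss_bound[of \<xi> n 0] by linarith

lemma gauss_min: "\<xi> > 0 \<Longrightarrow> 0 < gauss_min \<xi> \<and> (\<forall>x. gauss_min \<xi> \<le> per_gauss \<xi> 0 x)"
  using someI_ex[OF per_gauss_lower_bound[of \<xi>]] unfolding gauss_min_def .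

text \<open>Maclaurin's formula for \<open>e \<mapsto> per_gauss \<xi> n (p - e)\<close>. Dropping the factor \<open>1 / fact m\<close> keeps the
  bounds derived from it short.\<close>

lemma per_gauss_taylor:
  assumes "\<xi> \<noteq> 0"
  shows "\<bar>per_gauss \<xi> n (p - e) - (\<Sum>j<m. (- 1) ^ j * per_gauss \<xi> (n + j) p / fact j * e ^ j)\<bar>
    \<le> gauss_bound \<xi> (n + m) * \<bar>e\<bar> ^ m"
proof -
  define F where "F j e = (- 1) ^ j * per_gauss \<xi> (n + j) (p - e)" for j :: nat and e
  have F: "(F j has_real_derivative F (Suc j) e) (at e)" for j e
  proof -
    have "((\<lambda>e. p - e) has_real_derivative - 1) (at e)" by (auto intro!: derivative_eq_intros)
    from DERIV_cmult[OF DERIV_chain2[where f = "per_gauss \<xi> (n + j)", OF DERIV_per_gauss[OF assms] this], of "(- 1) ^ j"]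
    show ?thesis by (simp add: F_def[abs_def])
  qed
  from Maclaurin_all_le[of F "F 0" e m] F obtain s where
    s: "F 0 e = (\<Sum>j<m. F j 0 / fact j * e ^ j) + F m s / fact m * e ^ m" by auto
  have "per_gauss \<xi> n (p - e) - (\<Sum>j<m. (- 1) ^ j * per_gauss \<xi> (n + j) p / fact j * e ^ j)
      = F m s / fact m * e ^ m"
    using s by (simp add: F_def)
  also have "\<bar>\<dots>\<bar> = \<bar>per_gauss \<xi> (n + m) (p - s)\<bar> / fact m * \<bar>e\<bar> ^ m"
    by (simp add: F_def abs_mult power_abs)
  also have "\<dots> \<le> \<bar>per_gauss \<xi> (n + m) (p - s)\<bar> / 1 * \<bar>e\<bar> ^ m"
    by (intro mult_right_mono divide_left_mono) (auto simp: fact_ge_1)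
  also have "\<dots> \<le> gauss_bound \<xi> (n + m) * \<bar>e\<bar> ^ m"
    using gauss_bound[OF assms] by (intro mult_right_mono) auto
  finally show ?thesis .
qed

lemma gauss_kernel_joint:
  assumes "\<xi> \<noteq> 0" "a \<in> borel_measurable circ" "w \<in> borel_measurable circ"
  shows "(\<lambda>(x, y). per_gauss \<xi> n (x - a y) * w y) \<in> borel_measurable (circ \<Otimes>\<^sub>M circ)"
proof -
  note assms(2,3)[measurable] per_gauss_measurable[OF assms(1), measurable] id_circ_measurable[measurable]
  show ?thesis by measurable
qed

lemma smooth_kernel_gauss:
  assumes \<xi>: "\<xi> \<noteq> 0" and m: "a \<in> borel_measurable circ" "w \<in> borel_measurable circ" and W: "\<And>y. \<bar>w y\<bar> \<le> W"
  shows "smooth_kernel (\<lambda>i x y. per_gauss \<xi> (i + m) (x - a y) * w y) (\<lambda>i. gauss_bound \<xi> (i + m) * W)"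
proof
  fix i x y
  have "((\<lambda>x. x - a y) has_real_derivative 1) (at x)" by (auto intro!: derivative_eq_intros)
  from DERIV_cmult_right[OF DERIV_chain2[where f = "per_gauss \<xi> (i + m)", OF DERIV_per_gauss[OF \<xi>] this], of "w y"]
  show "((\<lambda>x. per_gauss \<xi> (i + m) (x - a y) * w y) has_real_derivative
      per_gauss \<xi> (Suc i + m) (x - a y) * w y) (at x)" by simp
  show "(\<lambda>y. per_gauss \<xi> (i + m) (x - a y) * w y) \<in> borel_measurable circ"
  proof -
    note m[measurable] per_gauss_measurable[OF \<xi>, measurable]
    show ?thesis by measurable
  qed
  show "\<bar>per_gauss \<xi> (i + m) (x - a y) * w y\<bar> \<le> gauss_bound \<xi> (i + m) * W"
    unfolding abs_mult using gauss_bound[OF \<xi>] W gauss_bound_nonneg[OF \<xi>] by (intro mult_mono) auto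
  show "per_gauss \<xi> (0 + m) (x + 1 - a y) * w y = per_gauss \<xi> (0 + m) (x - a y) * w y"
    using per_gauss_periodic[of \<xi> m "x - a y"] by (simp add: algebra_simps)
qed

lemma markov_kernel_gauss:
  assumes \<xi>: "\<xi> > 0" and a: "a \<in> borel_measurable circ"
  shows "markov_kernel (\<lambda>i x y. per_gauss \<xi> i (x - a y)) (gauss_bound \<xi>) (gauss_min \<xi>)"
proof -
  have "smooth_kernel (\<lambda>i x y. per_gauss \<xi> i (x - a y)) (gauss_bound \<xi>)"
    using smooth_kernel_gauss[of \<xi> a "\<lambda>_. 1" 1 0] \<xi> a by simp
  then show ?thesis
    using gauss_min[OF \<xi>] integral_per_gauss_1[OF \<xi>] gauss_kernel_joint[of \<xi> a "\<lambda>_. 1" 0] \<xi> a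
    by (intro markov_kernel.intro markov_kernel_axioms.intro) auto
qed

lemma integral_kop_gauss_Suc:
  assumes \<xi>: "\<xi> > 0" and m: "a \<in> borel_measurable circ" "w \<in> borel_measurable circ" and W: "\<And>y. \<bar>w y\<bar> \<le> W"
    and f: "integrable circ f"
  shows "(\<integral>x. kop (\<lambda>x y. per_gauss \<xi> (Suc n) (x - a y) * w y) f x \<partial>circ) = 0"
proof -
  have "\<bar>per_gauss \<xi> (Suc n) (x - a y) * w y\<bar> \<le> gauss_bound \<xi> (Suc n) * W" for x y
    unfolding abs_mult using gauss_bound[of \<xi>] W gauss_bound_nonneg[of \<xi>] \<xi> by (intro mult_mono) auto
  from integral_mult_kop[OF gauss_kernel_joint[OF _ m] this, of "\<lambda>_. 1" 1 f] \<xi> f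
  show ?thesis by (simp add: integral_per_gauss_Suc)
qed

lemma smooth_kernel_lincomb:
  assumes "smooth_kernel k B" "smooth_kernel k' B'"
  shows "smooth_kernel (\<lambda>i x y. a * k i x y + b * k' i x y) (\<lambda>i. \<bar>a\<bar> * B i + \<bar>b\<bar> * B' i)"
proof -
  interpret k: smooth_kernel k B by (rule assms)
  interpret k': smooth_kernel k' B' by (rule assms)
  show ?thesis
  proof
    fix i x y
    show "((\<lambda>x. a * k i x y + b * k' i x y) has_real_derivative a * k (Suc i) x y + b * k' (Suc i) x y) (at x)"
      by (intro DERIV_add DERIV_cmult k.kernel_deriv k'.kernel_deriv)
    show "(\<lambda>y. a * k i x y + b * k' i x y) \<in> borel_measurable circ"
      using k.kernel_measurable[of i x] k'.kernel_measurable[of i x] by measurable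
    have "\<bar>a * k i x y + b * k' i x y\<bar> \<le> \<bar>a\<bar> * \<bar>k i x y\<bar> + \<bar>b\<bar> * \<bar>k' i x y\<bar>"
      by (metis abs_mult abs_triangle_ineq)
    also have "\<dots> \<le> \<bar>a\<bar> * B i + \<bar>b\<bar> * B' i"
      by (intro add_mono mult_left_mono k.kernel_bound k'.kernel_bound) auto
    finally show "\<bar>a * k i x y + b * k' i x y\<bar> \<le> \<bar>a\<bar> * B i + \<bar>b\<bar> * B' i" .
    show "a * k 0 (x + 1) y + b * k' 0 (x + 1) y = a * k 0 x y + b * k' 0 x y"
      by (simp add: k.kernel_periodic k'.kernel_periodic)
  qed
qed

lemma kop_kernel_lincomb:
  assumes "smooth_kernel k B" "smooth_kernel k' B'" "integrable circ f"
  shows "kop (\<lambda>x y. a * k i x y + b * k' i x y) f x = a * kop (k i) f x + b * kop (k' i) f x"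
proof -
  have "kop (\<lambda>x y. a * k i x y + b * k' i x y) f x
      = (\<integral>y. a * (k i x y * f y) + b * (k' i x y * f y) \<partial>circ)"
    by (simp add: kop_def algebra_simps)
  then show ?thesis
    using smooth_kernel.integrable_kernel_mult[OF assms(1,3), of i x]
      smooth_kernel.integrable_kernel_mult[OF assms(2,3), of i x]
    by (simp add: kop_def)
qed

text \<open>The kernel bounds for the derivatives of order above \<open>n\<close> do not influence the \<open>C\<^sup>n\<close> norm. So small
  kernels may be estimated order by order, without an estimate uniform over all orders.\<close>

lemma C_norm_kop_finite:
  assumes k: "smooth_kernel k B" and b: "\<And>i x y. i \<le> n \<Longrightarrow> \<bar>k i x y\<bar> \<le> b i" and f: "integrable circ f"
  shows "C_norm n (kop (k 0) f) \<le> (\<Sum>i\<le>n. b i) * L1_norm f"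
proof -
  interpret k: smooth_kernel k B by (rule k)
  have "smooth_kernel k (\<lambda>i. if i \<le> n then b i else B i)"
    by standard (auto simp: b k.kernel_bound k.kernel_deriv k.kernel_measurable k.kernel_periodic)
  from smooth_kernel.C_norm_kop[OF this f, of n] show ?thesis by simp
qed

section \<open>Densities given by distributions\<close>

text \<open>Test with \<open>u - v\<close> itself: its square has integral zero, so the open set where it does not vanish is
  null and hence empty.\<close>

lemma smooth_circle_eqI:
  assumes u: "u \<in> smooth_circle" and v: "v \<in> smooth_circle"
    and eq: "\<And>\<phi>. \<phi> \<in> smooth_circle \<Longrightarrow> dist_of u \<phi> = dist_of v \<phi>"
  shows "u = v"
proof -
  define d where "d x = u x - v x" for x
  have d: "d \<in> smooth_circle"
    using smooth_circle_lincomb[OF u v, of 1 "-1"] by (simp add: d_def[abs_def])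
  note bd = C_circle_bounded[OF smooth_circle_C[OF d, of 0]]
  have int: "integrable circ (\<lambda>x. d x * w x)" if "w \<in> smooth_circle" for w
    by (rule integrable_bounded_mult[OF C_circle_L1(1)[OF smooth_circle_C[OF that, of 0]] borel_circ_measurable[OF bd(2)] bd(1)])
  have "(\<integral>x. d x * d x \<partial>circ) = (\<integral>x. d x * u x - d x * v x \<partial>circ)"
    by (simp add: d_def algebra_simps)
  also have "\<dots> = dist_of u d - dist_of v d"
    using int[OF u] int[OF v] by (simp add: dist_of_def circle_integral_circ mult.commute)
  also have "\<dots> = 0" using eq[OF d] by simp
  finally have "(\<integral>x. d x * d x \<partial>circ) = 0" .
  then have "AE x in circ. d x = 0"
    using integral_nonneg_eq_0_iff_AE[OF int[OF d]] by simp
  then have "AE x in lebesgue. d x = 0"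
    using d by (intro AE_circ_imp_AE_lebesgue) (auto simp: smooth_circle_def C_circle_def periodic_def)
  then obtain N where N: "{x \<in> space lebesgue. d x \<noteq> 0} \<subseteq> N" "emeasure lebesgue N = 0" "N \<in> sets lebesgue"
    by (rule AE_E)
  have neg: "negligible {x. d x \<noteq> 0}"
    by (rule negligible_subset[of N]) (use N in \<open>auto simp: negligible_iff_null_sets null_sets_def\<close>)
  have "continuous_on UNIV d"
    using d C_diff_continuous by (auto simp: smooth_circle_def C_circle_def)
  then have "open {x. d x \<noteq> 0}"
    using open_Collect_neq[of d "\<lambda>_. 0"] by simp
  with neg open_not_negligible have "{x. d x \<noteq> 0} = {}" by blast
  then show ?thesis by (auto simp: d_def fun_eq_iff)
qed

lemma dist_fun_eqI:
  assumes "u \<in> smooth_circle" "\<And>\<phi>. \<phi> \<in> smooth_circle \<Longrightarrow> dist_of u \<phi> = F \<phi>"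
  shows "dist_fun F = u"
  unfolding dist_fun_def
  using assms by (intro the_equality) (auto intro: smooth_circle_eqI)

lemma circle_conv_gauss:
  assumes "\<xi> > 0"
  shows "circle_conv (normal_density 0 \<xi>) \<phi> = kop (\<lambda>x y. per_gauss \<xi> 0 (x - y)) \<phi>"
  by (simp add: fun_eq_iff circle_conv_def kop_def circle_integral_circ periodization_normal_density[OF assms])

lemma circle_conv_transfer_op:
  assumes \<xi>: "\<xi> > 0" and T: "nonsingular_circle_map T" and f: "integrable circ f"
  shows "circle_conv (normal_density 0 \<xi>) (transfer_op T f) = kop (\<lambda>x y. per_gauss \<xi> 0 (x - T y)) f"
proof
  fix x
  have \<xi>0: "\<xi> \<noteq> 0" using \<xi> by simp
  have "periodic (\<lambda>y. per_gauss \<xi> 0 (x - y))"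
    unfolding periodic_def
  proof
    fix y show "per_gauss \<xi> 0 (x - (y + 1)) = per_gauss \<xi> 0 (x - y)"
      using per_gauss_periodic[of \<xi> 0 "x - (y + 1)"] by (simp add: algebra_simps)
  qed
  moreover have "(\<lambda>y. per_gauss \<xi> 0 (x - y)) \<in> borel_measurable borel"
    using per_gauss_measurable[OF \<xi>0] by measurable
  moreover have "bounded (range (\<lambda>y. per_gauss \<xi> 0 (x - y)))"
    using gauss_bound[OF \<xi>0] by (auto simp: bounded_iff)
  ultimately show "circle_conv (normal_density 0 \<xi>) (transfer_op T f) x = kop (\<lambda>x y. per_gauss \<xi> 0 (x - T y)) f x"
    using transfer_op_duality(2)[OF T f, of "\<lambda>y. per_gauss \<xi> 0 (x - y)"]
    by (simp add: circle_conv_gauss[OF \<xi>] kop_def mult.commute)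
qed

lemma nonsingular_circle_map_measurable: "nonsingular_circle_map T \<Longrightarrow> T \<in> borel_measurable circ"
  by (auto simp: nonsingular_circle_map_def intro: measurable_restrict_space1)

lemma nonsingular_circle_map_periodic:
  assumes "nonsingular_circle_map T" "periodic g"
  shows "g (T (y + 1)) = g (T y)" "g (frac (T y)) = g (T y)"
proof -
  have "T (y + 1) - T y \<in> \<int>" using assms by (simp add: nonsingular_circle_map_def)
  then obtain k where "T (y + 1) - T y = of_int k" by (auto elim: Ints_cases)
  then have "T (y + 1) = T y + of_int k" by simp
  then show "g (T (y + 1)) = g (T y)"
    using periodic_of_int[of g "T y" k] assms by (simp add: periodic_def)
  show "g (frac (T y)) = g (T y)"
    using periodic_frac[of g "T y"] assms by (simp add: periodic_def)
qed

text \<open>Testing against derivatives of a smoothed test function moves the derivatives, up to the parity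
  of the Gaussian derivative, onto the kernel.\<close>

lemma transfer_op_test:
  assumes \<xi>: "\<xi> > 0" and T: "nonsingular_circle_map T" and f: "integrable circ f"
    and S: "S \<in> C_circle n" and \<phi>: "\<phi> \<in> smooth_circle"
  shows "dist_of (\<lambda>z. transfer_op T f z * S z) ((deriv ^^ m) (circle_conv (\<lambda>x. normal_density 0 \<xi> (- x)) \<phi>))
    = (- 1) ^ m * dist_of (kop (\<lambda>x y. per_gauss \<xi> m (x - T y) * S (T y)) f) \<phi>"
proof -
  have \<xi>0: "\<xi> \<noteq> 0" using \<xi> by simp
  have even: "(\<lambda>x. normal_density 0 \<xi> (- x)) = normal_density 0 \<xi>"
    by (simp add: normal_density_def fun_eq_iff)
  interpret K: markov_kernel "\<lambda>i x y. per_gauss \<xi> i (x - y)" "gauss_bound \<xi>" "gauss_min \<xi>"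
    by (rule markov_kernel_gauss[OF \<xi> id_circ_measurable])
  note \<phi>b = C_circle_bounded[OF smooth_circle_C[OF \<phi>, of 0]] and Sb = C_circle_bounded[OF S]
  have \<phi>i: "integrable circ \<phi>" by (rule C_circle_L1(1)[OF smooth_circle_C[OF \<phi>, of 0]])
  define \<psi> where "\<psi> = kop (\<lambda>x y. per_gauss \<xi> m (x - y)) \<phi>"
  have \<psi>: "(deriv ^^ m) (circle_conv (\<lambda>x. normal_density 0 \<xi> (- x)) \<phi>) = \<psi>"
    unfolding even circle_conv_gauss[OF \<xi>] \<psi>_def by (rule K.kop_deriv_iter[OF \<phi>i])
  have \<psi>b: "\<bar>\<psi> x\<bar> \<le> gauss_bound \<xi> m * L1_norm \<phi>" for x
    unfolding \<psi>_def by (rule K.kop_bound[OF \<phi>i])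
  have "continuous_on UNIV \<psi>"
    unfolding \<psi>_def using K.DERIV_kop[OF \<phi>i, of m] by (meson DERIV_isCont continuous_at_imp_continuous_on)
  then have \<psi>m: "\<psi> \<in> borel_measurable borel" by (rule borel_measurable_continuous_onI)
  have \<psi>p: "periodic \<psi>"
    unfolding periodic_def \<psi>_def kop_def
  proof
    fix x
    have "per_gauss \<xi> m (x + 1 - y) = per_gauss \<xi> m (x - y)" for y
      using per_gauss_periodic[of \<xi> m "x - y"] by (simp add: algebra_simps)
    then show "(\<integral>y. per_gauss \<xi> m (x + 1 - y) * \<phi> y \<partial>circ) = (\<integral>y. per_gauss \<xi> m (x - y) * \<phi> y \<partial>circ)" by simp
  qed
  define g where "g z = S z * \<psi> z" for z
  have g: "periodic g" "g \<in> borel_measurable borel" "bounded (range g)"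
  proof -
    show "periodic g" using S \<psi>p by (simp add: periodic_def C_circle_def g_def)
    show "g \<in> borel_measurable borel" unfolding g_def[abs_def] by (intro borel_measurable_times Sb \<psi>m)
    have "\<bar>g z\<bar> \<le> C_norm n S * (gauss_bound \<xi> m * L1_norm \<phi>)" for z
      unfolding g_def abs_mult using Sb(1) \<psi>b order_trans[OF abs_ge_zero Sb(1)] by (intro mult_mono) auto
    then show "bounded (range g)" by (auto simp: bounded_iff)
  qed
  have Tm: "T \<in> borel_measurable circ" by (rule nonsingular_circle_map_measurable[OF T])
  have STm: "(\<lambda>y. S (T y)) \<in> borel_measurable circ" by (rule measurable_compose[OF Tm Sb(2)])
  have kb: "\<bar>per_gauss \<xi> m (x - T y) * S (T y)\<bar> \<le> gauss_bound \<xi> m * C_norm n S" for x y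
    unfolding abs_mult using gauss_bound[OF \<xi>0] Sb(1) gauss_bound_nonneg[OF \<xi>0] by (intro mult_mono) auto
  have "dist_of (\<lambda>z. transfer_op T f z * S z) \<psi> = (\<integral>z. transfer_op T f z * g z \<partial>circ)"
    by (simp add: dist_of_def circle_integral_circ g_def mult.assoc)
  also have "\<dots> = (\<integral>y. f y * g (T y) \<partial>circ)"
    by (rule transfer_op_duality(2)[OF T f g])
  also have "\<dots> = (\<integral>y. (- 1) ^ m * (f y * (\<integral>x. \<phi> x * (per_gauss \<xi> m (x - T y) * S (T y)) \<partial>circ)) \<partial>circ)"
  proof (rule Bochner_Integration.integral_cong[OF refl])
    fix y
    have "per_gauss \<xi> m (T y - x) * \<phi> x = (- 1) ^ m * (\<phi> x * per_gauss \<xi> m (x - T y))" for x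
      using per_gauss_parity[OF \<xi>0, of m "x - T y"] by simp
    then have "\<psi> (T y) = (- 1) ^ m * (\<integral>x. \<phi> x * per_gauss \<xi> m (x - T y) \<partial>circ)"
      by (simp only: \<psi>_def kop_def integral_mult_right_zero)
    then show "f y * g (T y) = (- 1) ^ m * (f y * (\<integral>x. \<phi> x * (per_gauss \<xi> m (x - T y) * S (T y)) \<partial>circ))"
      by (simp add: g_def mult.assoc[symmetric])
  qed
  also have "\<dots> = (- 1) ^ m * (\<integral>x. \<phi> x * kop (\<lambda>x y. per_gauss \<xi> m (x - T y) * S (T y)) f x \<partial>circ)"
    using integral_mult_kop[OF gauss_kernel_joint[OF \<xi>0 Tm STm] kb borel_circ_measurable[OF \<phi>b(2)] \<phi>b(1) f]
    by simp
  finally show ?thesis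
    unfolding \<psi> by (simp add: dist_of_def circle_integral_circ mult.commute)
qed

section \<open>Expansion of the kernel in the size of the perturbation\<close>

text \<open>Here \<open>e\<close> is the displacement at a point where the two vector fields have the values \<open>s1\<close> and \<open>s2\<close>.
  Taylor's formula to orders 1, 2 and 3 is followed by replacing \<open>e\<close> by \<open>\<delta> s1 + \<delta>\<^sup>2/2 s2\<close> in the linear term and
  \<open>e\<^sup>2\<close> by \<open>\<delta>\<^sup>2 s1\<^sup>2\<close> in the quadratic one. The constant \<open>K\<close> is chosen such that \<open>\<bar>e\<bar> \<le> K \<delta>\<close> and
  \<open>\<bar>e - \<delta> s1\<bar> \<le> K \<delta>\<^sup>2\<close>. In the third estimate
  only the term with \<open>W\<close> is not of order \<open>\<delta>\<^sup>3\<close>.\<close>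

lemma gauss_expansion:
  fixes \<delta> s1 s2 e M W p :: real
  defines "K \<equiv> 2 * M + 1"
  assumes \<xi>: "\<xi> \<noteq> 0" and \<delta>: "0 < \<delta>" "\<delta> \<le> 1" and s: "\<bar>s1\<bar> \<le> M" "\<bar>s2\<bar> \<le> M"
    and W: "W \<le> \<delta>\<^sup>2" and e: "\<bar>e - \<delta> * s1 - \<delta>\<^sup>2 / 2 * s2\<bar> \<le> W"
  shows "\<bar>per_gauss \<xi> n (p - e) - per_gauss \<xi> n p\<bar> \<le> gauss_bound \<xi> (n + 1) * K * \<delta>" (is ?t1)
    and "\<bar>per_gauss \<xi> n (p - e) - per_gauss \<xi> n p + \<delta> * (s1 * per_gauss \<xi> (n + 1) p)\<bar>
      \<le> (gauss_bound \<xi> (n + 2) * K\<^sup>2 + gauss_bound \<xi> (n + 1) * K) * \<delta>\<^sup>2" (is ?t2)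
    and "\<bar>per_gauss \<xi> n (p - e) - per_gauss \<xi> n p + \<delta> * (s1 * per_gauss \<xi> (n + 1) p)
        - \<delta>\<^sup>2 / 2 * (s1\<^sup>2 * per_gauss \<xi> (n + 2) p - s2 * per_gauss \<xi> (n + 1) p)\<bar>
      \<le> gauss_bound \<xi> (n + 1) * W + (gauss_bound \<xi> (n + 3) * K ^ 3 + gauss_bound \<xi> (n + 2) * K\<^sup>2) * \<delta> ^ 3" (is ?t3)
proof -
  define B where "B = gauss_bound \<xi>"
  define P where "P i = per_gauss \<xi> (n + i) p" for i
  define Q where "Q = per_gauss \<xi> n (p - e)"
  have B: "0 \<le> B i" for i by (simp add: B_def gauss_bound_nonneg[OF \<xi>])
  have P: "\<bar>P i\<bar> \<le> B (n + i)" for i by (simp add: B_def P_def gauss_bound[OF \<xi>])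
  have M: "0 \<le> M" using s by linarith
  then have K: "0 \<le> K" by (simp add: K_def)
  have \<delta>2: "\<delta>\<^sup>2 \<le> \<delta>" using \<delta> by (simp add: power2_eq_square mult_left_le)
  have b1: "\<bar>\<delta> * s1\<bar> \<le> \<delta> * M" using \<delta> s by (simp add: abs_mult)
  have b2: "\<bar>\<delta>\<^sup>2 / 2 * s2\<bar> \<le> \<delta>\<^sup>2 / 2 * M"
    using s by (simp add: abs_mult) (intro mult_left_mono; simp)
  have b3: "\<delta>\<^sup>2 * M \<le> \<delta> * M" using \<delta>2 M by (rule mult_right_mono)
  have e1: "\<bar>e - \<delta> * s1\<bar> \<le> K * \<delta>\<^sup>2"
  proof -
    have "\<bar>e - \<delta> * s1\<bar> \<le> \<delta>\<^sup>2 / 2 * M + \<delta>\<^sup>2" using e b2 W by linarith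
    also have "\<dots> \<le> K * \<delta>\<^sup>2" using M by (simp add: K_def algebra_simps)
    finally show ?thesis .
  qed
  have e0: "\<bar>e\<bar> \<le> K * \<delta>"
  proof -
    have "\<bar>e\<bar> \<le> \<delta> * M + (\<delta>\<^sup>2 / 2 * M + \<delta>\<^sup>2)" using e b1 b2 W by linarith
    also have "\<dots> \<le> K * \<delta>"
    proof -
      have "0 \<le> \<delta>\<^sup>2 * M" using M by simp
      moreover have "K * \<delta> = \<delta> * M + \<delta> * M + \<delta>" by (simp add: K_def algebra_simps)
      moreover have "\<delta>\<^sup>2 / 2 * M = \<delta>\<^sup>2 * M / 2" by simp
      ultimately show ?thesis using b3 \<delta>2 by linarith
    qed
    finally show ?thesis .
  qed
  have e0': "\<bar>e + \<delta> * s1\<bar> \<le> 2 * (K * \<delta>)"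
  proof -
    have "\<delta> * M \<le> K * \<delta>" using M \<delta> by (simp add: K_def algebra_simps)
    then show ?thesis using e0 b1 by linarith
  qed
  have pow: "\<bar>e\<bar> ^ i \<le> (K * \<delta>) ^ i" for i by (rule power_mono[OF e0]) simp
  have T: "\<bar>Q - (\<Sum>j<m. (- 1) ^ j * P j / fact j * e ^ j)\<bar> \<le> B (n + m) * (K * \<delta>) ^ m" for m
  proof -
    have "\<bar>Q - (\<Sum>j<m. (- 1) ^ j * P j / fact j * e ^ j)\<bar> \<le> B (n + m) * \<bar>e\<bar> ^ m"
      using per_gauss_taylor[OF \<xi>, of n p e m] by (simp add: Q_def P_def B_def)
    also have "\<dots> \<le> B (n + m) * (K * \<delta>) ^ m" by (intro mult_left_mono pow B)
    finally show ?thesis .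
  qed
  have T1: "\<bar>Q - P 0\<bar> \<le> B (n + 1) * (K * \<delta>)"
    using T[of 1] by simp
  have T2: "\<bar>Q - P 0 + e * P 1\<bar> \<le> B (n + 2) * (K * \<delta>)\<^sup>2"
    using T[of 2] by (simp add: numeral_2_eq_2 algebra_simps)
  have T3: "\<bar>Q - P 0 + e * P 1 - e\<^sup>2 / 2 * P 2\<bar> \<le> B (n + 3) * (K * \<delta>) ^ 3"
    using T[of 3] by (simp add: numeral_3_eq_3 numeral_2_eq_2 algebra_simps)
  show ?t1 using T1 by (simp add: Q_def P_def B_def mult_ac)
  have "\<bar>(\<delta> * s1 - e) * P 1\<bar> \<le> (K * \<delta>\<^sup>2) * B (n + 1)"
    unfolding abs_mult using e1 P[of 1] K by (intro mult_mono) (auto simp: abs_minus_commute)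
  moreover have "Q - P 0 + \<delta> * (s1 * P 1) = (Q - P 0 + e * P 1) + (\<delta> * s1 - e) * P 1"
    by (simp add: algebra_simps)
  ultimately have "\<bar>Q - P 0 + \<delta> * (s1 * P 1)\<bar> \<le> B (n + 2) * (K * \<delta>)\<^sup>2 + (K * \<delta>\<^sup>2) * B (n + 1)"
    using T2 by linarith
  then show ?t2 by (simp add: Q_def P_def B_def power_mult_distrib algebra_simps)
  define r where "r = \<delta> * s1 + \<delta>\<^sup>2 / 2 * s2 - e"
  have r1: "\<bar>r * P 1\<bar> \<le> W * B (n + 1)"
    unfolding abs_mult
  proof (rule mult_mono)
    show "\<bar>r\<bar> \<le> W" using e by (simp add: r_def)
    then show "0 \<le> W" by linarith
  qed (use P[of 1] in auto)
  have "\<bar>(e - \<delta> * s1) * (e + \<delta> * s1)\<bar> \<le> (K * \<delta>\<^sup>2) * (2 * (K * \<delta>))"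
    unfolding abs_mult using e1 e0' K by (intro mult_mono) auto
  then have r2: "\<bar>((e - \<delta> * s1) * (e + \<delta> * s1)) * P 2\<bar> \<le> ((K * \<delta>\<^sup>2) * (2 * (K * \<delta>))) * B (n + 2)"
    unfolding abs_mult[of _ "P 2"] using P[of 2] K \<delta> by (intro mult_mono) auto
  have "Q - P 0 + \<delta> * (s1 * P 1) - \<delta>\<^sup>2 / 2 * (s1\<^sup>2 * P 2 - s2 * P 1)
      = (Q - P 0 + e * P 1 - e\<^sup>2 / 2 * P 2) + r * P 1 + ((e - \<delta> * s1) * (e + \<delta> * s1)) * P 2 / 2"
    unfolding r_def by (simp add: power2_eq_square field_simps)
  with T3 r1 r2 have "\<bar>Q - P 0 + \<delta> * (s1 * P 1) - \<delta>\<^sup>2 / 2 * (s1\<^sup>2 * P 2 - s2 * P 1)\<bar>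
      \<le> B (n + 3) * (K * \<delta>) ^ 3 + W * B (n + 1) + ((K * \<delta>\<^sup>2) * (2 * (K * \<delta>))) * B (n + 2) / 2" by linarith
  also have "\<dots> = B (n + 1) * W + (B (n + 3) * K ^ 3 + B (n + 2) * K\<^sup>2) * \<delta> ^ 3"
    by (simp add: power_mult_distrib power2_eq_square power3_eq_cube algebra_simps)
  finally show ?t3 by (simp add: Q_def P_def B_def)
qed

section \<open>The annealed transfer operator\<close>

text \<open>After taking adjoints the inner integral is an integral of \<open>g\<close> against a periodized Gaussian centred at
  \<open>a y\<close>, that is, the expectation of \<open>g (a y + X)\<close>; Fubini exchanges it with the integral over the circle.\<close>

lemma annealed_duality:
  assumes \<xi>: "\<xi> > 0" and a: "a \<in> borel_measurable circ" and f: "integrable circ f"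
    and g: "g \<in> borel_measurable borel" "bounded (range g)" "periodic g"
    and X: "distributed M lborel X (\<lambda>x. ennreal (normal_density 0 \<xi> x))"
  shows "(\<integral>x. kop (\<lambda>x y. per_gauss \<xi> 0 (x - a y)) f x * g x \<partial>circ)
    = (\<integral>\<omega>. (\<integral>x. f x * g (frac (a x + X \<omega>)) \<partial>circ) \<partial>M)"
proof -
  have \<xi>0: "\<xi> \<noteq> 0" using \<xi> by simp
  have gp: "\<And>x. g (x + 1) = g x" using g(3) by (simp add: periodic_def)
  obtain C where C: "\<And>x. \<bar>g x\<bar> \<le> C" using g(2) by (auto simp: bounded_iff)
  note a[measurable] g(1)[measurable]
  have [measurable]: "f \<in> borel_measurable circ" using f by simp
  interpret pair_sigma_finite lborel circ ..
  define \<rho> where "\<rho> = normal_density 0 \<xi>"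
  have [measurable]: "\<rho> \<in> borel_measurable borel" by (simp add: \<rho>_def)
  have \<rho>: "integrable lborel \<rho>" using \<xi> by (simp add: \<rho>_def integrable_normal_density)
  have "integrable (lborel \<Otimes>\<^sub>M circ) (\<lambda>p. \<rho> (fst p) * f (snd p))"
    by (rule Fubini_integrable) (use f \<rho> in \<open>auto simp: abs_mult\<close>)
  then have "integrable (lborel \<Otimes>\<^sub>M circ) (\<lambda>p. g (fst p + a (snd p)) * (\<rho> (fst p) * f (snd p)))"
    by (rule integrable_bounded_mult) (auto intro: C)
  then have int: "integrable (lborel \<Otimes>\<^sub>M circ) (\<lambda>(z, y). g (z + a y) * (\<rho> z * f y))"
    by (simp add: case_prod_unfold)
  have kb: "\<bar>per_gauss \<xi> 0 (x - a y) * 1\<bar> \<le> gauss_bound \<xi> 0" for x y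
    using gauss_bound[OF \<xi>0] by simp
  define F where "F z = (\<integral>y. f y * g (a y + z) \<partial>circ)" for z
  have F[measurable]: "F \<in> borel_measurable borel"
  proof -
    have "(\<lambda>(z, y). f y * g (a y + z)) \<in> borel_measurable (borel \<Otimes>\<^sub>M circ)" by measurable
    then show ?thesis unfolding F_def[abs_def] by (rule circ.borel_measurable_lebesgue_integral)
  qed
  have "(\<integral>x. kop (\<lambda>x y. per_gauss \<xi> 0 (x - a y)) f x * g x \<partial>circ)
      = (\<integral>y. f y * (\<integral>x. g x * per_gauss \<xi> 0 (x - a y) \<partial>circ) \<partial>circ)"
    using integral_mult_kop[OF gauss_kernel_joint[OF \<xi>0 a] kb borel_circ_measurable[OF g(1)] C f]
    by (simp add: mult.commute)
  also have "\<dots> = (\<integral>y. (\<integral>z. g (z + a y) * (\<rho> z * f y) \<partial>lborel) \<partial>circ)"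
  proof (rule Bochner_Integration.integral_cong[OF refl])
    fix y
    have "f y * (\<integral>x. g x * per_gauss \<xi> 0 (x - a y) \<partial>circ) = f y * (\<integral>z. \<rho> z * g (z + a y) \<partial>lborel)"
      using integral_per_gauss[OF \<xi> g(1,2) gp, of "a y"] by (simp add: \<rho>_def mult.commute)
    also have "\<dots> = (\<integral>z. f y * (\<rho> z * g (z + a y)) \<partial>lborel)" by simp
    finally show "f y * (\<integral>x. g x * per_gauss \<xi> 0 (x - a y) \<partial>circ) = (\<integral>z. g (z + a y) * (\<rho> z * f y) \<partial>lborel)"
      by (simp only: mult_ac)
  qed
  also have "\<dots> = (\<integral>z. (\<integral>y. g (z + a y) * (\<rho> z * f y) \<partial>circ) \<partial>lborel)"
    by (rule Fubini_integral[OF int])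
  also have "\<dots> = (\<integral>z. \<rho> z * F z \<partial>lborel)"
  proof (rule Bochner_Integration.integral_cong[OF refl])
    fix z
    have "(\<integral>y. g (z + a y) * (\<rho> z * f y) \<partial>circ) = (\<integral>y. \<rho> z * (f y * g (a y + z)) \<partial>circ)"
      by (simp only: mult_ac add.commute)
    then show "(\<integral>y. g (z + a y) * (\<rho> z * f y) \<partial>circ) = \<rho> z * F z" by (simp add: F_def)
  qed
  also have "\<dots> = (\<integral>\<omega>. F (X \<omega>) \<partial>M)"
    unfolding \<rho>_def by (rule distributed_integral[OF X]) (auto simp: normal_density_nonneg)
  also have "\<dots> = (\<integral>\<omega>. (\<integral>x. f x * g (frac (a x + X \<omega>)) \<partial>circ) \<partial>M)"
    by (simp add: F_def periodic_frac[of g, OF gp])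
  finally show ?thesis .
qed

text \<open>The kernel formula for the annealed operator is tied to integrable functions, so the results on kernel
  operators are carried over to operators that agree with them there.\<close>

lemma resolvent_cong:
  assumes eq: "\<And>f. f \<in> zero_avg n \<Longrightarrow> L f = L' f"
  shows "resolvent L n = resolvent L' n"
proof
  fix w
  have "(f \<in> zero_avg n \<and> id_minus L f = w) \<longleftrightarrow> (f \<in> zero_avg n \<and> id_minus L' f = w)" for f
    using eq by (auto simp: id_minus_def)
  then show "resolvent L n w = resolvent L' n w" by (simp add: resolvent_def inv_into_def)
qed

lemma (in markov_kernel) resolvent_well_defined_cong:
  assumes eq: "\<And>f. integrable circ f \<Longrightarrow> L f = A f"
  shows "resolvent_well_defined L n"
proof -
  have iter: "(L ^^ i) f = (A ^^ i) f" if "f \<in> zero_avg n" for f i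
    using integrable_kop_iter[OF zero_avg_integrable[OF that]] by (induction i) (simp_all add: eq)
  have res: "resolvent L n = resolvent A n"
    by (intro resolvent_cong eq zero_avg_integrable)
  have "id_minus L f = id_minus A f" if "f \<in> zero_avg n" for f
    using eq[OF zero_avg_integrable[OF that]] by (simp add: id_minus_def)
  then have bij: "bij_betw (id_minus L) (zero_avg n) (zero_avg n) = bij_betw (id_minus A) (zero_avg n) (zero_avg n)"
    by (rule bij_betw_cong)
  from resolvent_well_defined[of n] show ?thesis
    unfolding resolvent_well_defined_def bij res by (simp add: iter)
qed

section \<open>Response of the noisy circle map\<close>

locale perturbed_map =
  fixes T :: "real \<Rightarrow> real" and D :: "real \<Rightarrow> real \<Rightarrow> real" and S1 S2 :: "real \<Rightarrow> real"
    and \<delta>bar \<xi> :: real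
  assumes T: "nonsingular_circle_map T"
    and \<delta>bar: "0 < \<delta>bar"
    and D: "\<And>\<delta>. \<delta> \<in> {0..\<delta>bar} \<Longrightarrow> circle_diffeo 3 (D \<delta>)"
    and D0: "D 0 = id"
    and S: "S1 \<in> C_circle 3" "S2 \<in> C_circle 3"
    and lim2: "((\<lambda>\<delta>. 1 / \<delta>\<^sup>2 * C_norm 0 (\<lambda>x. D \<delta> x - x - \<delta> * S1 x - \<delta>\<^sup>2 / 2 * S2 x)) \<longlongrightarrow> 0) (at_right 0)"
    and \<xi>: "0 < \<xi>"
begin

lemma \<xi>0: "\<xi> \<noteq> 0" using \<xi> by simp

text \<open>The kernels of the annealed operators and of the first and second derivative of the family at \<open>\<delta> = 0\<close>,
  each together with its \<open>x\<close>-derivatives. The factors \<open>1\<close> and \<open>-1\<close> in \<open>k2\<close> give it the literal shape of a linear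
  combination of kernels.\<close>

definition k :: "real \<Rightarrow> nat \<Rightarrow> real \<Rightarrow> real \<Rightarrow> real" where
  "k \<delta> i x y = per_gauss \<xi> i (x - D \<delta> (T y))"

definition k1 :: "nat \<Rightarrow> real \<Rightarrow> real \<Rightarrow> real" where
  "k1 i x y = per_gauss \<xi> (i + 1) (x - T y) * (- S1 (T y))"

definition k2 :: "nat \<Rightarrow> real \<Rightarrow> real \<Rightarrow> real" where
  "k2 i x y = 1 * (per_gauss \<xi> (i + 2) (x - T y) * (S1 (T y))\<^sup>2)
    + (- 1) * (per_gauss \<xi> (i + 1) (x - T y) * S2 (T y))"

lemma D_comp_T: "\<delta> \<in> {0..\<delta>bar} \<Longrightarrow> nonsingular_circle_map (D \<delta> \<circ> T)"
  by (rule nonsingular_diffeo_comp[OF D _ T]) simp_all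

lemma T_meas: "T \<in> borel_measurable circ"
  by (rule nonsingular_circle_map_measurable[OF T])

lemma k_markov:
  assumes "\<delta> \<in> {0..\<delta>bar}"
  shows "markov_kernel (k \<delta>) (gauss_bound \<xi>) (gauss_min \<xi>)"
proof -
  have "(\<lambda>y. D \<delta> (T y)) \<in> borel_measurable circ"
    using nonsingular_circle_map_measurable[OF D_comp_T[OF assms]] by (simp add: o_def)
  from markov_kernel_gauss[OF \<xi> this] show ?thesis unfolding k_def[abs_def] .
qed

lemma k_smooth: "\<delta> \<in> {0..\<delta>bar} \<Longrightarrow> smooth_kernel (k \<delta>) (gauss_bound \<xi>)"
  using k_markov markov_kernel.axioms(1) by blast

lemma ST_meas: "(\<lambda>y. S1 (T y)) \<in> borel_measurable circ" "(\<lambda>y. S2 (T y)) \<in> borel_measurable circ"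
  using S by (auto intro: measurable_compose[OF T_meas] C_circle_bounded(2))

definition M :: real where "M = max (C_norm 3 S1) (C_norm 3 S2)"

lemma S_bound: "\<bar>S1 x\<bar> \<le> M" "\<bar>S2 x\<bar> \<le> M"
  using C_circle_bounded(1)[OF S(1)] C_circle_bounded(1)[OF S(2)] by (auto simp: M_def max.coboundedI1 max.coboundedI2)

lemma S1_sq_bound: "\<bar>(S1 x)\<^sup>2\<bar> \<le> M\<^sup>2"
  using power_mono[OF S_bound(1)[of x], of 2] by simp

lemma k1_smooth: "smooth_kernel k1 (\<lambda>i. gauss_bound \<xi> (i + 1) * M)"
  unfolding k1_def[abs_def]
  using ST_meas S_bound by (intro smooth_kernel_gauss[OF \<xi>0 T_meas]) auto

lemma k2_smooth: "\<exists>B. smooth_kernel k2 B"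
  unfolding k2_def[abs_def]
  using smooth_kernel_lincomb[OF
      smooth_kernel_gauss[OF \<xi>0 T_meas borel_measurable_power[OF ST_meas(1)] S1_sq_bound, where m = 2]
      smooth_kernel_gauss[OF \<xi>0 T_meas ST_meas(2) S_bound(2), where m = 1]]
  by blast

lemma k2_kop:
  assumes f: "integrable circ f"
  shows "kop (k2 0) f x = kop (\<lambda>x y. per_gauss \<xi> 2 (x - T y) * (S1 (T y))\<^sup>2) f x
    - kop (\<lambda>x y. per_gauss \<xi> 1 (x - T y) * S2 (T y)) f x"
  using kop_kernel_lincomb[OF
      smooth_kernel_gauss[OF \<xi>0 T_meas borel_measurable_power[OF ST_meas(1)] S1_sq_bound, where m = 2]
      smooth_kernel_gauss[OF \<xi>0 T_meas ST_meas(2) S_bound(2), where m = 1] f, where a = 1 and b = "-1" and i = 0 and x = x]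
  unfolding k2_def[abs_def] by (simp only: add_0 mult_1_left mult_minus1 diff_conv_add_uminus)

lemma k1_kop: "kop (k1 0) f x = - kop (\<lambda>x y. per_gauss \<xi> 1 (x - T y) * S1 (T y)) f x"
  by (simp add: k1_def kop_def)

lemma k1_mean: "integrable circ f \<Longrightarrow> (\<integral>x. kop (k1 0) f x \<partial>circ) = 0"
  using integral_kop_gauss_Suc[OF \<xi> T_meas ST_meas(1) S_bound(1), of f 0] by (simp add: k1_kop)

lemma k2_mean:
  assumes f: "integrable circ f"
  shows "(\<integral>x. kop (k2 0) f x \<partial>circ) = 0"
proof -
  have int: "integrable circ (kop (\<lambda>x y. per_gauss \<xi> 2 (x - T y) * (S1 (T y))\<^sup>2) f)"
    "integrable circ (kop (\<lambda>x y. per_gauss \<xi> 1 (x - T y) * S2 (T y)) f)"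
    using smooth_kernel.integrable_kop[OF smooth_kernel_gauss[OF \<xi>0 T_meas borel_measurable_power[OF ST_meas(1)] S1_sq_bound, where m = 2] f]
      smooth_kernel.integrable_kop[OF smooth_kernel_gauss[OF \<xi>0 T_meas ST_meas(2) S_bound(2), where m = 1] f]
    by (simp_all only: add_0)
  have "(\<integral>x. kop (\<lambda>x y. per_gauss \<xi> 2 (x - T y) * (S1 (T y))\<^sup>2) f x \<partial>circ) = 0"
    using integral_kop_gauss_Suc[OF \<xi> T_meas borel_measurable_power[OF ST_meas(1)] S1_sq_bound f, of 1]
    by (simp add: numeral_2_eq_2)
  moreover have "(\<integral>x. kop (\<lambda>x y. per_gauss \<xi> 1 (x - T y) * S2 (T y)) f x \<partial>circ) = 0"
    using integral_kop_gauss_Suc[OF \<xi> T_meas ST_meas(2) S_bound(2) f, of 0] by simp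
  ultimately show ?thesis using int by (simp add: k2_kop[OF f])
qed

definition W :: "real \<Rightarrow> real" where
  "W \<delta> = C_norm 0 (\<lambda>x. D \<delta> x - x - \<delta> * S1 x - \<delta>\<^sup>2 / 2 * S2 x)"

lemma eventually_small: "0 < r \<Longrightarrow> \<forall>\<^sub>F \<delta> in at_right 0. 0 < \<delta> \<and> \<delta> < r" for r :: real
  by (simp add: eventually_at_right_field) blast

lemma eventually_W:
  assumes "0 < \<epsilon>"
  shows "\<forall>\<^sub>F \<delta> in at_right 0. W \<delta> \<le> \<epsilon> * \<delta>\<^sup>2"
proof -
  have "\<forall>\<^sub>F \<delta> in at_right 0. 1 / \<delta>\<^sup>2 * W \<delta> < \<epsilon>"
    using lim2 assms unfolding W_def by (rule order_tendstoD)
  then show ?thesis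
    using eventually_small[OF zero_less_one]
  proof eventually_elim
    case (elim \<delta>)
    then show ?case by (simp add: divide_less_eq less_imp_le)
  qed
qed

definition admissible :: "real \<Rightarrow> bool" where
  "admissible \<delta> \<longleftrightarrow> 0 < \<delta> \<and> \<delta> \<le> 1 \<and> \<delta> \<in> {0..\<delta>bar} \<and> W \<delta> \<le> \<delta>\<^sup>2"

lemma eventually_admissible: "\<forall>\<^sub>F \<delta> in at_right 0. admissible \<delta>"
  using eventually_W[OF zero_less_one] eventually_small[OF zero_less_one] eventually_small[OF \<delta>bar]
  by eventually_elim (auto simp: admissible_def)

definition K :: real where "K = 2 * M + 1"

text \<open>The kernel only sees the map modulo integers, so the displacement may be measured at the
  representative of \<open>T y\<close> in the unit interval, where the hypotheses control it.\<close>

lemma kernel_expansion: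
  assumes \<delta>: "admissible \<delta>"
  shows "\<bar>k \<delta> n x y - k 0 n x y\<bar> \<le> gauss_bound \<xi> (n + 1) * K * \<delta>"
    and "\<bar>k \<delta> n x y - k 0 n x y - \<delta> * k1 n x y\<bar>
      \<le> (gauss_bound \<xi> (n + 2) * K\<^sup>2 + gauss_bound \<xi> (n + 1) * K) * \<delta>\<^sup>2"
    and "\<bar>k \<delta> n x y - k 0 n x y - \<delta> * k1 n x y - \<delta>\<^sup>2 / 2 * k2 n x y\<bar>
      \<le> gauss_bound \<xi> (n + 1) * W \<delta> + (gauss_bound \<xi> (n + 3) * K ^ 3 + gauss_bound \<xi> (n + 2) * K\<^sup>2) * \<delta> ^ 3"
proof -
  have \<delta>': "0 < \<delta>" "\<delta> \<le> 1" "\<delta> \<in> {0..\<delta>bar}" "W \<delta> \<le> \<delta>\<^sup>2" using \<delta> by (auto simp: admissible_def)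
  define t where "t = frac (T y)"
  define e where "e = D \<delta> t - t"
  define p where "p = x - t"
  have Ty: "T y = t + of_int \<lfloor>T y\<rfloor>" by (simp add: t_def frac_def)
  have per: "per_gauss \<xi> i (z - of_int l) = per_gauss \<xi> i z" for i z l
    using periodic_of_int[of "per_gauss \<xi> i" z "- l", OF per_gauss_periodic] by simp
  have P: "per_gauss \<xi> i (x - T y) = per_gauss \<xi> i p" for i
    using per[of i p "\<lfloor>T y\<rfloor>"] by (simp add: p_def t_def frac_def)
  obtain s where s: "s \<in> {1, -1 :: real}" "\<And>x l. D \<delta> (x + of_int l) = D \<delta> x + s * of_int l"
    using circle_diffeo_shift[OF D[OF \<delta>'(3)]] by blast
  obtain l where l: "s * of_int \<lfloor>T y\<rfloor> = of_int l"
    using s(1) by (metis insert_iff mult_1 mult_minus1 of_int_minus singletonD)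
  have "D \<delta> (T y) = D \<delta> t + of_int l" using s(2)[of t "\<lfloor>T y\<rfloor>"] unfolding Ty[symmetric] l .
  then have kd: "k \<delta> n x y = per_gauss \<xi> n (p - e)"
    using per[of n "p - e" l] by (simp add: k_def p_def e_def algebra_simps)
  have k0: "k 0 n x y = per_gauss \<xi> n p" by (simp add: k_def D0 P)
  have St: "S1 t = S1 (T y)" "S2 t = S2 (T y)"
    unfolding t_def using nonsingular_circle_map_periodic(2)[OF T] S by (auto simp: C_circle_def)
  have "continuous_on UNIV (D \<delta>)" "continuous_on UNIV S1" "continuous_on UNIV S2"
    using D[OF \<delta>'(3)] S C_diff_continuous by (auto simp: circle_diffeo_def C_circle_def)
  then have "C_diff 0 (\<lambda>x. D \<delta> x - x - \<delta> * S1 x - \<delta>\<^sup>2 / 2 * S2 x)"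
    by (auto simp: C_diff_def intro!: continuous_intros)
  from C_norm_ge[OF this, of 0 t]
  have e: "\<bar>e - \<delta> * S1 t - \<delta>\<^sup>2 / 2 * S2 t\<bar> \<le> W \<delta>"
    by (simp add: W_def e_def t_def frac_lt_1 less_imp_le)
  note exp = gauss_expansion[OF \<xi>0 \<delta>'(1,2) S_bound(1)[of t] S_bound(2)[of t] \<delta>'(4) e, of n p, folded K_def]
  have k1: "k1 n x y = - (S1 t * per_gauss \<xi> (n + 1) p)"
    unfolding k1_def P St by simp
  have k2: "k2 n x y = (S1 t)\<^sup>2 * per_gauss \<xi> (n + 2) p - S2 t * per_gauss \<xi> (n + 1) p"
    unfolding k2_def P St by simp
  show "\<bar>k \<delta> n x y - k 0 n x y\<bar> \<le> gauss_bound \<xi> (n + 1) * K * \<delta>"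
    unfolding kd k0 by (rule exp(1))
  show "\<bar>k \<delta> n x y - k 0 n x y - \<delta> * k1 n x y\<bar>
      \<le> (gauss_bound \<xi> (n + 2) * K\<^sup>2 + gauss_bound \<xi> (n + 1) * K) * \<delta>\<^sup>2"
    unfolding kd k0 k1 mult_minus_right diff_minus_eq_add by (rule exp(2))
  show "\<bar>k \<delta> n x y - k 0 n x y - \<delta> * k1 n x y - \<delta>\<^sup>2 / 2 * k2 n x y\<bar>
      \<le> gauss_bound \<xi> (n + 1) * W \<delta> + (gauss_bound \<xi> (n + 3) * K ^ 3 + gauss_bound \<xi> (n + 2) * K\<^sup>2) * \<delta> ^ 3"
    unfolding kd k0 k1 k2 mult_minus_right diff_minus_eq_add by (rule exp(3))
qed

text \<open>The kernel estimates hold for every \<open>x\<close>-derivative, so they carry over to \<open>C\<^sup>n\<close> norms.\<close>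

lemma operator_expansion:
  assumes \<delta>: "admissible \<delta>" and f: "integrable circ f"
  shows "C_norm n (\<lambda>x. kop (k \<delta> 0) f x - kop (k 0 0) f x)
      \<le> (\<Sum>i\<le>n. gauss_bound \<xi> (i + 1) * K * \<delta>) * L1_norm f"
    and "C_norm n (\<lambda>x. kop (k \<delta> 0) f x - kop (k 0 0) f x - \<delta> * kop (k1 0) f x)
      \<le> (\<Sum>i\<le>n. (gauss_bound \<xi> (i + 2) * K\<^sup>2 + gauss_bound \<xi> (i + 1) * K) * \<delta>\<^sup>2) * L1_norm f"
    and "C_norm n (\<lambda>x. kop (k \<delta> 0) f x - kop (k 0 0) f x - \<delta> * kop (k1 0) f x - \<delta>\<^sup>2 / 2 * kop (k2 0) f x)
      \<le> (\<Sum>i\<le>n. gauss_bound \<xi> (i + 1) * W \<delta>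
        + (gauss_bound \<xi> (i + 3) * K ^ 3 + gauss_bound \<xi> (i + 2) * K\<^sup>2) * \<delta> ^ 3) * L1_norm f"
proof -
  have \<delta>': "\<delta> \<in> {0..\<delta>bar}" "0 \<in> {0..\<delta>bar}" using \<delta> \<delta>bar by (auto simp: admissible_def)
  obtain B2 where k2: "smooth_kernel k2 B2" using k2_smooth by blast
  define d0 where "d0 i x y = 1 * k \<delta> i x y + (- 1) * k 0 i x y" for i x y
  define d1 where "d1 i x y = 1 * d0 i x y + (- \<delta>) * k1 i x y" for i x y
  define d2 where "d2 i x y = 1 * d1 i x y + (- (\<delta>\<^sup>2 / 2)) * k2 i x y" for i x y
  obtain B where s0: "smooth_kernel d0 B"
    unfolding d0_def[abs_def] using smooth_kernel_lincomb[OF k_smooth[OF \<delta>'(1)] k_smooth[OF \<delta>'(2)]] by blast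
  obtain B' where s1: "smooth_kernel d1 B'"
    unfolding d1_def[abs_def] using smooth_kernel_lincomb[OF s0 k1_smooth] by blast
  obtain B'' where s2: "smooth_kernel d2 B''"
    unfolding d2_def[abs_def] using smooth_kernel_lincomb[OF s1 k2] by blast
  have e0: "kop (d0 0) f = (\<lambda>x. kop (k \<delta> 0) f x - kop (k 0 0) f x)"
  proof
    fix x show "kop (d0 0) f x = kop (k \<delta> 0) f x - kop (k 0 0) f x"
      using kop_kernel_lincomb[OF k_smooth[OF \<delta>'(1)] k_smooth[OF \<delta>'(2)] f, where a = 1 and b = "-1" and i = 0 and x = x]
      unfolding d0_def[abs_def] by simp
  qed
  have e1: "kop (d1 0) f = (\<lambda>x. kop (k \<delta> 0) f x - kop (k 0 0) f x - \<delta> * kop (k1 0) f x)"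
  proof
    fix x show "kop (d1 0) f x = kop (k \<delta> 0) f x - kop (k 0 0) f x - \<delta> * kop (k1 0) f x"
      using kop_kernel_lincomb[OF s0 k1_smooth f, where a = 1 and b = "-\<delta>" and i = 0 and x = x] e0
      unfolding d1_def[abs_def] by simp
  qed
  have e2: "kop (d2 0) f = (\<lambda>x. kop (k \<delta> 0) f x - kop (k 0 0) f x - \<delta> * kop (k1 0) f x - \<delta>\<^sup>2 / 2 * kop (k2 0) f x)"
  proof
    fix x show "kop (d2 0) f x = kop (k \<delta> 0) f x - kop (k 0 0) f x - \<delta> * kop (k1 0) f x - \<delta>\<^sup>2 / 2 * kop (k2 0) f x"
      using kop_kernel_lincomb[OF s1 k2 f, where a = 1 and b = "-(\<delta>\<^sup>2 / 2)" and i = 0 and x = x] e1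
      unfolding d2_def[abs_def] by simp
  qed
  show "C_norm n (\<lambda>x. kop (k \<delta> 0) f x - kop (k 0 0) f x)
      \<le> (\<Sum>i\<le>n. gauss_bound \<xi> (i + 1) * K * \<delta>) * L1_norm f"
    unfolding e0[symmetric] using kernel_expansion(1)[OF \<delta>]
    by (intro C_norm_kop_finite[OF s0 _ f]) (simp add: d0_def)
  show "C_norm n (\<lambda>x. kop (k \<delta> 0) f x - kop (k 0 0) f x - \<delta> * kop (k1 0) f x)
      \<le> (\<Sum>i\<le>n. (gauss_bound \<xi> (i + 2) * K\<^sup>2 + gauss_bound \<xi> (i + 1) * K) * \<delta>\<^sup>2) * L1_norm f"
    unfolding e1[symmetric] using kernel_expansion(2)[OF \<delta>]
    by (intro C_norm_kop_finite[OF s1 _ f]) (simp add: d0_def d1_def)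
  show "C_norm n (\<lambda>x. kop (k \<delta> 0) f x - kop (k 0 0) f x - \<delta> * kop (k1 0) f x - \<delta>\<^sup>2 / 2 * kop (k2 0) f x)
      \<le> (\<Sum>i\<le>n. gauss_bound \<xi> (i + 1) * W \<delta>
        + (gauss_bound \<xi> (i + 3) * K ^ 3 + gauss_bound \<xi> (i + 2) * K\<^sup>2) * \<delta> ^ 3) * L1_norm f"
    unfolding e2[symmetric] using kernel_expansion(3)[OF \<delta>]
    by (intro C_norm_kop_finite[OF s2 _ f]) (simp add: d0_def d1_def d2_def)
qed

text \<open>A fixed choice for each \<open>\<delta>\<close>; it depends on no order of differentiability, so one family serves all \<open>k\<close>
  in the theorem.\<close>

definition h :: "real \<Rightarrow> real \<Rightarrow> real" where
  "h \<delta> = (SOME h. h \<in> smooth_circle \<and> kop (k \<delta> 0) h = h \<and> (\<forall>x. 0 \<le> h x) \<and> (\<integral>x. h x \<partial>circ) = 1)"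

lemma h:
  assumes "\<delta> \<in> {0..\<delta>bar}"
  shows "h \<delta> \<in> smooth_circle" "kop (k \<delta> 0) (h \<delta>) = h \<delta>" "\<And>x. 0 \<le> h \<delta> x" "(\<integral>x. h \<delta> x \<partial>circ) = 1"
  using someI_ex[OF markov_kernel.stationary_density_exists[OF k_markov[OF assms]]]
  unfolding h_def by blast+

lemma response: "kernel_response (k 0) (gauss_bound \<xi>) (gauss_min \<xi>)
    (\<lambda>\<delta>. kop (k \<delta> 0)) (kop (k1 0)) (kop (k2 0)) (h 0) h"
proof (intro kernel_response.intro kernel_response_axioms.intro)
  have z: "0 \<in> {0..\<delta>bar}" using \<delta>bar by simp
  show "markov_kernel (k 0) (gauss_bound \<xi>) (gauss_min \<xi>)" by (rule k_markov[OF z])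
  show "\<forall>\<^sub>F \<delta> in at_right 0. \<exists>k' B'. markov_kernel k' B' (gauss_min \<xi>) \<and> kop (k \<delta> 0) = kop (k' 0)"
    using eventually_admissible by eventually_elim (use k_markov in \<open>auto simp: admissible_def\<close>)
  show "\<exists>k' B'. smooth_kernel k' B' \<and> kop (k1 0) = kop (k' 0)" using k1_smooth by blast
  show "\<exists>k' B'. smooth_kernel k' B' \<and> kop (k2 0) = kop (k' 0)" using k2_smooth by blast
  show "h 0 \<in> smooth_circle" "kop (k 0 0) (h 0) = h 0" "(\<integral>x. h 0 x \<partial>circ) = 1" using h[OF z] by blast+
  show "\<forall>\<^sub>F \<delta> in at_right 0. h \<delta> \<in> smooth_circle \<and> kop (k \<delta> 0) (h \<delta>) = h \<delta> \<and> (\<integral>x. h \<delta> x \<partial>circ) = 1"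
    using eventually_admissible by eventually_elim (use h in \<open>auto simp: admissible_def\<close>)
  fix n
  show "\<exists>C. \<forall>\<^sub>F \<delta> in at_right 0. \<forall>f. integrable circ f \<longrightarrow>
      C_norm n (\<lambda>x. kop (k \<delta> 0) f x - kop (k 0 0) f x) \<le> C * \<delta> * L1_norm f"
  proof
    show "\<forall>\<^sub>F \<delta> in at_right 0. \<forall>f. integrable circ f \<longrightarrow>
      C_norm n (\<lambda>x. kop (k \<delta> 0) f x - kop (k 0 0) f x) \<le> (\<Sum>i\<le>n. gauss_bound \<xi> (i + 1) * K) * \<delta> * L1_norm f"
      using eventually_admissible
      by eventually_elim (use operator_expansion(1)[of _ _ n] in \<open>simp add: sum_distrib_right\<close>)
  qed
  show "\<exists>C. \<forall>\<^sub>F \<delta> in at_right 0. \<forall>f. integrable circ f \<longrightarrow>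
      C_norm n (\<lambda>x. kop (k \<delta> 0) f x - kop (k 0 0) f x - \<delta> * kop (k1 0) f x) \<le> C * \<delta>\<^sup>2 * L1_norm f"
  proof
    show "\<forall>\<^sub>F \<delta> in at_right 0. \<forall>f. integrable circ f \<longrightarrow>
      C_norm n (\<lambda>x. kop (k \<delta> 0) f x - kop (k 0 0) f x - \<delta> * kop (k1 0) f x)
        \<le> (\<Sum>i\<le>n. gauss_bound \<xi> (i + 2) * K\<^sup>2 + gauss_bound \<xi> (i + 1) * K) * \<delta>\<^sup>2 * L1_norm f"
      using eventually_admissible
      by eventually_elim (use operator_expansion(2)[of _ _ n] in \<open>simp add: sum_distrib_right\<close>)
  qed
  fix \<epsilon> :: real assume \<epsilon>: "0 < \<epsilon>"
  define SB where "SB = (\<Sum>i\<le>n. gauss_bound \<xi> (i + 1))"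
  define SC where "SC = (\<Sum>i\<le>n. gauss_bound \<xi> (i + 3) * K ^ 3 + gauss_bound \<xi> (i + 2) * K\<^sup>2)"
  have SB: "0 \<le> SB" by (simp add: SB_def sum_nonneg gauss_bound_nonneg[OF \<xi>0])
  \<comment> \<open>\<open>\<eta>\<close> and \<open>r\<close> make the \<open>W\<close> part and the cubic part at most \<open>\<epsilon> \<delta>\<^sup>2 / 2\<close> each\<close>
  define \<eta> where "\<eta> = \<epsilon> / 2 / (SB + 1)"
  have \<eta>: "0 < \<eta>" "SB * \<eta> \<le> \<epsilon> / 2"
  proof -
    show "0 < \<eta>" using SB \<epsilon> by (simp add: \<eta>_def)
    then have "SB * \<eta> \<le> (SB + 1) * \<eta>" by (intro mult_right_mono) auto
    also have "\<dots> = \<epsilon> / 2"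
      using SB nonzero_mult_div_cancel_left[of "SB + 1" "\<epsilon> / 2"] by (simp only: \<eta>_def times_divide_eq_right)
    finally show "SB * \<eta> \<le> \<epsilon> / 2" .
  qed
  define r where "r = \<epsilon> / 2 / (\<bar>SC\<bar> + 1)"
  have r: "0 < r" using \<epsilon> by (simp add: r_def)
  show "\<forall>\<^sub>F \<delta> in at_right 0. \<forall>f. integrable circ f \<longrightarrow>
      C_norm n (\<lambda>x. kop (k \<delta> 0) f x - kop (k 0 0) f x - \<delta> * kop (k1 0) f x - \<delta>\<^sup>2 / 2 * kop (k2 0) f x)
        \<le> \<epsilon> * \<delta>\<^sup>2 * L1_norm f"
    using eventually_admissible eventually_W[OF \<eta>(1)] eventually_small[OF r]
  proof eventually_elim
    case (elim \<delta>)
    have "SC * \<delta> \<le> (\<bar>SC\<bar> + 1) * r" using elim(3) by (intro mult_mono) auto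
    also have "\<dots> = \<epsilon> / 2" 
      using nonzero_mult_div_cancel_left[of "\<bar>SC\<bar> + 1" "\<epsilon> / 2"] by (simp only: r_def times_divide_eq_right)
    finally have c: "SC * \<delta> \<le> \<epsilon> / 2" .
    have "SB * W \<delta> + SC * \<delta> ^ 3 \<le> SB * (\<eta> * \<delta>\<^sup>2) + SC * \<delta> ^ 3"
      using mult_left_mono[OF elim(2) SB] by simp
    also have "\<dots> = (SB * \<eta> + SC * \<delta>) * \<delta>\<^sup>2" by (simp add: power2_eq_square power3_eq_cube algebra_simps)
    also have "\<dots> \<le> \<epsilon> * \<delta>\<^sup>2" using \<eta>(2) c by (intro mult_right_mono) auto
    finally have b: "SB * W \<delta> + SC * \<delta> ^ 3 \<le> \<epsilon> * \<delta>\<^sup>2" .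
    show ?case
    proof (intro allI impI)
      fix f :: "real \<Rightarrow> real" assume f: "integrable circ f"
      have "C_norm n (\<lambda>x. kop (k \<delta> 0) f x - kop (k 0 0) f x - \<delta> * kop (k1 0) f x - \<delta>\<^sup>2 / 2 * kop (k2 0) f x)
          \<le> (SB * W \<delta> + SC * \<delta> ^ 3) * L1_norm f"
      proof -
        have "SB * W \<delta> + SC * \<delta> ^ 3 = (\<Sum>i\<le>n. gauss_bound \<xi> (i + 1) * W \<delta>
            + (gauss_bound \<xi> (i + 3) * K ^ 3 + gauss_bound \<xi> (i + 2) * K\<^sup>2) * \<delta> ^ 3)"
          unfolding SB_def SC_def sum_distrib_right by (rule sum.distrib[symmetric])
        with operator_expansion(3)[OF elim(1) f, of n] show ?thesis by (simp only:)
      qed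
      also have "\<dots> \<le> \<epsilon> * \<delta>\<^sup>2 * L1_norm f" by (rule mult_right_mono[OF b L1_norm_nonneg])
      finally show "C_norm n (\<lambda>x. kop (k \<delta> 0) f x - kop (k 0 0) f x - \<delta> * kop (k1 0) f x - \<delta>\<^sup>2 / 2 * kop (k2 0) f x)
          \<le> \<epsilon> * \<delta>\<^sup>2 * L1_norm f" .
    qed
  qed
qed (fact k1_mean k2_mean)+

text \<open>The sign of \<open>R_op\<close>, the one in \<open>dist_deriv\<close> and the one from the odd derivative of the Gaussian leave
  a single minus sign, the one in \<open>k1\<close>.\<close>

lemma dist_fun_R:
  assumes f: "integrable circ f"
  shows "dist_fun (dist_conv (normal_density 0 \<xi>) (R_op S1 (transfer_op T f))) = kop (k1 0) f"
proof (rule dist_fun_eqI)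
  show "kop (k1 0) f \<in> smooth_circle" by (rule smooth_kernel.kop_smooth[OF k1_smooth f])
  fix \<phi> assume \<phi>: "\<phi> \<in> smooth_circle"
  show "dist_of (kop (k1 0) f) \<phi> = dist_conv (normal_density 0 \<xi>) (R_op S1 (transfer_op T f)) \<phi>"
    using transfer_op_test[OF \<xi> T f S(1) \<phi>, of 1]
    by (simp add: dist_conv_def R_op_def dist_deriv_def dist_of_def circle_integral_circ k1_kop)
qed

lemma dist_fun_Q:
  assumes f: "integrable circ f"
  shows "dist_fun (dist_conv (normal_density 0 \<xi>) (Q_op S1 S2 (transfer_op T f))) = kop (k2 0) f"
proof (rule dist_fun_eqI)
  show "kop (k2 0) f \<in> smooth_circle" using k2_smooth smooth_kernel.kop_smooth[OF _ f] by blast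
  fix \<phi> assume \<phi>: "\<phi> \<in> smooth_circle"
  have S1sq: "(\<lambda>x. (S1 x)\<^sup>2) \<in> C_circle 0"
    using S C_diff_continuous by (auto simp: C_circle_def periodic_def C_diff_def intro!: continuous_intros)
  define u where "u = kop (\<lambda>x y. per_gauss \<xi> 2 (x - T y) * (S1 (T y))\<^sup>2) f"
  define v where "v = kop (\<lambda>x y. per_gauss \<xi> 1 (x - T y) * S2 (T y)) f"
  have int: "integrable circ u" "integrable circ v"
    using smooth_kernel.integrable_kop[OF smooth_kernel_gauss[OF \<xi>0 T_meas borel_measurable_power[OF ST_meas(1)] S1_sq_bound, where m = 2] f]
      smooth_kernel.integrable_kop[OF smooth_kernel_gauss[OF \<xi>0 T_meas ST_meas(2) S_bound(2), where m = 1] f]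
    by (simp_all only: add_0 u_def v_def)
  note \<phi>b = C_circle_bounded[OF smooth_circle_C[OF \<phi>, of 0]]
  have int': "integrable circ (\<lambda>x. \<phi> x * u x)" "integrable circ (\<lambda>x. \<phi> x * v x)"
    using int by (auto intro!: integrable_bounded_mult[OF _ borel_circ_measurable[OF \<phi>b(2)] \<phi>b(1)])
  have "dist_of (kop (k2 0) f) \<phi> = (\<integral>x. \<phi> x * u x - \<phi> x * v x \<partial>circ)"
    by (simp add: dist_of_def circle_integral_circ k2_kop[OF f] u_def v_def algebra_simps)
  also have "\<dots> = dist_of u \<phi> - dist_of v \<phi>"
    using int' by (simp add: dist_of_def circle_integral_circ mult.commute)
  also have "\<dots> = dist_conv (normal_density 0 \<xi>) (Q_op S1 S2 (transfer_op T f)) \<phi>"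
    using transfer_op_test[OF \<xi> T f S1sq \<phi>, of 2] transfer_op_test[OF \<xi> T f S(2) \<phi>, of 1]
    by (simp add: dist_conv_def Q_op_def dist_deriv_def numeral_2_eq_2 u_def v_def)
  finally show "dist_of (kop (k2 0) f) \<phi> = dist_conv (normal_density 0 \<xi>) (Q_op S1 S2 (transfer_op T f)) \<phi>" .
qed

end

theorem theorem27:
  fixes T :: "real \<Rightarrow> real" and D :: "real \<Rightarrow> real \<Rightarrow> real" and S1 S2 :: "real \<Rightarrow> real"
    and \<delta>bar \<xi> :: real
    and M :: "'w measure" and X :: "'w \<Rightarrow> real" and T\<delta> :: "real \<Rightarrow> 'w \<Rightarrow> real \<Rightarrow> real"
    and L :: "real \<Rightarrow> (real \<Rightarrow> real) \<Rightarrow> (real \<Rightarrow> real)"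
    and Ldot Lddot :: "(real \<Rightarrow> real) \<Rightarrow> (real \<Rightarrow> real)"
  assumes T: "nonsingular_circle_map T"
    and \<delta>bar: "0 < \<delta>bar"
    and D: "\<And>\<delta>. \<delta> \<in> {0..\<delta>bar} \<Longrightarrow> circle_diffeo 3 (D \<delta>)"
    and D0: "D 0 = id"
    and S: "S1 \<in> C_circle 3" "S2 \<in> C_circle 3"
    and lim1: "((\<lambda>\<delta>. 1 / \<bar>\<delta>\<bar> * C_norm 0 (\<lambda>x. D \<delta> x - x - \<delta> * S1 x)) \<longlongrightarrow> 0) (at_right 0)"
    and lim2: "((\<lambda>\<delta>. 1 / \<delta>\<^sup>2 * C_norm 0 (\<lambda>x. D \<delta> x - x - \<delta> * S1 x - \<delta>\<^sup>2 / 2 * S2 x)) \<longlongrightarrow> 0) (at_right 0)"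
    and \<xi>: "0 < \<xi>"
    and M: "prob_space M"
    and X: "distributed M lborel X (\<lambda>x. ennreal (normal_density 0 \<xi> x))"
    and T\<delta>: "\<And>\<delta> \<omega> x. T\<delta> \<delta> \<omega> x = frac (D \<delta> (T x) + X \<omega>)"
    and L: "\<And>\<delta> f. L \<delta> f = circle_conv (normal_density 0 \<xi>) (transfer_op (D \<delta> \<circ> T) f)"
    and Ldot: "\<And>f. Ldot f = dist_fun (dist_conv (normal_density 0 \<xi>) (R_op S1 (transfer_op T f)))"
    and Lddot: "\<And>f. Lddot f = dist_fun (dist_conv (normal_density 0 \<xi>) (Q_op S1 S2 (transfer_op T f)))"
  shows
    "(\<forall>\<delta>\<in>{0..\<delta>bar}. \<forall>f g. L1_circle f \<and> periodic g \<and> g \<in> borel_measurable borel \<and> bounded (range g) \<longrightarrow>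
        circle_integral (\<lambda>x. L \<delta> f x * g x)
          = (\<integral>\<omega>. circle_integral (\<lambda>x. f x * g (T\<delta> \<delta> \<omega> x)) \<partial>M)) \<and>
     (\<exists>h. (\<forall>\<delta>\<in>{0..\<delta>bar}.
             prob_density (h \<delta>) \<and> L \<delta> (h \<delta>) = h \<delta> \<and>
             (\<forall>f. prob_density f \<and> (AE x in lebesgue. L \<delta> f x = f x) \<longrightarrow> (AE x in lebesgue. f x = h \<delta> x))) \<and>
          (\<forall>k\<ge>2.
             (\<forall>\<delta>\<in>{0..\<delta>bar}. h \<delta> \<in> C_circle (k + 1)) \<and>
             resolvent_well_defined (L 0) (k - 1) \<and>
             resolvent_well_defined (L 0) (k - 2) \<and>
             (let h1 = resolvent (L 0) (k - 1) (Ldot (h 0));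
                  v = (\<lambda>x. 1 / 2 * Lddot (h 0) x + Ldot h1 x);
                  h2 = resolvent (L 0) (k - 2) v
              in Ldot (h 0) \<in> zero_avg (k - 1) \<and> v \<in> zero_avg (k - 2) \<and>
                 ((\<lambda>\<delta>. C_norm (k - 1) (\<lambda>x. (h \<delta> x - h 0 x) / \<delta> - h1 x)) \<longlongrightarrow> 0) (at_right 0) \<and>
                 ((\<lambda>\<delta>. C_norm (k - 2) (\<lambda>x. (h \<delta> x - h 0 x - \<delta> * h1 x) / \<delta>\<^sup>2 - h2 x)) \<longlongrightarrow> 0) (at_right 0))))"
proof -
  interpret perturbed_map T D S1 S2 \<delta>bar \<xi>
    by standard (fact T \<delta>bar D D0 S lim2 \<xi>)+
  interpret R: kernel_response "k 0" "gauss_bound \<xi>" "gauss_min \<xi>" "\<lambda>\<delta>. kop (k \<delta> 0)"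
    "kop (k1 0)" "kop (k2 0)" "h 0" h
    by (rule response)
  have z: "0 \<in> {0..\<delta>bar}" using \<delta>bar by simp
  have L_kop: "L \<delta> f = kop (k \<delta> 0) f" if "\<delta> \<in> {0..\<delta>bar}" "integrable circ f" for \<delta> f
    using circle_conv_transfer_op[OF \<xi> D_comp_T[OF that(1)] that(2)] by (simp add: L k_def[abs_def])
  have Ldot_kop: "Ldot f = kop (k1 0) f" if "integrable circ f" for f
    unfolding Ldot by (rule dist_fun_R[OF that])
  have Lddot_kop: "Lddot f = kop (k2 0) f" if "integrable circ f" for f
    unfolding Lddot by (rule dist_fun_Q[OF that])
  have hi: "integrable circ (h \<delta>)" if "\<delta> \<in> {0..\<delta>bar}" for \<delta>
    using C_circle_L1(1)[OF smooth_circle_C[OF h(1)[OF that], of 0]] .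
  have part1: "circle_integral (\<lambda>x. L \<delta> f x * g x) = (\<integral>\<omega>. circle_integral (\<lambda>x. f x * g (T\<delta> \<delta> \<omega> x)) \<partial>M)"
    if \<delta>: "\<delta> \<in> {0..\<delta>bar}" and f: "L1_circle f" and g: "periodic g" "g \<in> borel_measurable borel" "bounded (range g)"
    for \<delta> f g
  proof -
    have fi: "integrable circ f" using f by (simp add: L1_circle_iff)
    have "(\<lambda>y. D \<delta> (T y)) \<in> borel_measurable circ"
      using nonsingular_circle_map_measurable[OF D_comp_T[OF \<delta>]] by (simp add: o_def)
    from annealed_duality[OF \<xi> this fi g(2,3,1) X]
    show ?thesis by (simp add: circle_integral_circ L_kop[OF \<delta> fi] T\<delta> k_def[abs_def])
  qed
  have density: "prob_density (h \<delta>)" if \<delta>: "\<delta> \<in> {0..\<delta>bar}" for \<delta>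
    using h[OF \<delta>] hi[OF \<delta>] smooth_circle_C[OF h(1)[OF \<delta>], of 0]
    by (simp add: prob_density_def L1_circle_iff circle_integral_circ C_circle_def)
  have stationary: "L \<delta> (h \<delta>) = h \<delta>" if \<delta>: "\<delta> \<in> {0..\<delta>bar}" for \<delta>
    using L_kop[OF \<delta> hi[OF \<delta>]] h(2)[OF \<delta>] by simp
  have unique: "AE x in lebesgue. f x = h \<delta> x"
    if \<delta>: "\<delta> \<in> {0..\<delta>bar}" and f: "prob_density f" "AE x in lebesgue. L \<delta> f x = f x" for \<delta> f
  proof -
    have fi: "integrable circ f" "periodic f" "(\<integral>x. f x \<partial>circ) = 1"
      using f by (auto simp: prob_density_def L1_circle_iff circle_integral_circ)
    have "AE x in circ. L \<delta> f x = f x"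
      using f(2) by (subst AE_restrict_space_iff) (auto elim: eventually_mono)
    then have "AE x in circ. kop (k \<delta> 0) f x = f x" by (simp add: L_kop[OF \<delta> fi(1)])
    from markov_kernel.stationary_density_unique[OF k_markov[OF \<delta>] fi(1) this hi[OF \<delta>] h(2)[OF \<delta>]]
    have "AE x in circ. f x = h \<delta> x" using h(4)[OF \<delta>] fi(3) by simp
    then show ?thesis
      using fi(2) smooth_circle_C[OF h(1)[OF \<delta>], of 0]
      by (intro AE_circ_imp_AE_lebesgue) (auto simp: periodic_def C_circle_def)
  qed
  have L0: "L 0 f = R.A f" if "integrable circ f" for f
    by (rule L_kop[OF z that])
  have resolvent_defined: "resolvent_well_defined (L 0) n" for n
    by (rule R.resolvent_well_defined_cong[OF L0])
  have res: "resolvent (L 0) n = resolvent R.A n" for n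
    by (intro resolvent_cong L0 R.zero_avg_integrable)
  have resp: "let h1 = resolvent (L 0) (k - 1) (Ldot (h 0));
          v = (\<lambda>x. 1 / 2 * Lddot (h 0) x + Ldot h1 x);
          h2 = resolvent (L 0) (k - 2) v
      in Ldot (h 0) \<in> zero_avg (k - 1) \<and> v \<in> zero_avg (k - 2) \<and>
         ((\<lambda>\<delta>. C_norm (k - 1) (\<lambda>x. (h \<delta> x - h 0 x) / \<delta> - h1 x)) \<longlongrightarrow> 0) (at_right 0) \<and>
         ((\<lambda>\<delta>. C_norm (k - 2) (\<lambda>x. (h \<delta> x - h 0 x - \<delta> * h1 x) / \<delta>\<^sup>2 - h2 x)) \<longlongrightarrow> 0) (at_right 0)"
    for k :: nat
  proof -
    define h1 where "h1 = resolvent R.A (k - 1) (Ldot (h 0))"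
    define v where "v = (\<lambda>x. 1 / 2 * Lddot (h 0) x + Ldot h1 x)"
    define h2 where "h2 = resolvent R.A (k - 2) v"
    note hz = hi[OF z]
    have w: "Ldot (h 0) \<in> zero_avg (k - 1)"
      unfolding Ldot_kop[OF hz] by (rule R.D_zero_avg(1)[OF hz])
    have h1: "h1 \<in> zero_avg (k - 1)" "h1 x - R.A h1 x = kop (k1 0) (h 0) x" for x
      using R.resolvent_in[OF w] R.resolvent_eq[OF w, of x] by (simp_all add: h1_def Ldot_kop[OF hz])
    have h1i: "integrable circ h1" by (rule R.zero_avg_integrable[OF h1(1)])
    have h1': "h1 \<in> zero_avg (k - 2)"
      using h1(1) by (auto simp: R.zero_avg_iff intro: C_circle_mono)
    note Dz = R.D_zero_avg(2)[OF hz, of "k - 2"] R.D_zero_avg(1)[OF h1i, of "k - 2"]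
    have v: "v \<in> zero_avg (k - 2)"
    proof -
      have "(\<lambda>x. 1 / 2 * kop (k2 0) (h 0) x + 1 * kop (k1 0) h1 x) \<in> C_circle (k - 2)"
        using Dz by (intro C_circle_lincomb) (simp_all add: R.zero_avg_iff)
      moreover have "(\<integral>x. 1 / 2 * kop (k2 0) (h 0) x + kop (k1 0) h1 x \<partial>circ) = 0"
        using Dz Dz[THEN R.zero_avg_integrable] by (simp add: R.zero_avg_iff)
      ultimately show ?thesis
        by (simp add: v_def Lddot_kop[OF hz] Ldot_kop[OF h1i] R.zero_avg_iff)
    qed
    have h2: "h2 \<in> zero_avg (k - 2)"
      "h2 x - R.A h2 x = 1 / 2 * kop (k2 0) (h 0) x + kop (k1 0) h1 x" for x
      using R.resolvent_in[OF v] R.resolvent_eq[OF v, of x]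
      by (simp_all add: h2_def) (simp add: v_def Lddot_kop[OF hz] Ldot_kop[OF h1i])
    show ?thesis
      unfolding Let_def res h1_def[symmetric] v_def[symmetric] h2_def[symmetric]
      by (intro conjI w v R.linear_response[OF h1] R.quadratic_response[OF h1' h1(2) h2])
  qed
  show ?thesis
    using part1 density stationary unique smooth_circle_C[OF h(1)] resolvent_defined resp
    by (intro conjI ballI exI[of _ h] allI impI) blast+
qed

end
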